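(* Let $d\ge1$. Assume that $W$ satisfies hypothesis (H-s) stated in the context, that $W\in C^4(\mathbb{R}^d\setminus\{0\})$ is radially symmetric, that the interaction energy $E$ associated to $W$ is LIC, that $$\Delta^2W(x)<0\quad\text{for all }x\neq0,$$ and that $\Delta W(x)>0$ for all $|x|$ sufficiently large. Let $\rho$ be a compactly supported $d_\infty$-local minimizer of $E$ with zero center of mass such that $\nabla W*\rho$ is continuous. Then $\rho$ is the unique global minimizer of $E$ over the set of measures in $\mathcal{P}_2(\mathbb{R}^d)$ with zero center of mass.
   Context: $\mathcal{P}(\mathbb{R}^d)$: Borel probability measures on $\mathbb{R}^d$; $\mathcal{P}_2(\mathbb{R}^d)$: those with finite second moment. $E[\rho]=\frac12\int\int W(x-y)\,d\rho(y)\,d\rho(x)$ (also used for signed measures). Hypothesis (H-s): $W:\mathbb{R}^d\to(-\infty,\infty]$ is locally integrable, bounded below (normalized so that $W\ge0$), lower semicontinuous and symmetric ($W(x)=W(-x)$); $W$ is either continuous on $\mathbb{R}^d\setminus\{0\}$ with $W(0)=+\infty$, or $W\in C(\mathbb{R}^d)$; and for all $R>0$ there is $C_R>0$ such that $\frac{1}{|B(x;r)|}\int_{B(x;r)}W(y)\,dy\le C_RW(x)$ for all $|x|\le R$, $0<r\le R$. $d_\infty(\mu,\nu)=\inf_{\pi\in\Pi(\mu,\nu)}\sup_{(x,y)\in\operatorname{supp}\pi}|x-y|$ for compactly supported $\mu,\nu$ ($\Pi(\mu,\nu)$: transport plans). $\rho$ is a $d_\infty$-local minimizer of $E$ if there is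 $\epsilon>0$ with $E[\rho]\le E[\nu]$ for all compactly supported $\nu\in\mathcal{P}(\mathbb{R}^d)$ with $d_\infty(\rho,\nu)<\epsilon$. LIC: for all $\rho_0\ne\rho_1$ in $\mathcal{P}_2(\mathbb{R}^d)$ with the same center of mass and $E[\rho_0],E[\rho_1]<\infty$, the function $t\mapsto E[(1-t)\rho_0+t\rho_1]$ is strictly convex on $[0,1]$; equivalently, $E[\mu]>0$ for every nonzero finite signed measure $\mu$ (with finite second moment) such that $\int d\mu=0$, $\int x\,d\mu=0$, $E[|\mu|]<\infty$. *)

theory Defs
  imports "HOL-Probability.Probability"
begin

section \<open>Differential operators\<close>

definition partial_deriv :: "'a \<Rightarrow> ('a::euclidean_space \<Rightarrow> real) \<Rightarrow> 'a \<Rightarrow> real" where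
  "partial_deriv b f x = frechet_derivative f (at x) b"

definition gradient :: "('a::euclidean_space \<Rightarrow> real) \<Rightarrow> 'a \<Rightarrow> 'a" where
  "gradient f x = (\<Sum>b\<in>Basis. partial_deriv b f x *\<^sub>R b)"

definition laplacian :: "('a::euclidean_space \<Rightarrow> real) \<Rightarrow> 'a \<Rightarrow> real" where
  "laplacian f x = (\<Sum>b\<in>Basis. partial_deriv b (partial_deriv b f) x)"

text \<open>\<open>Ck_on k f S\<close>: \<open>f\<close> is of class \<open>C^k\<close> on \<open>S\<close>. This is only meant for open \<open>S\<close>, because
  \<^const>\<open>partial_deriv\<close> takes derivatives with respect to the full neighbourhood of a point.\<close>

primrec Ck_on :: "nat \<Rightarrow> ('a::euclidean_space \<Rightarrow> real) \<Rightarrow> 'a set \<Rightarrow> bool" where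
  "Ck_on 0 f S \<longleftrightarrow> continuous_on S f"
| "Ck_on (Suc k) f S \<longleftrightarrow> f differentiable_on S \<and> (\<forall>b\<in>Basis. Ck_on k (partial_deriv b f) S)"

section \<open>Borel probability measures\<close>

definition borel_prob :: "'a::euclidean_space measure set" where
  "borel_prob = {\<mu>. prob_space \<mu> \<and> sets \<mu> = sets borel}"

definition borel_prob2 :: "'a::euclidean_space measure set" where
  "borel_prob2 = {\<mu> \<in> borel_prob. integrable \<mu> (\<lambda>x. (norm x)\<^sup>2)}"

definition center_of_mass :: "'a::euclidean_space measure \<Rightarrow> 'a" where
  "center_of_mass \<mu> = (\<integral>x. x \<partial>\<mu>)"

definition measure_supp :: "'a::topological_space measure \<Rightarrow> 'a set" where
  "measure_supp \<mu> = {x. \<forall>U. open U \<and> x \<in> U \<longrightarrow> emeasure \<mu> U > 0}"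

definition compactly_supported :: "'a::euclidean_space measure \<Rightarrow> bool" where
  "compactly_supported \<mu> \<longleftrightarrow> compact (measure_supp \<mu>)"

definition mix_measure :: "real \<Rightarrow> 'a::euclidean_space measure \<Rightarrow> 'a measure \<Rightarrow> 'a measure" where
  "mix_measure t \<mu> \<nu> = measure_of UNIV (sets borel)
     (\<lambda>A. ennreal (1 - t) * emeasure \<mu> A + ennreal t * emeasure \<nu> A)"

lemma emeasure_mix_measure:
  assumes "sets \<mu> = sets borel" "sets \<nu> = sets borel" "A \<in> sets borel"
  shows "emeasure (mix_measure t \<mu> \<nu>) A
           = ennreal (1 - t) * emeasure \<mu> A + ennreal t * emeasure \<nu> A"
proof -
  have ca: "countably_additive (sets borel)
     (\<lambda>A. ennreal (1 - t) * emeasure \<mu> A + ennreal t * emeasure \<nu> A)"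
  proof (rule countably_additiveI)
    fix F :: "nat \<Rightarrow> 'a set"
    assume F: "range F \<subseteq> sets borel" "disjoint_family F"
    have "(\<Sum>i. ennreal (1 - t) * emeasure \<mu> (F i) + ennreal t * emeasure \<nu> (F i))
        = ennreal (1 - t) * (\<Sum>i. emeasure \<mu> (F i)) + ennreal t * (\<Sum>i. emeasure \<nu> (F i))"
      by (simp add: suminf_add[symmetric])
    also have "\<dots> = ennreal (1 - t) * emeasure \<mu> (\<Union>i. F i) + ennreal t * emeasure \<nu> (\<Union>i. F i)"
      using F assms(1,2) by (simp add: suminf_emeasure)
    finally show "(\<Sum>i. ennreal (1 - t) * emeasure \<mu> (F i) + ennreal t * emeasure \<nu> (F i))
        = ennreal (1 - t) * emeasure \<mu> (\<Union>i. F i) + ennreal t * emeasure \<nu> (\<Union>i. F i)" .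
  qed
  have sa: "sigma_algebra UNIV (sets (borel :: 'a measure))"
    using sets.sigma_algebra_axioms[of "borel :: 'a measure"] by simp
  show ?thesis
    unfolding mix_measure_def
    by (rule emeasure_measure_of_sigma[OF sa _ ca assms(3)]) (simp add: positive_def)
qed

section \<open>The distance \<open>d_\<infinity>\<close>\<close>

definition couplings ::
    "'a::euclidean_space measure \<Rightarrow> 'a measure \<Rightarrow> ('a \<times> 'a) measure set" where
  "couplings \<mu> \<nu> =
     {\<pi> \<in> borel_prob. distr \<pi> borel fst = \<mu> \<and> distr \<pi> borel snd = \<nu>}"

text \<open>The value is an \<^typ>\<open>ennreal\<close> so that infimum and supremum are always meaningful; it is finite
  for compactly supported probability measures.\<close>

definition d_infty :: "'a::euclidean_space measure \<Rightarrow> 'a measure \<Rightarrow> ennreal" where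
  "d_infty \<mu> \<nu> = (INF \<pi>\<in>couplings \<mu> \<nu>. SUP (x, y)\<in>measure_supp \<pi>. ennreal (norm (x - y)))"

section \<open>Interaction energy\<close>

text \<open>Potentials have type \<^typ>\<open>'a \<Rightarrow> ereal\<close>. They are only ever used under the normalization
  \<open>W \<ge> 0\<close>, for which \<^const>\<open>e2ennreal\<close> is the identity embedding.\<close>

definition energy :: "('a::euclidean_space \<Rightarrow> ereal) \<Rightarrow> 'a measure \<Rightarrow> ennreal" where
  "energy W \<mu> = (\<integral>\<^sup>+x. (\<integral>\<^sup>+y. e2ennreal (W (x - y)) \<partial>\<mu>) \<partial>\<mu>) / 2"

definition real_continuous_on :: "'a::euclidean_space set \<Rightarrow> ('a \<Rightarrow> ereal) \<Rightarrow> bool" where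
  "real_continuous_on S W \<longleftrightarrow> (\<forall>x\<in>S. \<bar>W x\<bar> \<noteq> \<infinity>) \<and> continuous_on S W"

definition hypothesis_Hs :: "('a::euclidean_space \<Rightarrow> ereal) \<Rightarrow> bool" where
  "hypothesis_Hs W \<longleftrightarrow>
     (\<forall>x. 0 \<le> W x) \<and>
     W \<in> borel_measurable borel \<and>
     (\<forall>K. compact K \<longrightarrow> (\<integral>\<^sup>+x\<in>K. e2ennreal (W x) \<partial>lborel) < \<infinity>) \<and>
     (\<forall>x. W x \<le> Liminf (at x) W) \<and>
     (\<forall>x. W (- x) = W x) \<and>
     (real_continuous_on (- {0}) W \<and> W 0 = \<infinity> \<or> real_continuous_on UNIV W) \<and>
     (\<forall>R>0. \<exists>C>0. \<forall>x r. norm x \<le> R \<and> 0 < r \<and> r \<le> R \<longrightarrow>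
        (\<integral>\<^sup>+y\<in>ball x r. e2ennreal (W y) \<partial>lborel) / emeasure lborel (ball x r)
          \<le> ennreal C * e2ennreal (W x))"

definition radially_symmetric :: "('a::euclidean_space \<Rightarrow> 'b) \<Rightarrow> bool" where
  "radially_symmetric W \<longleftrightarrow> (\<forall>x y. norm x = norm y \<longrightarrow> W x = W y)"

text \<open>For a function that is finite at the endpoints, the strict inequality forces finiteness on
  the whole interval.\<close>

definition strictly_convex_on :: "real set \<Rightarrow> (real \<Rightarrow> ennreal) \<Rightarrow> bool" where
  "strictly_convex_on I f \<longleftrightarrow>
     (\<forall>s\<in>I. \<forall>t\<in>I. \<forall>u. s \<noteq> t \<and> 0 < u \<and> u < 1 \<longrightarrow>
        f ((1 - u) * s + u * t) < ennreal (1 - u) * f s + ennreal u * f t)"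

definition LIC :: "('a::euclidean_space \<Rightarrow> ereal) \<Rightarrow> bool" where
  "LIC W \<longleftrightarrow>
     (\<forall>\<rho>0\<in>borel_prob2. \<forall>\<rho>1\<in>borel_prob2.
        \<rho>0 \<noteq> \<rho>1 \<and> center_of_mass \<rho>0 = center_of_mass \<rho>1 \<and>
        energy W \<rho>0 < \<infinity> \<and> energy W \<rho>1 < \<infinity> \<longrightarrow>
        strictly_convex_on {0..1} (\<lambda>t. energy W (mix_measure t \<rho>0 \<rho>1)))"

definition d_infty_local_minimizer ::
    "('a::euclidean_space \<Rightarrow> ereal) \<Rightarrow> 'a measure \<Rightarrow> bool" where
  "d_infty_local_minimizer W \<rho> \<longleftrightarrow>
     (\<exists>\<epsilon>>0. \<forall>\<nu>\<in>borel_prob. compactly_supported \<nu> \<and> d_infty \<rho> \<nu> < ennreal \<epsilon> \<longrightarrow>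
        energy W \<rho> \<le> energy W \<nu>)"

text \<open>Since \<open>\<nabla>W\<close> is only given off the origin, the convolution \<open>\<nabla>W * \<rho>\<close> is defined almost
  everywhere; its continuity means that it has a continuous representative. The value of
  \<^const>\<open>gradient\<close> at \<open>0\<close> is immaterial, as \<open>\<rho>\<close> has at most countably many atoms.\<close>

definition grad_conv_continuous ::
    "('a::euclidean_space \<Rightarrow> real) \<Rightarrow> 'a measure \<Rightarrow> bool" where
  "grad_conv_continuous w \<rho> \<longleftrightarrow>
     (\<exists>g. continuous_on UNIV g \<and>
        (AE x in lborel. integrable \<rho> (\<lambda>y. gradient w (x - y)) \<and>
           g x = (\<integral>y. gradient w (x - y) \<partial>\<rho>)))"

end

theory Submission
  imports Defs
begin

text \<open>
  Write \<open>v = W * \<rho>\<close> for the potential of \<open>\<rho>\<close>, \<open>K\<close> for its support and \<open>d\<close> for the dimension. The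
  core of the proof is that \<open>v\<close> equals a constant \<open>C\<close> on \<open>K\<close> and that \<open>v \<ge> C\<close> everywhere
  (\<open>potential_minimal_on_supp\<close>). Given this, linear interpolation convexity finishes the argument
  (\<open>energy_less_competitor\<close>): the energy of a mixture \<open>(1-t) \<rho> + t \<nu>\<close> is a quadratic polynomial in
  \<open>t\<close> whose cross term is \<open>\<integral> v d\<nu> \<ge> C = 2 E[\<rho>]\<close>, and this is incompatible with strict convexity
  unless \<open>E[\<nu>] > E[\<rho>]\<close>.

  The first step is regularity. The identity \<open>\<nabla>v = g\<close>, where \<open>g\<close> is the continuous representative of \<open>\<nabla>W * \<rho>\<close>,
  has to be proved, because \<open>W\<close> may be singular at the origin. As \<open>\<Delta>\<^sup>2W < 0\<close>, the function
  \<open>r^(d-1) \<partial>\<^sub>r(\<Delta>W)\<close> decreases in \<open>r\<close>; two applications of the mean value theorem bound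
  \<open>r^(d-1) \<partial>\<^sub>rW\<close> from below near \<open>0\<close>, and together with \<open>W \<ge> 0\<close> this makes \<open>\<nabla>W\<close> locally integrable
  (\<open>integrable_radial_gradient\<close>). So averages of \<open>v\<close> over small balls have the averages of \<open>g\<close> as
  gradient. The averaging condition in (H-s) lets dominated convergence pass to the limit of zero
  radius at every point where \<open>v\<close> is finite, Fatou's lemma treats the other points, and the
  outcome is that \<open>v\<close> is finite and \<open>C^1\<close> everywhere with gradient \<open>g\<close>
  (\<open>pot_finite_and_diff\<close>, \<open>v_has_derivative\<close>).

  The second step exploits local minimality. Moving the mass of a small ball around a point \<open>x\<close> of \<open>K\<close> by a vector
  \<open>z\<close> with \<open>|z| < \<epsilon>\<close> is a competitor close to \<open>\<rho>\<close>; the first variation gives \<open>v x \<le> v (x + z)\<close>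
  (\<open>euler_lagrange\<close>), and therefore \<open>\<nabla>v = 0\<close> on \<open>K\<close>. If \<open>T\<close> is a rotation close to the identity and
  \<open>T\<rho> \<noteq> \<rho>\<close>, then strict convexity would give \<open>(\<rho> + T\<rho>)/2\<close>, which is also close to \<open>\<rho>\<close>, less energy than \<open>\<rho>\<close>;
  so \<open>T\<rho> = \<rho>\<close>. For \<open>d \<ge> 2\<close>, spheres are connected, and \<open>v\<close> and \<open>K\<close> are invariant under all rotations (\<open>radial\<close>).

  The problem is now one-dimensional: study \<open>v\<close> along a ray if \<open>d \<ge> 2\<close> and along the whole line
  if \<open>d = 1\<close>. Off \<open>K\<close> the potential is \<open>C^4\<close> and \<open>\<Delta>\<^sup>2v < 0\<close>, so \<open>r^(d-1) \<partial>\<^sub>r(\<Delta>v)\<close> decreases on every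
  interval that avoids \<open>K\<close>. A function with this property has no interior minimum: it is
  quasi-concave. At an end point of the interval that belongs to \<open>K\<close> the flux
  \<open>r^(d-1) \<partial>\<^sub>rv\<close> vanishes and \<open>v\<close> has a local minimum, so \<open>\<Delta>v\<close> cannot be negative throughout a neighbourhood of that end; for
  large \<open>r\<close> it is positive by assumption. Hence \<open>\<Delta>v > 0\<close> on the whole interval, and the flux, whose derivative is
  \<open>r^(d-1) \<Delta>v\<close>, increases strictly. On a bounded gap the flux vanishes at both
  ends, which is a contradiction (\<open>no_bounded_gap\<close>); a gap around the origin is excluded in the
  same way, since the flux vanishes at \<open>0\<close>. So \<open>K\<close> is a ball (an interval if \<open>d = 1\<close>), \<open>v\<close> is constant
  on it because \<open>\<nabla>v = 0\<close> there, and \<open>v\<close> increases outwards from it (\<open>outer_monotone\<close>).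
\<close>

section \<open>Functions of class \<open>C^k\<close> and their gradients\<close>

text \<open>Partial derivatives are local, although \<^const>\<open>partial_deriv\<close> is defined through a choice
  operator: two functions that agree near \<open>x\<close> have the same set of Frechet derivatives at \<open>x\<close>.\<close>

lemma partial_deriv_cong:
  assumes "open S" "x \<in> S" "\<And>y. y \<in> S \<Longrightarrow> f y = g y"
  shows "partial_deriv b f x = partial_deriv b g x"
proof -
  have "(f has_derivative D) (at x) \<longleftrightarrow> (g has_derivative D) (at x)" for D
    using has_derivative_transform_within_open[OF _ assms(1,2), of f D UNIV g]
      has_derivative_transform_within_open[OF _ assms(1,2), of g D UNIV f] assms(3)
    by auto
  then show ?thesis
    unfolding partial_deriv_def frechet_derivative_def by simp
qed

lemma differentiable_on_cong:
  assumes "\<And>x. x \<in> S \<Longrightarrow> f x = g x"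
  shows "f differentiable_on S \<longleftrightarrow> g differentiable_on S"
proof -
  have "g differentiable_on S" if "f differentiable_on S" "\<And>x. x \<in> S \<Longrightarrow> f x = g x" for f g :: "'a \<Rightarrow> 'b"
    unfolding differentiable_on_def
  proof
    fix x assume x: "x \<in> S"
    have "f differentiable (at x within S)" using x that(1) unfolding differentiable_on_def by blast
    then obtain D where "(f has_derivative D) (at x within S)"
      unfolding differentiable_def by (elim exE)
    then have "(g has_derivative D) (at x within S)"
      using has_derivative_transform[OF x, of g f D] that(2) by auto
    then show "g differentiable (at x within S)" unfolding differentiable_def by blast
  qed
  from this[of f g] this[of g f] show ?thesis using assms by auto
qed

lemma Ck_on_cong:
  assumes "open S" "\<And>x. x \<in> S \<Longrightarrow> f x = g x"
  shows "Ck_on k f S \<longleftrightarrow> Ck_on k g S"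
  using assms(2)
proof (induction k arbitrary: f g)
  case 0
  then show ?case by (simp cong: continuous_on_cong)
next
  case (Suc k)
  have "Ck_on k (partial_deriv b f) S \<longleftrightarrow> Ck_on k (partial_deriv b g) S" for b
    by (rule Suc.IH) (rule partial_deriv_cong[OF assms(1)], use Suc.prems in auto)
  moreover have "f differentiable_on S \<longleftrightarrow> g differentiable_on S"
    by (rule differentiable_on_cong) (use Suc.prems in auto)
  ultimately show ?case by simp
qed

lemma Ck_on_continuous: "Ck_on k f S \<Longrightarrow> continuous_on S f"
  by (cases k) (auto intro: differentiable_imp_continuous_on)

lemma Ck_on_partial:
  "Ck_on (Suc k) f S \<Longrightarrow> b \<in> Basis \<Longrightarrow> Ck_on k (partial_deriv b f) S"
  by simp

lemma Ck_on_lower: "Ck_on (Suc k) f S \<Longrightarrow> Ck_on k f S"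
proof (induction k arbitrary: f)
  case 0 then show ?case by (simp add: differentiable_imp_continuous_on)
next
  case (Suc k)
  have "Ck_on k (partial_deriv b f) S" if "b \<in> Basis" for b
    using Suc.IH Ck_on_partial[OF Suc.prems that] by blast
  then show ?case using Suc.prems by simp
qed

lemma has_derivative_gradient:
  fixes f :: "'a::euclidean_space \<Rightarrow> real"
  assumes "f differentiable (at x)"
  shows "(f has_derivative (\<lambda>z. gradient f x \<bullet> z)) (at x)"
proof -
  let ?D = "frechet_derivative f (at x)"
  have D: "(f has_derivative ?D) (at x)" using assms frechet_derivative_works by blast
  then interpret linear ?D using has_derivative_linear by blast
  have "?D z = gradient f x \<bullet> z" for z
  proof -
    have "?D z = ?D (\<Sum>b\<in>Basis. (z \<bullet> b) *\<^sub>R b)" by (simp add: euclidean_representation)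
    also have "\<dots> = (\<Sum>b\<in>Basis. (z \<bullet> b) * ?D b)" by (simp add: sum scale)
    also have "\<dots> = gradient f x \<bullet> z"
      unfolding gradient_def partial_deriv_def inner_sum_left
      by (intro sum.cong) (auto simp: inner_commute)
    finally show ?thesis .
  qed
  then have "?D = (\<lambda>z. gradient f x \<bullet> z)" by auto
  with D show ?thesis by simp
qed

lemma partial_deriv_eqI:
  "(f has_derivative D) (at x) \<Longrightarrow> partial_deriv b f x = D b"
  unfolding partial_deriv_def using frechet_derivative_at by metis

lemma gradient_inner_Basis: "b \<in> Basis \<Longrightarrow> gradient f x \<bullet> b = partial_deriv b f x"
  unfolding gradient_def by simp

lemma Ck_on_differentiable:
  assumes "open S" "x \<in> S" "Ck_on (Suc k) f S"
  shows "f differentiable (at x)"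
proof -
  have "f differentiable_on S" using assms(3) by simp
  then show ?thesis using assms(1,2)
    by (simp add: differentiable_on_eq_differentiable_at)
qed

lemma Ck_on_has_derivative:
  fixes f :: "'a::euclidean_space \<Rightarrow> real"
  assumes "open S" "x \<in> S" "Ck_on (Suc k) f S"
  shows "(f has_derivative (\<lambda>z. gradient f x \<bullet> z)) (at x)"
  using Ck_on_differentiable[OF assms] by (rule has_derivative_gradient)

text \<open>The induction needs \<open>Ck_on_cong\<close>: the partial derivative of a sum is the sum of the partial
  derivatives on \<open>S\<close> only, not as a function on the whole space.\<close>

lemma Ck_on_add:
  fixes f g :: "'a::euclidean_space \<Rightarrow> real"
  assumes "open S" "Ck_on k f S" "Ck_on k g S"
  shows "Ck_on k (\<lambda>x. f x + g x) S"
  using assms(2,3)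
proof (induction k arbitrary: f g)
  case 0 then show ?case by (simp add: continuous_on_add)
next
  case (Suc k)
  have "Ck_on k (partial_deriv b (\<lambda>x. f x + g x)) S" if b: "b \<in> Basis" for b
  proof -
    have "Ck_on k (\<lambda>x. partial_deriv b f x + partial_deriv b g x) S"
      by (rule Suc.IH) (use Suc.prems b in auto)
    moreover have "partial_deriv b (\<lambda>x. f x + g x) x = partial_deriv b f x + partial_deriv b g x"
      if x: "x \<in> S" for x
      using partial_deriv_eqI[OF has_derivative_add[OF Ck_on_has_derivative[OF assms(1) x Suc.prems(1)]
          Ck_on_has_derivative[OF assms(1) x Suc.prems(2)]], of b] b
      by (simp add: gradient_inner_Basis)
    ultimately show ?thesis using Ck_on_cong[OF assms(1)] by (metis (no_types, lifting))
  qed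
  moreover have "(\<lambda>x. f x + g x) differentiable_on S" using Suc.prems by (simp add: differentiable_on_add)
  ultimately show ?case by simp
qed

lemma Ck_on_const: "Ck_on k (\<lambda>x. c) (S :: 'a::euclidean_space set)"
proof (induction k arbitrary: c)
  case (Suc k)
  have "partial_deriv b (\<lambda>x::'a. c) = (\<lambda>x. 0)" for b :: 'a
    by (rule ext) (use partial_deriv_eqI[OF has_derivative_const] in auto)
  then show ?case using Suc by (simp add: differentiable_on_const)
qed simp

lemma Ck_on_sum:
  fixes f :: "'i \<Rightarrow> 'a::euclidean_space \<Rightarrow> real"
  assumes "open S" "\<And>i. i \<in> I \<Longrightarrow> Ck_on k (f i) S" 
  shows "Ck_on k (\<lambda>x. \<Sum>i\<in>I. f i x) S"
proof (cases "finite I")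
  case True
  then show ?thesis using assms(2)
    by (induction I) (auto simp: Ck_on_const intro: Ck_on_add[OF assms(1)])
qed (simp add: Ck_on_const)

lemma Ck_on_laplacian:
  assumes "open S" "Ck_on (Suc (Suc k)) f S"
  shows "Ck_on k (laplacian f) S"
  unfolding laplacian_def[abs_def]
  by (rule Ck_on_sum[OF assms(1)]) (use assms(2) in simp)

section \<open>Radial functions along a ray\<close>

lemma line_has_derivative:
  fixes F :: "'a::euclidean_space \<Rightarrow> real"
  assumes "F differentiable (at (r *\<^sub>R e))"
  shows "((\<lambda>s. F (s *\<^sub>R e)) has_real_derivative gradient F (r *\<^sub>R e) \<bullet> e) (at r)"
proof -
  have "((\<lambda>s. s *\<^sub>R e) has_derivative (\<lambda>s. s *\<^sub>R e)) (at r)"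
    by (auto intro!: derivative_eq_intros)
  from has_derivative_compose[OF this has_derivative_gradient[OF assms]]
  show ?thesis by (simp add: has_field_derivative_def mult_commute_abs)
qed

lemma line_gradient_has_derivative:
  fixes F :: "'a::euclidean_space \<Rightarrow> real"
  assumes "open S" "Ck_on 2 F S" "r *\<^sub>R e \<in> S"
  shows "((\<lambda>s. gradient F (s *\<^sub>R e) \<bullet> e) has_real_derivative
     (\<Sum>b\<in>Basis. (gradient (partial_deriv b F) (r *\<^sub>R e) \<bullet> e) * (b \<bullet> e))) (at r)"
proof -
  have "Ck_on (Suc 0) (partial_deriv b F) S" if "b \<in> Basis" for b
    using assms(2) that by (simp add: numeral_2_eq_2)
  then show ?thesis
    unfolding gradient_def[of F] inner_sum_left inner_scaleR_left
    by (intro DERIV_sum DERIV_cmult_right line_has_derivative Ck_on_differentiable[OF assms(1,3)])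
qed

text \<open>In dimension one there are just two unit vectors, and a ray may point in either direction.\<close>

lemma DIM_1_Basis:
  assumes "DIM('a::euclidean_space) = 1" "norm (e::'a) = 1"
  shows "e \<in> Basis \<and> Basis = {e} \<or> - e \<in> Basis \<and> Basis = {- e}"
proof -
  obtain b :: 'a where b: "Basis = {b}" using assms(1) card_1_singletonE by blast
  have e: "(e \<bullet> b) *\<^sub>R b = e" using euclidean_representation[of e] unfolding b by simp
  have nb: "norm b = 1" using b norm_Basis[of b] by blast
  have "norm e = \<bar>e \<bullet> b\<bar>" by (metis e norm_scaleR nb mult.right_neutral)
  then have "e \<bullet> b = 1 \<or> e \<bullet> b = -1" using assms(2) by linarith
  then have "e = b \<or> e = - b" using e by (metis scaleR_one scaleR_minus1_left)
  then show ?thesis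
  proof
    assume "e = b" then show ?thesis unfolding b by blast
  next
    assume "e = - b" then have "b = - e" by simp
    then show ?thesis unfolding b by blast
  qed
qed

lemma norm_has_derivative:
  fixes x :: "'a::euclidean_space"
  assumes "x \<noteq> 0"
  shows "(norm has_derivative (\<lambda>z. (x \<bullet> z) / norm x)) (at x)"
  using has_derivative_norm[OF assms]
  by (simp add: sgn_div_norm inner_commute divide_inverse mult.commute)

text \<open>Near \<open>x\<close> the function is \<open>F y = F (norm y *\<^sub>R e)\<close>; the chain rule for the norm does the rest. The
  ray direction \<open>e\<close> is arbitrary, so radial profiles can be read off along any convenient ray.\<close>

lemma gradient_radial:
  fixes F :: "'a::euclidean_space \<Rightarrow> real"
  assumes S: "open S" and F: "\<And>x. x \<in> S \<Longrightarrow> F differentiable (at x)"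
    and rad: "\<And>x y. x \<in> S \<Longrightarrow> y \<in> S \<Longrightarrow> norm x = norm y \<Longrightarrow> F x = F y"
    and e: "norm e = 1" and x: "x \<in> S" "norm x *\<^sub>R e \<in> S" "x \<noteq> 0"
  shows "gradient F x = ((gradient F (norm x *\<^sub>R e) \<bullet> e) / norm x) *\<^sub>R x"
proof (rule euclidean_eqI)
  fix b :: 'a assume b: "b \<in> Basis"
  \<comment> \<open>a neighbourhood of \<open>x\<close> whose points \<open>y\<close> and their projections \<open>norm y *\<^sub>R e\<close> stay in \<open>S\<close>\<close>
  define N where "N = S \<inter> (\<lambda>y. norm y *\<^sub>R e) -` S"
  have "open ((\<lambda>y. norm y *\<^sub>R e) -` S)"
    by (intro open_vimage S continuous_intros)
  then have N: "open N" "x \<in> N" unfolding N_def using S x by auto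
  have Feq: "F y = F (norm y *\<^sub>R e)" if "y \<in> N" for y
    using that rad[of y "norm y *\<^sub>R e"] e by (simp add: N_def)
  let ?v1 = "gradient F (norm x *\<^sub>R e) \<bullet> e"
  have "((\<lambda>s. F (s *\<^sub>R e)) has_derivative (\<lambda>h. ?v1 * h)) (at (norm x))"
    using line_has_derivative[OF F[OF x(2)]] unfolding has_field_derivative_def .
  from has_derivative_compose[OF norm_has_derivative[OF x(3)] this]
  have "((\<lambda>x. F (norm x *\<^sub>R e)) has_derivative (\<lambda>z. ?v1 * (x \<bullet> z / norm x))) (at x)" .
  then have "(F has_derivative (\<lambda>z. ?v1 * (x \<bullet> z / norm x))) (at x)"
    by (rule has_derivative_transform_within_open[OF _ N]) (rule Feq[symmetric])
  from partial_deriv_eqI[OF this, of b]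
  show "gradient F x \<bullet> b = ((gradient F (norm x *\<^sub>R e) \<bullet> e) / norm x) *\<^sub>R x \<bullet> b"
    using b by (simp add: gradient_inner_Basis)
qed

text \<open>The divergence form of the radial Laplacian, \<open>(r^(d-1) F')' = r^(d-1) \<Delta>F\<close>. In dimension
  one the weight is \<open>r^0 = 1\<close> and the formula holds along the whole line for every \<open>C^2\<close> function, radial
  or not; stating both cases together lets one argument serve all dimensions later.\<close>

lemma laplacian_along_line:
  fixes F :: "'a::euclidean_space \<Rightarrow> real"
  assumes S: "open S" and F: "Ck_on 2 F S" and rS: "r *\<^sub>R e \<in> S" and e: "norm e = 1"
    and rad: "DIM('a) = 1 \<or> r > 0 \<and> (\<forall>x\<in>S. \<forall>y\<in>S. norm x = norm y \<longrightarrow> F x = F y)"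
  shows "((\<lambda>s. s ^ (DIM('a) - 1) * (gradient F (s *\<^sub>R e) \<bullet> e)) has_real_derivative
           r ^ (DIM('a) - 1) * laplacian F (r *\<^sub>R e)) (at r)"
proof (cases "DIM('a) = 1")
  case True
  have n: "DIM('a) - 1 = 0" using True by simp
  have D: "((\<lambda>s. gradient F (s *\<^sub>R e) \<bullet> e) has_real_derivative
     (\<Sum>b\<in>Basis. (gradient (partial_deriv b F) (r *\<^sub>R e) \<bullet> e) * (b \<bullet> e))) (at r)"
    by (rule line_gradient_has_derivative[OF S F rS])
  have "(\<Sum>b\<in>Basis. (gradient (partial_deriv b F) (r *\<^sub>R e) \<bullet> e) * (b \<bullet> e)) = laplacian F (r *\<^sub>R e)"
    using DIM_1_Basis[OF True e]
  proof
    assume *: "e \<in> Basis \<and> Basis = {e}"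
    then have "gradient (partial_deriv e F) (r *\<^sub>R e) \<bullet> e
        = partial_deriv e (partial_deriv e F) (r *\<^sub>R e)"
      by (intro gradient_inner_Basis) simp
    moreover have B: "Basis = {e}" using * by blast
    moreover have "e \<bullet> e = 1" using e by (simp add: norm_eq_1)
    ultimately show ?thesis unfolding laplacian_def B by simp
  next
    assume *: "- e \<in> Basis \<and> Basis = {- e}"
    then have "gradient (partial_deriv (- e) F) (r *\<^sub>R e) \<bullet> (- e)
        = partial_deriv (- e) (partial_deriv (- e) F) (r *\<^sub>R e)"
      by (intro gradient_inner_Basis) simp
    moreover have B: "Basis = {- e}" using * by blast
    moreover have "e \<bullet> e = 1" using e by (simp add: norm_eq_1)
    ultimately show ?thesis unfolding laplacian_def B by simp
  qed
  with D n show ?thesis by simp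
next
  case False
  then have r: "r > 0" and radF: "\<And>x y. x \<in> S \<Longrightarrow> y \<in> S \<Longrightarrow> norm x = norm y \<Longrightarrow> F x = F y"
    using rad by blast+
  define x0 where "x0 = r *\<^sub>R e"
  define n where "n = DIM('a) - 1"
  have nd: "real DIM('a) = real n + 1" unfolding n_def using DIM_positive[where 'a='a] by linarith
  have x0: "norm x0 = r" "x0 \<noteq> 0" unfolding x0_def using r e by auto
  define v1 where "v1 s = gradient F (s *\<^sub>R e) \<bullet> e" for s
  obtain v2 where v2: "(v1 has_real_derivative v2) (at r)"
    unfolding v1_def using line_gradient_has_derivative[OF S F rS] by blast
  \<comment> \<open>a neighbourhood of \<open>x0\<close> whose points \<open>x\<close> and their projections \<open>norm x *\<^sub>R e\<close> stay in \<open>S\<close>\<close>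
  define N where "N = S \<inter> (\<lambda>x. norm x *\<^sub>R e) -` S \<inter> - {0}"
  have "open ((\<lambda>x. norm x *\<^sub>R e) -` S)"
    by (intro open_vimage S continuous_intros)
  then have N: "open N" unfolding N_def using S by auto
  have x0N: "x0 \<in> N" unfolding N_def using x0 rS by (auto simp: x0_def)
  have F2: "Ck_on (Suc 1) F S" using F by (simp add: numeral_2_eq_2)
  have grad: "partial_deriv b F x = v1 (norm x) * (x \<bullet> b) / norm x"
    if x: "x \<in> N" and b: "b \<in> Basis" for x b
  proof -
    have x': "x \<in> S" "norm x *\<^sub>R e \<in> S" "x \<noteq> 0" using x by (auto simp: N_def)
    have "gradient F x = (v1 (norm x) / norm x) *\<^sub>R x"
      unfolding v1_def
      by (rule gradient_radial[OF S Ck_on_differentiable[OF S _ F2] radF e x'])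
    then have "gradient F x \<bullet> b = v1 (norm x) * (x \<bullet> b) / norm x" by simp
    then show ?thesis by (simp only: gradient_inner_Basis[OF b])
  qed
  have second: "partial_deriv b (partial_deriv b F) x0
      = v2 * (x0 \<bullet> b)\<^sup>2 / r\<^sup>2 + v1 r / r - v1 r * (x0 \<bullet> b)\<^sup>2 / r ^ 3" if b: "b \<in> Basis" for b
  proof -
    have "partial_deriv b (partial_deriv b F) x0
        = partial_deriv b (\<lambda>x. v1 (norm x) * (x \<bullet> b) / norm x) x0"
      by (rule partial_deriv_cong[OF N x0N]) (rule grad[OF _ b])
    also have "\<dots> = v2 * (x0 \<bullet> b)\<^sup>2 / r\<^sup>2 + v1 r / r - v1 r * (x0 \<bullet> b)\<^sup>2 / r ^ 3"
    proof -
      have "(v1 has_derivative (\<lambda>h. v2 * h)) (at (norm x0))"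
        using v2 x0 unfolding has_field_derivative_def by simp
      from has_derivative_compose[OF norm_has_derivative[OF x0(2)] this]
      have d1: "((\<lambda>x. v1 (norm x)) has_derivative (\<lambda>z. v2 * ((x0 \<bullet> z) / norm x0))) (at x0)" .
      have d2: "((\<lambda>x. x \<bullet> b) has_derivative (\<lambda>z. z \<bullet> b)) (at x0)"
        by (auto intro!: derivative_eq_intros)
      from has_derivative_divide'[OF has_derivative_mult[OF d1 d2] norm_has_derivative[OF x0(2)]]
      have "((\<lambda>x. v1 (norm x) * (x \<bullet> b) / norm x) has_derivative
         (\<lambda>h. ((v1 (norm x0) * (h \<bullet> b) + v2 * ((x0 \<bullet> h) / norm x0) * (x0 \<bullet> b)) * norm x0
            - v1 (norm x0) * (x0 \<bullet> b) * ((x0 \<bullet> h) / norm x0)) / (norm x0 * norm x0))) (at x0)"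
        using x0(2) by simp
      from partial_deriv_eqI[OF this, of b]
      have "partial_deriv b (\<lambda>x. v1 (norm x) * (x \<bullet> b) / norm x) x0
        = ((v1 r + v2 * ((x0 \<bullet> b) / r) * (x0 \<bullet> b)) * r - v1 r * (x0 \<bullet> b) * ((x0 \<bullet> b) / r)) / (r * r)"
        using b by (simp add: x0(1))
      also have "\<dots> = v2 * (x0 \<bullet> b)\<^sup>2 / r\<^sup>2 + v1 r / r - v1 r * (x0 \<bullet> b)\<^sup>2 / r ^ 3"
        using r by (simp add: field_simps power2_eq_square power3_eq_cube)
      finally show ?thesis .
    qed
    finally show ?thesis .
  qed
  have sq: "(\<Sum>b\<in>Basis. (x0 \<bullet> b)\<^sup>2) = r\<^sup>2"
    unfolding x0(1)[symmetric] power2_norm_eq_inner euclidean_inner[of x0 x0]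
    by (simp only: power2_eq_square)
  have "laplacian F x0 = (\<Sum>b\<in>Basis. v2 * (x0 \<bullet> b)\<^sup>2 / r\<^sup>2 + v1 r / r - v1 r * (x0 \<bullet> b)\<^sup>2 / r ^ 3)"
    unfolding laplacian_def by (intro sum.cong) (auto simp: second)
  also have "\<dots> = v2 * (\<Sum>b\<in>Basis. (x0 \<bullet> b)\<^sup>2) / r\<^sup>2 + real DIM('a) * (v1 r / r)
      - v1 r * (\<Sum>b\<in>Basis. (x0 \<bullet> b)\<^sup>2) / r ^ 3"
    by (simp add: sum.distrib sum_subtractf sum_distrib_left sum_divide_distrib)
  also have "\<dots> = v2 + real n * v1 r / r"
    unfolding sq nd using r by (simp add: field_simps power2_eq_square power3_eq_cube)
  finally have lap: "laplacian F x0 = v2 + real n * v1 r / r" .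
  have "((\<lambda>s. s ^ n * v1 s) has_real_derivative
      (real n * r ^ (n - 1)) * v1 r + v2 * r ^ n) (at r)"
    using DERIV_mult[OF DERIV_pow[of n r] v2] by simp
  moreover have "(real n * r ^ (n - 1)) * v1 r + v2 * r ^ n = r ^ n * laplacian F x0"
  proof (cases n)
    case 0
    then show ?thesis unfolding lap by simp
  next
    case (Suc k)
    then show ?thesis unfolding lap using r by (simp add: field_simps)
  qed
  ultimately show ?thesis by (simp only: v1_def x0_def n_def)
qed

text \<open>By \<open>laplacian_along_line\<close> the Laplacian at \<open>r e\<close> is determined by the profile
  \<open>s \<mapsto> F (s e)\<close>, which is the same for all unit vectors \<open>e\<close>.\<close>

lemma laplacian_radial:
  fixes F :: "'a::euclidean_space \<Rightarrow> real"
  assumes S: "open S" and F: "Ck_on 2 F S"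
    and radS: "\<And>x y. norm x = norm y \<Longrightarrow> x \<in> S \<Longrightarrow> y \<in> S"
    and rad: "\<And>x y. x \<in> S \<Longrightarrow> norm x = norm y \<Longrightarrow> F x = F y"
    and xy: "x \<in> S" "x \<noteq> 0" "norm x = norm y"
  shows "laplacian F x = laplacian F y"
proof -
  define r where "r = norm x"
  have r: "r > 0" "norm y = r" using xy(2) xy(3)[symmetric] by (simp_all add: r_def)
  have F2: "Ck_on (Suc 1) F S" using F by (simp add: numeral_2_eq_2)
  have rS: "r *\<^sub>R e \<in> S" if "norm e = 1" for e
    by (rule radS[OF _ xy(1)]) (use that r in \<open>simp add: r_def\<close>)
  let ?D = "\<lambda>e s. s ^ (DIM('a) - 1) * (gradient F (s *\<^sub>R e) \<bullet> e)"
  have D: "(?D e has_real_derivative r ^ (DIM('a) - 1) * laplacian F (r *\<^sub>R e)) (at r)"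
    if "norm e = 1" for e
    by (rule laplacian_along_line[OF S F rS[OF that] that])
       (intro disjI2 conjI ballI impI r(1) rad)
  define e e' where "e = x /\<^sub>R r" and "e' = y /\<^sub>R r"
  have ee: "norm e = 1" "norm e' = 1" "x = r *\<^sub>R e" "y = r *\<^sub>R e'"
    using r unfolding e_def e'_def r_def by auto
  define I where "I = {0<..} \<inter> (\<lambda>s. s *\<^sub>R e) -` S"
  have I: "open I" "r \<in> I"
    using r(1) rS[OF ee(1)] unfolding I_def
    by (auto intro!: open_Int open_vimage[OF S] continuous_intros)
  have same: "s *\<^sub>R e \<in> S" "s *\<^sub>R e' \<in> S" "F (s *\<^sub>R e) = F (s *\<^sub>R e')" if s: "s \<in> I" for s
  proof -
    show 1: "s *\<^sub>R e \<in> S" using s unfolding I_def by simp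
    have "norm (s *\<^sub>R e) = norm (s *\<^sub>R e')" using ee by simp
    then show "s *\<^sub>R e' \<in> S" "F (s *\<^sub>R e) = F (s *\<^sub>R e')" by (rule radS[OF _ 1], rule rad[OF 1])
  qed
  have eq: "?D e' s = ?D e s" if s: "s \<in> I" for s
  proof -
    have d: "((\<lambda>s. F (s *\<^sub>R e)) has_real_derivative gradient F (s *\<^sub>R e) \<bullet> e) (at s)"
      "((\<lambda>s. F (s *\<^sub>R e')) has_real_derivative gradient F (s *\<^sub>R e') \<bullet> e') (at s)"
      by (intro line_has_derivative Ck_on_differentiable[OF S _ F2] same s)+
    from has_field_derivative_transform_within_open[OF d(1) I(1) s same(3)] d(2)
    have "gradient F (s *\<^sub>R e') \<bullet> e' = gradient F (s *\<^sub>R e) \<bullet> e"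
      using DERIV_unique by blast
    then show ?thesis by simp
  qed
  have "(?D e has_real_derivative r ^ (DIM('a) - 1) * laplacian F (r *\<^sub>R e')) (at r)"
    by (rule has_field_derivative_transform_within_open[OF D[OF ee(2)] I eq])
  from DERIV_unique[OF this D[OF ee(1)]]
  have "r ^ (DIM('a) - 1) * laplacian F y = r ^ (DIM('a) - 1) * laplacian F x"
    by (simp only: ee(3,4)[symmetric])
  then show ?thesis using r(1) by simp
qed

section \<open>One-dimensional analysis on an interval off the support\<close>

text \<open>This is the one-dimensional form of the strong minimum principle. If \<open>u s\<close> were at most both outer
  values, the mean value theorem would give a point left of \<open>s\<close> with \<open>u' \<le> 0\<close> and one right of \<open>s\<close>
  with \<open>u' \<ge> 0\<close>, against the strict decrease of \<open>p u'\<close>.\<close>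

lemma quasi_concave:
  fixes u u1 p :: "real \<Rightarrow> real"
  assumes u: "\<And>r. r \<in> J \<Longrightarrow> (u has_real_derivative u1 r) (at r)"
    and p: "\<And>r. r \<in> J \<Longrightarrow> p r > 0"
    and dec: "\<And>r s. r \<in> J \<Longrightarrow> s \<in> J \<Longrightarrow> r < s \<Longrightarrow> p s * u1 s < p r * u1 r"
    and rst: "r < s" "s < t" "{r..t} \<subseteq> J"
  shows "min (u r) (u t) < u s"
proof (rule ccontr)
  assume "\<not> min (u r) (u t) < u s"
  then have le: "u s \<le> u r" "u s \<le> u t" by auto
  have "\<exists>z. r < z \<and> z < s \<and> u s - u r = (s - r) * u1 z"
    by (rule MVT2) (use rst in \<open>auto intro!: u\<close>)
  then obtain z where z: "r < z" "z < s" "u s - u r = (s - r) * u1 z" by blast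
  have "\<exists>y. s < y \<and> y < t \<and> u t - u s = (t - s) * u1 y"
    by (rule MVT2) (use rst in \<open>auto intro!: u\<close>)
  then obtain y where y: "s < y" "y < t" "u t - u s = (t - s) * u1 y" by blast
  have J: "z \<in> J" "y \<in> J" using z y rst by auto
  have "(s - r) * u1 z \<le> 0" using z le by linarith
  then have "u1 z \<le> 0" using rst by (simp add: mult_le_0_iff)
  moreover have "(t - s) * u1 y \<ge> 0" using y le by linarith
  then have "u1 y \<ge> 0" using rst by (simp add: zero_le_mult_iff)
  ultimately have "p z * u1 z \<le> 0" "p y * u1 y \<ge> 0" using p J
    by (auto simp: mult_le_0_iff zero_le_mult_iff less_imp_le)
  with dec[OF J] z y show False by linarith
qed

lemma pos_of_quasi_concave:
  fixes u :: "real \<Rightarrow> real"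
  assumes qc: "\<And>r s t. r < s \<Longrightarrow> s < t \<Longrightarrow> {r..t} \<subseteq> J \<Longrightarrow> min (u r) (u t) < u s"
    and left: "\<exists>r\<in>J. r < s \<and> u r \<ge> 0" and right: "\<exists>t\<in>J. s < t \<and> u t \<ge> 0"
    and J: "is_interval J"
  shows "u s > 0"
proof -
  obtain r t where rt: "r \<in> J" "r < s" "u r \<ge> 0" "t \<in> J" "s < t" "u t \<ge> 0" using left right by blast
  have "{r..t} \<subseteq> J" using mem_is_interval_1_I[OF J rt(1) rt(4)] by auto
  from qc[OF rt(2,5) this] rt show ?thesis by auto
qed

lemma increasing_from_right_limit:
  fixes m :: "real \<Rightarrow> real"
  assumes lim: "(m \<longlongrightarrow> 0) (at_right a)" and rc: "r \<in> {a<..<c}"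
    and inc: "\<And>r s. a < r \<Longrightarrow> r < s \<Longrightarrow> s < c \<Longrightarrow> m r < m s"
  shows "m r > 0"
proof -
  define s where "s = (a + r) / 2"
  have s: "a < s" "s < r" using rc unfolding s_def by auto
  have "eventually (\<lambda>x. m x \<le> m s) (at_right a)"
    unfolding eventually_at_right_field
  proof (intro exI[of _ s] conjI allI impI)
    fix y assume "a < y" "y < s"
    then show "m y \<le> m s" using inc[of y s] s rc by simp
  qed (rule s)
  then have "0 \<le> m s" using tendsto_upperbound[OF lim] trivial_limit_at_right_real by blast
  also have "m s < m r" using inc[of s r] s rc by auto
  finally show ?thesis .
qed

text \<open>Here \<open>u\<close> stands for the Laplacian of \<open>v\<close> and \<open>m\<close> for the flux \<open>p v'\<close>. If \<open>u\<close> were negative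
  all over \<open>(a, c)\<close>, then \<open>m\<close> would decrease from the value \<open>0\<close>, so \<open>v\<close> would decrease strictly,
  and \<open>v a\<close> could not be minimal.\<close>

lemma nonneg_near_left_end:
  fixes v u m p :: "real \<Rightarrow> real"
  assumes ac: "a < c"
    and m: "\<And>r. r \<in> {a<..<c} \<Longrightarrow> (m has_real_derivative p r * u r) (at r)"
    and v: "\<And>r. r \<in> {a<..<c} \<Longrightarrow> (v has_real_derivative m r / p r) (at r)"
    and p: "\<And>r. r \<in> {a<..<c} \<Longrightarrow> p r > 0"
    and lim: "(m \<longlongrightarrow> 0) (at_right a)"
    and vc: "continuous_on {a..<c} v"
    and vmin: "\<And>r. r \<in> {a<..<c} \<Longrightarrow> v a \<le> v r"
  shows "\<exists>r. r \<in> {a<..<c} \<and> u r \<ge> 0"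
proof (rule ccontr)
  assume "\<not> ?thesis"
  then have neg: "u r < 0" if "r \<in> {a<..<c}" for r
    using that by (metis not_le)
  have dec: "m r > m s" if "a < r" "r < s" "s < c" for r s
  proof (rule DERIV_neg_imp_decreasing[OF that(2)])
    fix x assume "r \<le> x" "x \<le> s"
    then have x: "x \<in> {a<..<c}" using that by auto
    have "p x * u x < 0" using p[OF x] neg[OF x] by (simp add: mult_less_0_iff)
    with m[OF x] show "\<exists>y. (m has_real_derivative y) (at x) \<and> y < 0" by blast
  qed
  have mneg: "m r < 0" if "r \<in> {a<..<c}" for r
  proof -
    have "((\<lambda>x. - m x) \<longlongrightarrow> 0) (at_right a)" using tendsto_minus[OF lim] by simp
    then have "0 < - m r" by (rule increasing_from_right_limit[OF _ that]) (simp add: dec)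
    then show ?thesis by simp
  qed
  define r where "r = (a + c) / 2"
  have r: "a < r" "r < c" using ac unfolding r_def by auto
  have "\<exists>l z. a < z \<and> z < r \<and> (v has_real_derivative l) (at z) \<and> v r - v a = (r - a) * l"
  proof (rule MVT[OF r(1)])
    show "continuous_on {a..r} v" by (rule continuous_on_subset[OF vc]) (use r in auto)
    show "v differentiable (at x)" if "a < x" "x < r" for x
      using v[of x] that r unfolding real_differentiable_def by auto
  qed
  then obtain l z where z: "a < z" "z < r" "(v has_real_derivative l) (at z)" "v r - v a = (r - a) * l"
    by blast
  have "l = m z / p z" using z r v[of z] by (intro DERIV_unique[OF z(3)]) auto
  also have "\<dots> < 0" using mneg[of z] p[of z] z r by (auto simp: divide_less_0_iff)
  finally have "(r - a) * l < 0" using r by (simp add: mult_less_0_iff)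
  with vmin[of r] z r show False by auto
qed

lemma strict_dec_of_neg_deriv:
  fixes f :: "real \<Rightarrow> real"
  assumes "\<And>x. x \<in> J \<Longrightarrow> (f has_real_derivative f' x) (at x)" "\<And>x. x \<in> J \<Longrightarrow> f' x < 0"
    and "{r..s} \<subseteq> J" "r < s"
  shows "f s < f r"
proof (rule DERIV_neg_imp_decreasing[OF assms(4)])
  fix x assume "r \<le> x" "x \<le> s"
  then have x: "x \<in> J" using assms(3) by auto
  show "\<exists>y. (f has_real_derivative y) (at x) \<and> y < 0"
    using assms(1)[OF x] assms(2)[OF x] by blast
qed

text \<open>The mirror image of \<open>nonneg_near_left_end\<close> under \<open>r \<mapsto> - r\<close>, which flips the sign of the flux.\<close>

lemma nonneg_near_right_end:
  fixes v u m p :: "real \<Rightarrow> real"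
  assumes ac: "c < b"
    and m: "\<And>r. r \<in> {c<..<b} \<Longrightarrow> (m has_real_derivative p r * u r) (at r)"
    and v: "\<And>r. r \<in> {c<..<b} \<Longrightarrow> (v has_real_derivative m r / p r) (at r)"
    and p: "\<And>r. r \<in> {c<..<b} \<Longrightarrow> p r > 0"
    and lim: "(m \<longlongrightarrow> 0) (at_left b)"
    and vc: "continuous_on {c<..b} v"
    and vmin: "\<And>r. r \<in> {c<..<b} \<Longrightarrow> v b \<le> v r"
  shows "\<exists>r. r \<in> {c<..<b} \<and> u r \<ge> 0"
proof -
  have "\<exists>r. r \<in> {-b<..<-c} \<and> u (- r) \<ge> 0"
  proof (rule nonneg_near_left_end[where m = "\<lambda>x. - m (- x)" and v = "\<lambda>x. v (- x)" and p = "\<lambda>x. p (- x)"])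
    show "- b < - c" using ac by simp
    show "((\<lambda>x. - m (- x)) has_real_derivative p (- r) * u (- r)) (at r)" if "r \<in> {- b<..<- c}" for r
      using DERIV_minus[OF DERIV_chain'[OF DERIV_minus[OF DERIV_ident] m[of "- r"]]] that by simp
    show "((\<lambda>x. v (- x)) has_real_derivative - m (- r) / p (- r)) (at r)" if "r \<in> {- b<..<- c}" for r
      using DERIV_chain'[OF DERIV_minus[OF DERIV_ident] v[of "- r"]] that by simp
    show "0 < p (- r)" if "r \<in> {- b<..<- c}" for r using p that by simp
    have "((\<lambda>x. - m x) \<longlongrightarrow> 0) (at_left b)" using tendsto_minus[OF lim] by simp
    then show "((\<lambda>x. - m (- x)) \<longlongrightarrow> 0) (at_right (- b))"
      by (simp add: filterlim_at_left_to_right)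
    show "continuous_on {- b..<- c} (\<lambda>x. v (- x))"
      by (rule continuous_on_compose2[OF vc]) (auto intro: continuous_intros)
    show "v (- (- b)) \<le> v (- r)" if "r \<in> {- b<..<- c}" for r using vmin that by simp
  qed
  then obtain r where "r \<in> {-b<..<-c}" "u (- r) \<ge> 0" by blast
  then show ?thesis by (intro exI[of _ "- r"]) auto
qed

text \<open>Quasi-concavity propagates the sign of \<open>u\<close> from both ends to the whole interval. So \<open>m\<close>
  increases strictly, but it vanishes at both ends.\<close>

lemma no_gap:
  fixes u m p :: "real \<Rightarrow> real"
  assumes ab: "a < b"
    and m: "\<And>r. r \<in> {a<..<b} \<Longrightarrow> (m has_real_derivative p r * u r) (at r)"
    and u: "\<And>r. r \<in> {a<..<b} \<Longrightarrow> (u has_real_derivative u1 r) (at r)"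
    and p: "\<And>r. r \<in> {a<..<b} \<Longrightarrow> p r > 0"
    and dec: "\<And>r s. r \<in> {a<..<b} \<Longrightarrow> s \<in> {a<..<b} \<Longrightarrow> r < s \<Longrightarrow> p s * u1 s < p r * u1 r"
    and left: "\<And>c. c \<in> {a<..<b} \<Longrightarrow> \<exists>r. r \<in> {a<..<c} \<and> u r \<ge> 0"
    and right: "\<And>c. c \<in> {a<..<b} \<Longrightarrow> \<exists>r. r \<in> {c<..<b} \<and> u r \<ge> 0"
    and lima: "(m \<longlongrightarrow> 0) (at_right a)" and limb: "(m \<longlongrightarrow> 0) (at_left b)"
  shows False
proof -
  have upos: "u s > 0" if s: "s \<in> {a<..<b}" for s
  proof (rule pos_of_quasi_concave[where J = "{a<..<b}" and u = u and s = s])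
    show "min (u r) (u t) < u q" if "r < q" "q < t" "{r..t} \<subseteq> {a<..<b}" for r q t
      using quasi_concave[OF u p dec that] by blast
    show "\<exists>r\<in>{a<..<b}. r < s \<and> 0 \<le> u r" using left[OF s] s by force
    show "\<exists>r\<in>{a<..<b}. s < r \<and> 0 \<le> u r" using right[OF s] s by force
  qed (rule is_interval_oo)
  have inc: "m r < m s" if "a < r" "r < s" "s < b" for r s
  proof -
    have "- m s < - m r"
      by (rule strict_dec_of_neg_deriv[where J = "{a<..<b}" and f' = "\<lambda>r. - (p r * u r)"])
        (use that m p upos in \<open>auto intro!: derivative_intros mult_pos_pos\<close>)
    then show ?thesis by simp
  qed
  define r where "r = (a + b) / 2"
  have r: "r \<in> {a<..<b}" using ab unfolding r_def by auto
  have "m r > 0" by (rule increasing_from_right_limit[OF lima r inc])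
  moreover have "- m (- (- r)) > 0"
  proof (rule increasing_from_right_limit[where a = "- b" and c = "- a" and r = "- r" and m = "\<lambda>x. - m (- x)"])
    have "((\<lambda>x. - m x) \<longlongrightarrow> 0) (at_left b)" using tendsto_minus[OF limb] by simp
    then show "((\<lambda>x. - m (- x)) \<longlongrightarrow> 0) (at_right (- b))"
      by (simp add: filterlim_at_left_to_right)
  qed (use r inc in auto)
  ultimately show False by simp
qed

text \<open>The same mechanism on a half line, with the sign of \<open>u\<close> at infinity in place of the second end.\<close>

lemma increasing_beyond:
  fixes u m p v :: "real \<Rightarrow> real"
  assumes m: "\<And>r. r \<in> {a<..} \<Longrightarrow> (m has_real_derivative p r * u r) (at r)"
    and v: "\<And>r. r \<in> {a<..} \<Longrightarrow> (v has_real_derivative m r / p r) (at r)"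
    and u: "\<And>r. r \<in> {a<..} \<Longrightarrow> (u has_real_derivative u1 r) (at r)"
    and p: "\<And>r. r \<in> {a<..} \<Longrightarrow> p r > 0"
    and dec: "\<And>r s. r \<in> {a<..} \<Longrightarrow> s \<in> {a<..} \<Longrightarrow> r < s \<Longrightarrow> p s * u1 s < p r * u1 r"
    and left: "\<And>c. c \<in> {a<..} \<Longrightarrow> \<exists>r. r \<in> {a<..<c} \<and> u r \<ge> 0"
    and right: "\<And>c. \<exists>r>c. u r \<ge> 0"
    and lima: "(m \<longlongrightarrow> 0) (at_right a)"
    and vc: "continuous_on {a..} v"
    and ar: "a \<le> r"
  shows "v a \<le> v r"
proof (cases "a = r")
  case False
  then have ar: "a < r" using assms(10) by simp
  have upos: "u s > 0" if s: "s \<in> {a<..}" for s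
  proof (rule pos_of_quasi_concave[where J = "{a<..}" and u = u and s = s])
    show "min (u r) (u t) < u q" if "r < q" "q < t" "{r..t} \<subseteq> {a<..}" for r q t
      using quasi_concave[OF u p dec that] by blast
    show "\<exists>r\<in>{a<..}. r < s \<and> 0 \<le> u r" using left[OF s] s by force
    show "\<exists>r\<in>{a<..}. s < r \<and> 0 \<le> u r" using right[of s] s by force
  qed (rule is_interval_oi)
  have inc: "m r < m s" if "a < r" "r < s" for r s
  proof -
    have "- m s < - m r"
      by (rule strict_dec_of_neg_deriv[where J = "{a<..}" and f' = "\<lambda>r. - (p r * u r)"])
        (use that m p upos in \<open>auto intro!: derivative_intros mult_pos_pos\<close>)
    then show ?thesis by simp
  qed
  have mpos: "m s > 0" if "a < s" for s
    by (rule increasing_from_right_limit[OF lima _ inc, of s "s + 1"]) (use that in auto)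
  have "\<exists>l z. a < z \<and> z < r \<and> (v has_real_derivative l) (at z) \<and> v r - v a = (r - a) * l"
  proof (rule MVT[OF ar])
    show "continuous_on {a..r} v" by (rule continuous_on_subset[OF vc]) auto
    show "v differentiable (at x)" if "a < x" "x < r" for x
      using v[of x] that unfolding real_differentiable_def by auto
  qed
  then obtain l z where z: "a < z" "z < r" "(v has_real_derivative l) (at z)" "v r - v a = (r - a) * l"
    by blast
  have "l = m z / p z" using z v[of z] by (intro DERIV_unique[OF z(3)]) auto
  also have "\<dots> > 0" using mpos[of z] p[of z] z by auto
  finally have "(r - a) * l > 0" using ar by simp
  with z show ?thesis by linarith
qed simp

section \<open>Integration of radial functions\<close>

text \<open>Polar coordinates for radial integrands: the volume of a ball determines the image of
  Lebesgue measure under the norm.\<close>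

lemma distr_norm_lborel:
  "distr (lborel :: 'a::euclidean_space measure) borel norm =
     density lborel (\<lambda>s. ennreal (unit_ball_vol (real DIM('a)) * real DIM('a) * s ^ (DIM('a) - 1))
        * indicator {0..} s)"
    (is "?M = ?N")
proof -
  define n where "n = DIM('a) - 1"
  define c where "c = unit_ball_vol (real DIM('a))"
  have d: "DIM('a) = Suc n" unfolding n_def using DIM_positive[where 'a='a] by simp
  have c: "c \<ge> 0" unfolding c_def by simp
  have N: "?N = density lborel (\<lambda>s. ennreal (c * real (Suc n) * s ^ n) * indicator {0..} s)"
    unfolding c_def d by simp
  have eq: "emeasure ?M {..a} = emeasure ?N {..a} \<and> emeasure ?M {..a} \<noteq> \<infinity>" for a
  proof (cases "a \<ge> 0")
    case True
    have "emeasure ?M {..a} = emeasure lborel (cball (0::'a) a)"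
      by (subst emeasure_distr) (auto intro!: arg_cong[where f = "emeasure lborel"])
    also have "\<dots> = ennreal (c * a ^ Suc n)"
      using emeasure_cball[OF True, of "0::'a"] unfolding c_def d by simp
    finally have 1: "emeasure ?M {..a} = ennreal (c * a ^ Suc n)" .
    have "emeasure ?N {..a} = (\<integral>\<^sup>+s. ennreal (c * real (Suc n) * s ^ n) * indicator {0..a} s \<partial>lborel)"
      unfolding N by (subst emeasure_density) (auto intro!: nn_integral_cong split: split_indicator)
    also have "\<dots> = ennreal (c * a ^ Suc n - c * 0 ^ Suc n)"
    proof (rule nn_integral_FTC_Icc[OF _ _ _ True, where F = "\<lambda>s. c * s ^ Suc n"])
      show "((\<lambda>s. c * s ^ Suc n) has_real_derivative c * real (Suc n) * x ^ n) (at x)" for x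
        using DERIV_cmult[OF DERIV_pow[of "Suc n" x], of c]
        by (auto intro!: has_field_derivative_at_within simp: mult.assoc simp del: of_nat_Suc power_Suc)
    qed (use c in auto)
    finally show ?thesis using 1 by simp
  next
    case False
    have "emeasure ?M {..a} = emeasure lborel ({} :: 'a set)"
    proof -
      have "norm -` {..a} = ({} :: 'a set)"
        using False by (auto simp: not_le dest: order_trans[OF norm_ge_zero])
      then show ?thesis by (subst emeasure_distr) auto
    qed
    moreover have "emeasure ?N {..a} = (\<integral>\<^sup>+s. 0 \<partial>(lborel :: real measure))"
    proof -
      have "emeasure ?N {..a}
        = (\<integral>\<^sup>+s. ennreal (c * real (Suc n) * s ^ n) * indicator {0..} s * indicator {..a} s \<partial>lborel)"
        unfolding N by (subst emeasure_density) auto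
      also have "\<dots> = (\<integral>\<^sup>+s. 0 \<partial>(lborel :: real measure))"
        by (intro nn_integral_cong) (use False in \<open>auto split: split_indicator\<close>)
      finally show ?thesis .
    qed
    ultimately show ?thesis by simp
  qed
  show ?thesis
  proof (rule measure_eqI_generator_eq[where E = "range (\<lambda>a. {..a})" and \<Omega> = UNIV and A = "\<lambda>i. {..real i}"])
    show "Int_stable (range (\<lambda>a::real. {..a}))"
      by (auto simp: Int_stable_def Int_atMost)
    show "sets ?M = sigma_sets UNIV (range (\<lambda>a. {..a}))" "sets ?N = sigma_sets UNIV (range (\<lambda>a. {..a}))"
      by (simp_all add: borel_eq_atMost)
    show "(\<Union>i. {..real i}) = UNIV" using real_arch_simple by auto
    show "emeasure ?M X = emeasure ?N X" if "X \<in> range (\<lambda>a. {..a})" for X using that eq by auto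
    show "emeasure ?M {..real i} \<noteq> \<infinity>" for i using eq by blast
  qed auto
qed

lemma nn_integral_norm:
  assumes [measurable]: "f \<in> borel_measurable borel"
  shows "(\<integral>\<^sup>+x. f (norm x) \<partial>(lborel :: 'a::euclidean_space measure))
    = (\<integral>\<^sup>+s. ennreal (unit_ball_vol (real DIM('a)) * real DIM('a) * s ^ (DIM('a) - 1))
        * indicator {0..} s * f s \<partial>lborel)"
proof -
  have "(\<integral>\<^sup>+x. f (norm x) \<partial>(lborel :: 'a measure)) = integral\<^sup>N (distr (lborel :: 'a measure) borel norm) f"
    by (simp add: nn_integral_distr)
  also have "\<dots> = (\<integral>\<^sup>+s. ennreal (unit_ball_vol (real DIM('a)) * real DIM('a) * s ^ (DIM('a) - 1))
        * indicator {0..} s * f s \<partial>lborel)"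
    unfolding distr_norm_lborel by (simp add: nn_integral_density)
  finally show ?thesis .
qed

section \<open>Local integrability of the gradient of a radial potential\<close>

text \<open>In the application \<open>m = r^n h'\<close> for the profile \<open>h\<close> of the potential and \<open>u\<close> is its Laplacian. The decrease of
  \<open>r^n u'\<close> gives \<open>u' \<ge> - c r^(-n)\<close>, so \<open>r^n u\<close> is bounded above by the mean value theorem,
  because \<open>s^n r^(-n) \<le> 1\<close> for \<open>s \<le> r\<close>. As \<open>r^n u = m'\<close>, a second application bounds \<open>m\<close> below.\<close>

lemma profile_flux_bounded_below:
  fixes m u u1 :: "real \<Rightarrow> real"
  assumes R: "R > 0"
    and m: "\<And>s. 0 < s \<Longrightarrow> (m has_real_derivative s ^ n * u s) (at s)"
    and u: "\<And>s. 0 < s \<Longrightarrow> (u has_real_derivative u1 s) (at s)"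
    and dec: "\<And>r s. 0 < r \<Longrightarrow> r < s \<Longrightarrow> s ^ n * u1 s < r ^ n * u1 r"
  obtains C where "C \<ge> 0" "\<And>s. 0 < s \<Longrightarrow> s \<le> R \<Longrightarrow> - C \<le> m s"
proof -
  define c where "c = \<bar>R ^ n * u1 R\<bar>"
  \<comment> \<open>the bounds \<open>u1 z \<ge> - c / z ^ n\<close> and \<open>s ^ n * u s \<le> D\<close> come from comparison with the point \<open>R\<close>\<close>
  define D where "D = R ^ n * \<bar>u R\<bar> + c * R"
  have D: "D \<ge> 0" unfolding D_def c_def using R by auto
  have m': "s ^ n * u s \<le> D" if s: "0 < s" "s < R" for s
  proof -
    have "\<exists>z. s < z \<and> z < R \<and> u R - u s = (R - s) * u1 z"
      by (rule MVT2[OF s(2)]) (use s in \<open>auto intro!: u\<close>)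
    then obtain z where z: "s < z" "z < R" "u R - u s = (R - s) * u1 z" by blast
    have "- c \<le> R ^ n * u1 R" unfolding c_def by linarith
    also have "\<dots> \<le> z ^ n * u1 z" using dec[of z R] z s by simp
    finally have 1: "- c \<le> z ^ n * u1 z" .
    have "- c \<le> s ^ n * u1 z"
    proof (cases "u1 z \<ge> 0")
      case True
      then have "0 \<le> s ^ n * u1 z" using s by simp
      then show ?thesis unfolding c_def by linarith
    next
      case False
      have "s ^ n \<le> z ^ n" using s z by (intro power_mono) auto
      then have "z ^ n * u1 z \<le> s ^ n * u1 z" using False by (intro mult_right_mono_neg) auto
      with 1 show ?thesis by linarith
    qed
    then have "(R - s) * (- c) \<le> (R - s) * (s ^ n * u1 z)" using s by (intro mult_left_mono) auto
    moreover have "(R - s) * c \<le> R * c" using s unfolding c_def by (intro mult_right_mono) auto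
    moreover have "s ^ n * u s = s ^ n * u R - (R - s) * (s ^ n * u1 z)"
    proof -
      have us: "u s = u R - (R - s) * u1 z" using z(3) by simp
      show ?thesis unfolding us by (simp add: algebra_simps)
    qed
    moreover have "s ^ n * u R \<le> s ^ n * \<bar>u R\<bar>" "s ^ n * \<bar>u R\<bar> \<le> R ^ n * \<bar>u R\<bar>"
      using s by (intro mult_left_mono mult_right_mono power_mono; simp)+
    ultimately show ?thesis unfolding D_def by (simp add: algebra_simps)
  qed
  show ?thesis
  proof (rule that[of "\<bar>m R\<bar> + D * R"])
    show "0 \<le> \<bar>m R\<bar> + D * R" using D R by simp
    fix s assume s: "0 < s" "s \<le> R"
    show "- (\<bar>m R\<bar> + D * R) \<le> m s"
    proof (cases "s = R")
      case True
      have "0 \<le> D * R" using D R by simp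
      then show ?thesis unfolding True by linarith
    next
      case False
      then have sR: "s < R" using s by simp
      have "\<exists>z. s < z \<and> z < R \<and> m R - m s = (R - s) * (z ^ n * u z)"
        by (rule MVT2[OF sR]) (use s in \<open>auto intro!: m\<close>)
      then obtain z where z: "s < z" "z < R" "m R - m s = (R - s) * (z ^ n * u z)" by blast
      have "(R - s) * (z ^ n * u z) \<le> (R - s) * D" using m'[of z] s z by (intro mult_left_mono) auto
      also have "\<dots> \<le> R * D" using s D by (intro mult_right_mono) auto
      finally show ?thesis using z(3) by (simp add: algebra_simps)
    qed
  qed
qed

lemma borel_measurable_if_positive:
  fixes g :: "real \<Rightarrow> real"
  assumes "continuous_on {0<..} g"
  shows "(\<lambda>s. if 0 < s then g s else 0) \<in> borel_measurable borel"
  using borel_measurable_continuous_on_if[of "{0<..}" g "\<lambda>_. 0"] assms by simp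

text \<open>Since \<open>s^n h' \<ge> - C\<close>, the integrand is at most \<open>s^n h' + 2 C\<close>, and this is at most the derivative
  of \<open>s^n h + 2 C s\<close> because \<open>h \<ge> 0\<close>. The boundary term at the inner end has the favourable sign
  for the same reason, so the bound does not deteriorate as that end tends to \<open>0\<close>.\<close>

lemma profile_flux_integrable:
  fixes h h' :: "real \<Rightarrow> real"
  assumes R: "R > 0" and C: "C \<ge> 0" "\<And>s. 0 < s \<Longrightarrow> s \<le> R \<Longrightarrow> - C \<le> s ^ n * h' s"
    and h: "\<And>s. 0 < s \<Longrightarrow> (h has_real_derivative h' s) (at s)" "\<And>s. 0 < s \<Longrightarrow> h s \<ge> 0"
    and cont: "continuous_on {0<..} h'"
  shows "(\<integral>\<^sup>+s\<in>{0<..R}. ennreal (s ^ n * \<bar>h' s\<bar>) \<partial>lborel) \<le> ennreal (R ^ n * h R + 2 * C * R)"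
proof -
  define f where "f s = (if s > 0 then s ^ n * \<bar>h' s\<bar> else 0)" for s
  have [measurable]: "f \<in> borel_measurable borel"
    unfolding f_def by (intro borel_measurable_if_positive continuous_intros cont)
  have fC: "f s \<le> s ^ n * h' s + 2 * C" if "0 < s" "s \<le> R" for s
  proof -
    have "\<bar>s ^ n * h' s\<bar> \<le> s ^ n * h' s + 2 * C" using C(2)[OF that] C(1) by linarith
    then show ?thesis using that by (simp add: f_def abs_mult)
  qed
  have bound: "(\<integral>\<^sup>+s\<in>{e..R}. ennreal (f s) \<partial>lborel) \<le> ennreal (R ^ n * h R + 2 * C * R)"
    if e: "0 < e" "e \<le> R" for e
  proof -
    define g where "g s = s ^ n * h' s + 2 * C + real n * s ^ (n - 1) * h s" for s
    have hc: "continuous_on {0<..} h"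
      by (rule DERIV_continuous_on) (use h(1) in \<open>auto intro: has_field_derivative_at_within\<close>)
    define g0 where "g0 s = (if s > 0 then g s else 0)" for s
    have gm: "g0 \<in> borel_measurable borel"
      unfolding g0_def g_def by (intro borel_measurable_if_positive continuous_intros cont hc)
    have fg: "f s \<le> g0 s" if "0 < s" "s \<le> R" for s
    proof -
      have "0 \<le> real n * s ^ (n - 1) * h s" using h(2)[of s] that by simp
      then show ?thesis using fC[OF that] that unfolding g_def g0_def by simp
    qed
    have "(\<integral>\<^sup>+s\<in>{e..R}. ennreal (f s) \<partial>lborel) \<le> (\<integral>\<^sup>+s. ennreal (g0 s) * indicator {e..R} s \<partial>lborel)"
      by (intro nn_integral_mono) (use fg e in \<open>auto split: split_indicator intro!: ennreal_leI\<close>)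
    also have "\<dots> = ennreal ((R ^ n * h R + 2 * C * R) - (e ^ n * h e + 2 * C * e))"
    proof (rule nn_integral_FTC_Icc[OF gm _ _ e(2), where F = "\<lambda>s. s ^ n * h s + 2 * C * s"])
      fix x assume "x \<in> {e..R}"
      then have x: "e \<le> x" "x \<le> R" by auto
      show "((\<lambda>s. s ^ n * h s + 2 * C * s) has_real_derivative g0 x) (at x)"
        using x e by (auto intro!: derivative_eq_intros h(1) simp: g_def g0_def algebra_simps)
      have "0 \<le> f x" unfolding f_def by auto
      then show "0 \<le> g0 x" using fg[of x] x e by linarith
    qed
    also have "\<dots> \<le> ennreal (R ^ n * h R + 2 * C * R)"
    proof (rule ennreal_leI)
      have "0 \<le> e ^ n * h e" "0 \<le> 2 * C * e" using h(2)[of e] e C(1) by auto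
      then show "(R ^ n * h R + 2 * C * R) - (e ^ n * h e + 2 * C * e) \<le> R ^ n * h R + 2 * C * R"
        by linarith
    qed
    finally show ?thesis .
  qed
  let ?A = "\<lambda>k::nat. {R / real (Suc k)..R}"
  have un: "(\<Union>k. ?A k) = {0<..R}"
  proof safe
    fix x k assume "x \<in> ?A k"
    moreover have "0 < R / real (Suc k)" using R by simp
    ultimately show "x \<in> {0<..R}" by (auto simp del: of_nat_Suc)
  next
    fix x assume x: "x \<in> {0<..R}"
    obtain k where "R / x < real k" using reals_Archimedean2 by blast
    then have "R < x * real (Suc k)" using x by (simp add: field_simps)
    then have "R / real (Suc k) \<le> x" using x by (simp add: field_simps)
    then show "x \<in> (\<Union>k. ?A k)" using x by auto
  qed
  have inc: "incseq ?A"
    unfolding incseq_def using R by (auto intro!: order_trans[OF divide_left_mono] simp: field_simps)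
  have "(\<integral>\<^sup>+s\<in>{0<..R}. ennreal (s ^ n * \<bar>h' s\<bar>) \<partial>lborel) = (\<integral>\<^sup>+s\<in>{0<..R}. ennreal (f s) \<partial>lborel)"
    by (intro nn_integral_cong) (auto simp: f_def split: split_indicator)
  also have "\<dots> = emeasure (density lborel f) (\<Union>k. ?A k)"
    unfolding un by (subst emeasure_density) auto
  also have "\<dots> = (SUP k. emeasure (density lborel f) (?A k))"
    by (rule SUP_emeasure_incseq[OF _ inc, symmetric]) auto
  also have "\<dots> \<le> ennreal (R ^ n * h R + 2 * C * R)"
  proof (rule SUP_least)
    fix k :: nat
    have "R / real (Suc k) \<le> R" using R by (simp add: field_simps)
    then show "emeasure (density lborel f) (?A k) \<le> ennreal (R ^ n * h R + 2 * C * R)"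
      using bound[of "R / real (Suc k)"] R by (simp add: emeasure_density)
  qed
  finally show ?thesis .
qed

text \<open>The second part is the pointwise lower bound on the flux itself; in dimension one it shows that the potential
  stays bounded near the origin.\<close>

lemma integrable_radial_gradient:
  fixes w :: "'a::euclidean_space \<Rightarrow> real"
  assumes w: "Ck_on 4 w (- {0})" and w0: "\<And>x. w x \<ge> 0"
    and rad: "\<And>x y. norm x = norm y \<Longrightarrow> w x = w y"
    and lap2: "\<And>x. x \<noteq> 0 \<Longrightarrow> laplacian (laplacian w) x < 0"
    and R: "R > 0"
  shows "(\<integral>\<^sup>+x\<in>ball 0 R. ennreal (norm (gradient w x)) \<partial>lborel) < \<infinity>"
    and "\<exists>C. \<forall>x. x \<noteq> 0 \<longrightarrow> norm x \<le> R \<longrightarrow> - C \<le> norm x ^ (DIM('a) - 1) * (gradient w x \<bullet> (x /\<^sub>R norm x))"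
proof -
  define n where "n = DIM('a) - 1"
  define e :: 'a where "e = (SOME b. b \<in> Basis)"
  have e: "norm e = 1" unfolding e_def by (rule norm_Basis) (rule SOME_Basis)
  have S: "open (- {0::'a})" by auto
  have w4: "Ck_on (Suc 3) w (- {0})" using w by (simp add: eval_nat_numeral)
  have w2: "Ck_on 2 w (- {0})" using w Ck_on_lower[of 3 w "- {0}"] Ck_on_lower[of 2 w "- {0}"]
    by (simp add: eval_nat_numeral del: Ck_on.simps)
  have L2: "Ck_on 2 (laplacian w) (- {0})"
    by (rule Ck_on_laplacian[OF S]) (use w in \<open>simp add: eval_nat_numeral del: Ck_on.simps\<close>)
  then have L1: "Ck_on (Suc 1) (laplacian w) (- {0})" by (simp add: eval_nat_numeral del: Ck_on.simps)
  have Lrad: "laplacian w x = laplacian w y" if "x \<noteq> 0" "norm x = norm y" for x y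
  proof (rule laplacian_radial[OF S w2 _ _ _ that])
    show "y \<in> - {0}" if "norm x = norm y" "x \<in> - {0}" for x y :: 'a using that by auto
    show "w x = w y" if "norm x = norm y" for x y by (rule rad[OF that])
    show "x \<in> - {0}" using that by simp
  qed
  define h where "h s = w (s *\<^sub>R e)" for s
  define h' where "h' s = gradient w (s *\<^sub>R e) \<bullet> e" for s
  define u where "u s = laplacian w (s *\<^sub>R e)" for s
  define u1 where "u1 s = gradient (laplacian w) (s *\<^sub>R e) \<bullet> e" for s
  have se: "s *\<^sub>R e \<in> - {0}" if "s > 0" for s using that e by auto
  have dh: "(h has_real_derivative h' s) (at s)" if "0 < s" for s
    unfolding h_def h'_def by (rule line_has_derivative[OF Ck_on_differentiable[OF S se[OF that] w4]])
  have du: "(u has_real_derivative u1 s) (at s)" if "0 < s" for s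
    unfolding u_def u1_def by (rule line_has_derivative[OF Ck_on_differentiable[OF S se[OF that] L1]])
  have dm: "((\<lambda>s. s ^ n * h' s) has_real_derivative s ^ n * u s) (at s)" if "0 < s" for s
    unfolding h'_def u_def n_def
    by (rule laplacian_along_line[OF S w2 se[OF that] e])
       (intro disjI2 conjI ballI impI that rad, simp)
  have dphi: "((\<lambda>s. s ^ n * u1 s) has_real_derivative s ^ n * laplacian (laplacian w) (s *\<^sub>R e)) (at s)"
    if "0 < s" for s
    unfolding u1_def n_def
    by (rule laplacian_along_line[OF S L2 se[OF that] e])
       (intro disjI2 conjI ballI impI that Lrad, simp_all)
  have dec: "s ^ n * u1 s < r ^ n * u1 r" if "0 < r" "r < s" for r s
  proof (rule strict_dec_of_neg_deriv[where J = "{0<..}" and f = "\<lambda>s. s ^ n * u1 s"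
        and f' = "\<lambda>s. s ^ n * laplacian (laplacian w) (s *\<^sub>R e)"])
    show "x ^ n * laplacian (laplacian w) (x *\<^sub>R e) < 0" if "x \<in> {0<..}" for x
      using lap2[of "x *\<^sub>R e"] that se[of x] by (auto simp: mult_less_0_iff)
  qed (use that dphi in auto)
  obtain C where C: "C \<ge> 0" "\<And>s. 0 < s \<Longrightarrow> s \<le> R \<Longrightarrow> - C \<le> s ^ n * h' s"
    using profile_flux_bounded_below[of R "\<lambda>s. s ^ n * h' s" n u u1, OF R dm du dec] by blast
  have cont: "continuous_on {0<..} h'"
  proof (rule DERIV_continuous_on)
    fix s :: real assume "s \<in> {0<..}"
    then have s: "s *\<^sub>R e \<in> - {0}" using se by simp
    show "(h' has_real_derivative
       (\<Sum>b\<in>Basis. (gradient (partial_deriv b w) (s *\<^sub>R e) \<bullet> e) * (b \<bullet> e))) (at s within {0<..})"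
      unfolding h'_def
      by (rule has_field_derivative_at_within[OF line_gradient_has_derivative[OF S w2 s]])
  qed
  have grad: "gradient w x = (h' (norm x) / norm x) *\<^sub>R x" if "x \<noteq> 0" for x
    unfolding h'_def
    by (rule gradient_radial[OF S Ck_on_differentiable[OF S _ w4] rad e]) (use that e in auto)
  have ng: "norm (gradient w x) = \<bar>h' (norm x)\<bar>" if "x \<noteq> 0" for x
    unfolding grad[OF that] using that by simp
  show "\<exists>C. \<forall>x. x \<noteq> 0 \<longrightarrow> norm x \<le> R \<longrightarrow> - C \<le> norm x ^ (DIM('a) - 1) * (gradient w x \<bullet> (x /\<^sub>R norm x))"
  proof (intro exI allI impI)
    fix x :: 'a assume x: "x \<noteq> 0" "norm x \<le> R"
    have "gradient w x \<bullet> (x /\<^sub>R norm x) = h' (norm x)"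
      unfolding grad[OF x(1)] using x by (simp add: dot_square_norm power2_eq_square)
    then show "- C \<le> norm x ^ (DIM('a) - 1) * (gradient w x \<bullet> (x /\<^sub>R norm x))"
      using C(2)[of "norm x"] x by (simp add: n_def)
  qed
  define f where "f s = (if s > 0 then ennreal \<bar>h' s\<bar> else 0) * indicator {0<..R} s" for s
  have [measurable]: "(\<lambda>s. if s > 0 then h' s else 0) \<in> borel_measurable borel"
    by (rule borel_measurable_if_positive[OF cont])
  have "f = (\<lambda>s. ennreal \<bar>if s > 0 then h' s else 0\<bar> * indicator {0<..R} s)"
    unfolding f_def by auto
  then have [measurable]: "f \<in> borel_measurable borel" by simp
  let ?c = "unit_ball_vol (real DIM('a)) * real DIM('a)"
  have "(\<integral>\<^sup>+x\<in>ball 0 R. ennreal (norm (gradient w x)) \<partial>lborel) \<le> (\<integral>\<^sup>+x. f (norm (x::'a)) \<partial>lborel)"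
  proof (rule nn_integral_mono_AE)
    show "AE x::'a in lborel. ennreal (norm (gradient w x)) * indicator (ball 0 R) x \<le> f (norm x)"
      using AE_lborel_singleton[of "0::'a"]
      by eventually_elim (auto simp: f_def ng split: split_indicator)
  qed
  also have "\<dots> = (\<integral>\<^sup>+s. ennreal (?c * s ^ n) * indicator {0..} s * f s \<partial>lborel)"
    unfolding n_def by (rule nn_integral_norm) simp
  also have "\<dots> = (\<integral>\<^sup>+s. ennreal ?c * (ennreal (s ^ n) * f s) \<partial>lborel)"
    by (intro nn_integral_cong)
       (auto simp: f_def ennreal_mult'[symmetric] ennreal_mult''[symmetric] mult_ac split: split_indicator)
  also have "\<dots> = ennreal ?c * (\<integral>\<^sup>+s. ennreal (s ^ n) * f s \<partial>lborel)"
    by (rule nn_integral_cmult) simp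
  finally have le: "(\<integral>\<^sup>+x\<in>ball 0 R. ennreal (norm (gradient w x)) \<partial>lborel)
      \<le> ennreal ?c * (\<integral>\<^sup>+s. ennreal (s ^ n) * f s \<partial>lborel)" .
  have "(\<integral>\<^sup>+s. ennreal (s ^ n) * f s \<partial>lborel) = (\<integral>\<^sup>+s\<in>{0<..R}. ennreal (s ^ n * \<bar>h' s\<bar>) \<partial>lborel)"
    by (intro nn_integral_cong)
       (auto simp: f_def ennreal_mult'[symmetric] ennreal_mult''[symmetric] mult_ac split: split_indicator)
  also have "\<dots> \<le> ennreal (R ^ n * h R + 2 * C * R)"
    by (rule profile_flux_integrable[OF R C dh _ cont]) (auto simp: h_def w0)
  finally have "ennreal ?c * (\<integral>\<^sup>+s. ennreal (s ^ n) * f s \<partial>lborel)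
      \<le> ennreal ?c * ennreal (R ^ n * h R + 2 * C * R)" by (rule mult_left_mono) simp
  also have "\<dots> < \<infinity>" by (simp add: ennreal_mult_less_top)
  finally show "(\<integral>\<^sup>+x\<in>ball 0 R. ennreal (norm (gradient w x)) \<partial>lborel) < \<infinity>"
    using le by (rule le_less_trans[rotated])
qed

section \<open>Averages over small balls\<close>

definition ball_unif :: "real \<Rightarrow> 'a::euclidean_space measure" where
  "ball_unif r = uniform_measure lborel (ball 0 r)"

lemma sets_ball_unif[simp, measurable_cong]: "sets (ball_unif r) = sets borel"
  and space_ball_unif[simp]: "space (ball_unif r) = UNIV"
  by (simp_all add: ball_unif_def)

lemma ball_measurable[measurable]: "ball (c::'a::euclidean_space) r \<in> sets borel"
  by simp

lemma emeasure_lborel_ball_pos: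
  "r > 0 \<Longrightarrow> emeasure lborel (ball (c::'a::euclidean_space) r) \<noteq> 0"
  using emeasure_ball[of r c] unit_ball_vol_pos[of "real DIM('a)"] by (simp add: less_imp_neq[symmetric])

lemma emeasure_lborel_ball_finite: "emeasure lborel (ball (c::'a::euclidean_space) r) \<noteq> \<infinity>"
  by (cases "r \<ge> 0") (simp_all add: emeasure_ball ball_empty)

lemma prob_space_ball_unif: "r > 0 \<Longrightarrow> prob_space (ball_unif r :: 'a::euclidean_space measure)"
  unfolding ball_unif_def
  by (rule prob_space_uniform_measure[OF emeasure_lborel_ball_pos emeasure_lborel_ball_finite])

lemma nn_integral_translate:
  fixes f :: "'a::euclidean_space \<Rightarrow> ennreal"
  assumes [measurable]: "f \<in> borel_measurable borel"
  shows "(\<integral>\<^sup>+q. f (c + q) \<partial>lborel) = (\<integral>\<^sup>+q. f q \<partial>lborel)"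
proof -
  have "(\<integral>\<^sup>+q. f q \<partial>lborel) = (\<integral>\<^sup>+q. f q \<partial>distr lborel borel ((+) c))"
    by (simp add: lborel_distr_plus)
  also have "\<dots> = (\<integral>\<^sup>+q. f (c + q) \<partial>lborel)"
    by (subst nn_integral_distr) auto
  finally show ?thesis ..
qed

lemma AE_translate:
  fixes P :: "'a::euclidean_space \<Rightarrow> bool"
  assumes "AE x in lborel. P x"
  shows "AE q in lborel. P (c + q)"
proof -
  have "AE x in distr lborel borel ((+) c). P x" using assms by (subst lborel_distr_plus)
  then show ?thesis by (rule AE_distrD[rotated]) simp
qed

lemma AE_ball_unif:
  fixes P :: "'a::euclidean_space \<Rightarrow> bool"
  assumes "AE x in lborel. P x"
  shows "AE p in ball_unif r. P (c + p)"
  unfolding ball_unif_def using AE_translate[OF assms, of c]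
  by (intro AE_uniform_measureI) auto

lemma AE_ball_unif_norm: "AE p in (ball_unif r :: 'a::euclidean_space measure). norm p < r"
  unfolding ball_unif_def by (intro AE_uniform_measureI) auto

lemma nn_integral_ball_unif:
  fixes f :: "'a::euclidean_space \<Rightarrow> ennreal"
  assumes [measurable]: "f \<in> borel_measurable borel"
  shows "(\<integral>\<^sup>+p. f (c + p) \<partial>ball_unif r) = (\<integral>\<^sup>+q\<in>ball c r. f q \<partial>lborel) / emeasure lborel (ball c r)"
proof -
  have e: "emeasure lborel (ball (0::'a) r) = emeasure lborel (ball c r)"
    by (cases "r \<ge> 0") (simp_all add: emeasure_ball ball_empty)
  have "(\<integral>\<^sup>+p. f (c + p) \<partial>ball_unif r) = (\<integral>\<^sup>+p. f (c + p) * indicator (ball 0 r) p \<partial>lborel) / emeasure lborel (ball (0::'a) r)"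
    unfolding ball_unif_def by (subst nn_integral_uniform_measure) auto
  also have "(\<integral>\<^sup>+p. f (c + p) * indicator (ball 0 r) p \<partial>lborel) = (\<integral>\<^sup>+p. f (c + p) * indicator (ball c r) (c + p) \<partial>lborel)"
    by (intro nn_integral_cong) (auto simp: dist_norm split: split_indicator)
  also have "\<dots> = (\<integral>\<^sup>+q\<in>ball c r. f q \<partial>lborel)"
    by (rule nn_integral_translate[where f = "\<lambda>q. f q * indicator (ball c r) q"]) simp
  finally show ?thesis unfolding e .
qed

lemma nn_integral_ball_unif_le:
  fixes f :: "'a::euclidean_space \<Rightarrow> ennreal"
  assumes [measurable]: "f \<in> borel_measurable borel" and "norm c + r \<le> R"
  shows "(\<integral>\<^sup>+p. f (c + p) \<partial>ball_unif r)
    \<le> (\<integral>\<^sup>+q\<in>ball 0 R. f q \<partial>lborel) / emeasure lborel (ball (0::'a) r)"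
proof -
  have e: "emeasure lborel (ball (0::'a) r) = emeasure lborel (ball c r)"
    by (cases "r \<ge> 0") (simp_all add: emeasure_ball ball_empty)
  have "q \<in> ball 0 R" if "q \<in> ball c r" for q
    using that assms(2) norm_triangle_sub[of q c] by (auto simp: dist_norm norm_minus_commute)
  then have "(\<integral>\<^sup>+q\<in>ball c r. f q \<partial>lborel) \<le> (\<integral>\<^sup>+q\<in>ball 0 R. f q \<partial>lborel)"
    by (intro nn_integral_mono) (auto split: split_indicator)
  then show ?thesis unfolding nn_integral_ball_unif[OF assms(1)] e by (rule divide_right_mono_ennreal)
qed

text \<open>The values are extended reals, so the statement covers points where \<open>f\<close> is infinite.\<close>

lemma ball_unif_tendsto:
  fixes f :: "'a::euclidean_space \<Rightarrow> ennreal"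
  assumes cont: "isCont f x" and m[measurable]: "f \<in> borel_measurable borel"
    and r: "\<And>j. r j > 0" "r \<longlonglongrightarrow> 0"
  shows "(\<lambda>j. \<integral>\<^sup>+p. f (x + p) \<partial>ball_unif (r j)) \<longlonglongrightarrow> f x"
proof (rule order_tendstoI)
  have ev: "eventually (\<lambda>j. AE p in ball_unif (r j). P (f (x + p))) sequentially"
    if P: "eventually (\<lambda>y. P (f y)) (nhds x)" for P
  proof -
    obtain d where "d > 0 \<and> (\<forall>y. dist y x < d \<longrightarrow> P (f y))"
      using P unfolding eventually_nhds_metric by (elim exE)
    then have d: "d > 0" "\<And>y. dist y x < d \<Longrightarrow> P (f y)" by simp_all
    have "eventually (\<lambda>j. r j < d) sequentially" using order_tendstoD(2)[OF r(2) d(1)] .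
    then show ?thesis
    proof eventually_elim
      case (elim j)
      show ?case using AE_ball_unif_norm[of "r j"]
      proof eventually_elim
        case (elim p)
        show ?case by (rule d(2)) (use elim \<open>r j < d\<close> in \<open>simp add: dist_norm\<close>)
      qed
    qed
  qed
  have lim: "(f \<longlongrightarrow> f x) (nhds x)"
    using cont by (simp add: isCont_def tendsto_nhds_iff)
  have one: "emeasure (ball_unif (r j)) (UNIV::'a set) = 1" for j
    using prob_space.emeasure_space_1[OF prob_space_ball_unif[OF r(1), where 'a='a], of j] by simp
  fix a
  {
    assume "a < f x"
    then obtain b where b: "a < b" "b < f x" using dense by blast
    from ev[OF order_tendstoD(1)[OF lim b(2)]]
    show "eventually (\<lambda>j. a < (\<integral>\<^sup>+p. f (x + p) \<partial>ball_unif (r j))) sequentially"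
    proof eventually_elim
      case (elim j)
      have "b = (\<integral>\<^sup>+p. b \<partial>(ball_unif (r j) :: 'a measure))" by (simp add: one)
      also have "\<dots> \<le> (\<integral>\<^sup>+p. f (x + p) \<partial>ball_unif (r j))"
        by (intro nn_integral_mono_AE) (rule eventually_mono[OF elim], simp)
      finally show ?case using b(1) by simp
    qed
  next
    assume "f x < a"
    then obtain b where b: "b < a" "f x < b" using dense by blast
    from ev[OF order_tendstoD(2)[OF lim b(2)]]
    show "eventually (\<lambda>j. (\<integral>\<^sup>+p. f (x + p) \<partial>ball_unif (r j)) < a) sequentially"
    proof eventually_elim
      case (elim j)
      have "(\<integral>\<^sup>+p. f (x + p) \<partial>ball_unif (r j)) \<le> (\<integral>\<^sup>+p. b \<partial>(ball_unif (r j) :: 'a measure))"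
        by (intro nn_integral_mono_AE) (rule eventually_mono[OF elim], simp)
      also have "\<dots> = b" by (simp add: one)
      finally show ?case using b(1) by simp
    qed
  }
qed

lemma ball_unif_tendsto_real:
  fixes f :: "'a::euclidean_space \<Rightarrow> real"
  assumes cont: "continuous_on UNIV f" 
    and r: "\<And>j. r j > 0" "r \<longlonglongrightarrow> 0"
  shows "(\<lambda>j. \<integral>p. f (x + p) \<partial>ball_unif (r j)) \<longlonglongrightarrow> f x"
proof (rule LIMSEQ_I)
  fix e :: real assume e: "e > 0"
  have [measurable]: "f \<in> borel_measurable borel" using cont by (rule borel_measurable_continuous_onI)
  have "isCont f x" using cont by (simp add: continuous_on_eq_continuous_at)
  then obtain d where d: "d > 0" "\<And>y. dist y x < d \<Longrightarrow> dist (f y) (f x) < e / 2"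
    using e unfolding continuous_at_eps_delta by (metis half_gt_zero)
  have "eventually (\<lambda>j. r j < d) sequentially" using order_tendstoD(2)[OF r(2) d(1)] .
  then show "\<exists>no. \<forall>n\<ge>no. norm ((\<integral>p. f (x + p) \<partial>ball_unif (r n)) - f x) < e"
  proof (unfold eventually_sequentially, elim exE, intro exI allI impI)
    fix N n assume "\<forall>n\<ge>N. r n < d" "N \<le> n"
    then have rn: "r n < d" by simp
    interpret U: prob_space "ball_unif (r n) :: 'a measure" by (rule prob_space_ball_unif[OF r(1)])
    have b: "AE p in ball_unif (r n). \<bar>f (x + p) - f x\<bar> \<le> e / 2"
      using AE_ball_unif_norm[of "r n"]
    proof eventually_elim
      case (elim p)
      then show ?case using d(2)[of "x + p"] rn by (auto simp: dist_norm)
    qed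
    have i: "integrable (ball_unif (r n)) (\<lambda>p. f (x + p) - f x)"
      by (rule U.integrable_const_bound[where B = "e / 2"]) (use b in auto)
    then have i2: "integrable (ball_unif (r n)) (\<lambda>p. f (x + p))"
      using Bochner_Integration.integrable_add[OF i, of "\<lambda>_. f x"] by simp
    have "(\<integral>p. f (x + p) \<partial>ball_unif (r n)) - f x = (\<integral>p. f (x + p) - f x \<partial>ball_unif (r n))"
      using i2 by (subst Bochner_Integration.integral_diff) (auto simp: U.prob_space[simplified])
    also have "norm \<dots> \<le> (\<integral>p. norm (f (x + p) - f x) \<partial>ball_unif (r n))" by (rule integral_norm_bound)
    also have "\<dots> \<le> (\<integral>p. e / 2 \<partial>(ball_unif (r n) :: 'a measure))"
      by (rule integral_mono_AE) (use i b in auto)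
    also have "\<dots> = e / 2" by (simp add: U.prob_space[simplified])
    finally show "norm ((\<integral>p. f (x + p) \<partial>ball_unif (r n)) - f x) < e" using e by simp
  qed
qed

abbreviation unit_line :: "real measure" where "unit_line \<equiv> uniform_measure lborel {0..1}"

lemma prob_space_unit_line: "prob_space unit_line"
  by (rule prob_space_uniform_measure) auto

lemma AE_unit_line: "AE s in unit_line. s \<in> {0..1}"
  by (intro AE_uniform_measureI) auto

text \<open>Finitely many exceptional points are allowed because a segment may run through the origin, where the
  potential need not be differentiable.\<close>

lemma integral_unit_line_FTC:
  fixes f f' :: "real \<Rightarrow> real"
  assumes "finite S" "\<And>x. x \<in> {0<..<1} - S \<Longrightarrow> (f has_real_derivative f' x) (at x)"
    and "continuous_on {0..1} f" and int: "integrable unit_line f'"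
    and [measurable]: "f' \<in> borel_measurable borel"
  shows "(\<integral>s. f' s \<partial>unit_line) = f 1 - f 0"
proof -
  have 1: "(f' has_integral (f 1 - f 0)) {0..1}"
    by (rule fundamental_theorem_of_calculus_interior_strong[OF assms(1)])
       (use assms(2,3) in \<open>auto simp: has_real_derivative_iff_has_vector_derivative\<close>)
  have d: "unit_line = density lborel (\<lambda>s. ennreal (indicator {0..1} s))"
    unfolding uniform_measure_def by (intro density_cong) (auto split: split_indicator)
  have "set_integrable lborel {0..1} f'"
    using int unfolding d set_integrable_def by (subst (asm) integrable_density) auto
  from set_borel_integral_eq_integral(2)[OF this]
  have "(\<integral>s. f' s \<partial>unit_line) = integral {0..1} f'"
    unfolding d set_lebesgue_integral_def by (subst integral_density) auto
  with 1 show ?thesis by (simp add: integral_unique)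
qed

section \<open>The interaction kernel and its ball averages\<close>

text \<open>The kernel is kept in two forms: \<open>k\<close> with values in \<open>[0, \<infinity>]\<close> for integration of nonnegative functions and Tonelli's
  theorem, and the real-valued \<open>w\<close> for derivatives. They agree off the origin; if \<open>k 0 = \<infinity>\<close> then
  \<open>w 0 = 0\<close> by the convention of \<^const>\<open>enn2real\<close>.\<close>

locale kernel =
  fixes k :: "'a::euclidean_space \<Rightarrow> ennreal" and w :: "'a \<Rightarrow> real"
  assumes k_cont: "continuous_on UNIV k"
    and k_sym: "k (- x) = k x"
    and w_def: "w x = enn2real (k x)"
    and k_fin: "x \<noteq> 0 \<Longrightarrow> k x < \<infinity>"
    and k_int: "(\<integral>\<^sup>+x\<in>ball 0 R. k x \<partial>lborel) < \<infinity>"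
    and k_avg: "R > 0 \<Longrightarrow> \<exists>C. \<forall>x r. norm x \<le> R \<and> 0 < r \<and> r \<le> R \<longrightarrow>
        (\<integral>\<^sup>+p. k (x + p) \<partial>ball_unif r) \<le> ennreal C * k x"
    and w4: "Ck_on 4 w (- {0})"
    and w_rad: "norm x = norm y \<Longrightarrow> w x = w y"
    and lap2: "x \<noteq> 0 \<Longrightarrow> laplacian (laplacian w) x < 0"
begin

lemma k_meas[measurable]: "k \<in> borel_measurable borel"
  using k_cont by (rule borel_measurable_continuous_onI)

lemma w_meas[measurable]: "w \<in> borel_measurable borel"
  unfolding w_def[abs_def] by measurable

lemma w_nonneg: "0 \<le> w x" by (simp add: w_def)

lemma k_eq: "k x < \<infinity> \<Longrightarrow> k x = ennreal (w x)"
  by (simp add: w_def less_top)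

lemma k_eq': "x \<noteq> 0 \<Longrightarrow> k x = ennreal (w x)"
  using k_eq k_fin by simp

lemma w4': "Ck_on (Suc 3) w (- {0})" using w4 by (simp add: eval_nat_numeral)

lemma open_punctured: "open (- {0::'a})" by auto

lemma w_diff: "x \<noteq> 0 \<Longrightarrow> w differentiable (at x)"
  by (rule Ck_on_differentiable[OF open_punctured _ w4']) simp

lemma w_cont: "x \<noteq> 0 \<Longrightarrow> isCont w x"
  using w_diff differentiable_imp_continuous_within by blast

abbreviation gw :: "'a \<Rightarrow> 'a" where "gw \<equiv> gradient w"

lemma gw_cont: "continuous_on (- {0}) gw"
  unfolding gradient_def
  by (intro continuous_intros Ck_on_continuous[OF Ck_on_partial[OF w4']])

lemma gw_meas[measurable]: "gw \<in> borel_measurable borel"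
proof -
  have "(\<lambda>x. if x \<in> - {0} then gw x else gw 0) \<in> borel_measurable borel"
    by (rule borel_measurable_continuous_on_if) (auto intro: gw_cont)
  moreover have "(\<lambda>x. if x \<in> - {0} then gw x else gw 0) = gw" by auto
  ultimately show ?thesis by simp
qed

lemma gw_int: "(\<integral>\<^sup>+x\<in>ball 0 R. ennreal (norm (gw x)) \<partial>lborel) < \<infinity>"
proof -
  have "(\<integral>\<^sup>+x\<in>ball 0 R. ennreal (norm (gw x)) \<partial>lborel) \<le> (\<integral>\<^sup>+x\<in>ball 0 (max R 1). ennreal (norm (gw x)) \<partial>lborel)"
    by (intro nn_integral_mono) (auto split: split_indicator)
  also have "\<dots> < \<infinity>"
    by (rule integrable_radial_gradient(1)[OF w4 w_nonneg w_rad lap2]) auto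
  finally show ?thesis .
qed

text \<open>In dimension one the flux is \<open>w'\<close> itself, so its lower bound keeps \<open>w\<close> bounded near \<open>0\<close>; continuity
  of \<open>k\<close> carries the bound to the origin. On the line, the segments that cross the origin are not
  negligible, and the fundamental theorem of calculus has to hold along them too.\<close>

lemma k_fin_DIM_1:
  assumes "DIM('a) = 1"
  shows "k x < \<infinity>"
proof (cases "x = 0")
  case True
  obtain C where C: "\<And>x::'a. x \<noteq> 0 \<Longrightarrow> norm x \<le> 1 \<Longrightarrow> - C \<le> gw x \<bullet> (x /\<^sub>R norm x)"
    using integrable_radial_gradient(2)[OF w4 w_nonneg w_rad lap2, of 1] assms by auto
  define e :: 'a where "e = (SOME b. b \<in> Basis)"
  have e: "norm e = 1" unfolding e_def by (rule norm_Basis) (rule SOME_Basis)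
  have bound: "w (s *\<^sub>R e) \<le> w e + \<bar>C\<bar>" if s: "0 < s" "s < 1" for s
  proof -
    have "\<exists>x. s < x \<and> x < 1 \<and> w (1 *\<^sub>R e) - w (s *\<^sub>R e) = (1 - s) * (gw (x *\<^sub>R e) \<bullet> e)"
    proof (rule MVT2[OF s(2)])
      fix x assume "s \<le> x" "x \<le> 1"
      then show "((\<lambda>s. w (s *\<^sub>R e)) has_real_derivative gw (x *\<^sub>R e) \<bullet> e) (at x)"
        using s e by (intro line_has_derivative w_diff) auto
    qed
    then obtain x where x: "s < x" "x < 1" "w e - w (s *\<^sub>R e) = (1 - s) * (gw (x *\<^sub>R e) \<bullet> e)" by auto
    have "x *\<^sub>R e \<noteq> 0" using x s e by auto
    then have "- C \<le> gw (x *\<^sub>R e) \<bullet> e" using C[of "x *\<^sub>R e"] x s e by (auto simp: field_simps)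
    then have "(1 - s) * (- \<bar>C\<bar>) \<le> (1 - s) * (gw (x *\<^sub>R e) \<bullet> e)" using s by (intro mult_left_mono) auto
    moreover have "(1 - s) * \<bar>C\<bar> \<le> \<bar>C\<bar>" using s by (simp add: mult_left_le_one_le)
    ultimately show ?thesis using x(3) by linarith
  qed
  have lim: "((\<lambda>s. k (s *\<^sub>R e)) \<longlongrightarrow> k 0) (at_right 0)"
  proof -
    have "((\<lambda>s. s *\<^sub>R e) \<longlongrightarrow> 0) (at_right 0)" by (auto intro!: tendsto_eq_intros)
    moreover have "isCont k 0" using k_cont by (simp add: continuous_on_eq_continuous_at)
    ultimately show ?thesis by (rule isCont_tendsto_compose[rotated])
  qed
  have "eventually (\<lambda>s. k (s *\<^sub>R e) \<le> ennreal (w e + \<bar>C\<bar>)) (at_right 0)"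
    unfolding eventually_at_right_field
  proof (intro exI[of _ 1] conjI allI impI)
    fix s :: real assume s: "0 < s" "s < 1"
    then have "s *\<^sub>R e \<noteq> 0" using e by auto
    then show "k (s *\<^sub>R e) \<le> ennreal (w e + \<bar>C\<bar>)"
      using bound[OF s] by (simp add: k_eq' ennreal_leI)
  qed simp
  from tendsto_upperbound[OF lim this] have "k 0 \<le> ennreal (w e + \<bar>C\<bar>)"
    by simp
  also have "\<dots> < \<infinity>" by simp
  finally show ?thesis using True by simp
qed (rule k_fin)

lemma w_cont_DIM_1:
  assumes "DIM('a) = 1"
  shows "continuous_on UNIV w"
  unfolding continuous_on_eq_continuous_at[OF open_UNIV]
proof
  fix x :: 'a
  have "isCont k x" using k_cont by (simp add: continuous_on_eq_continuous_at)
  then have "((\<lambda>x. ennreal (w x)) \<longlongrightarrow> ennreal (w x)) (at x)"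
    unfolding isCont_def k_eq[OF k_fin_DIM_1[OF assms]] .
  then have "(w \<longlongrightarrow> w x) (at x)" by (simp add: w_nonneg tendsto_ennreal_iff)
  then show "isCont w x" by (simp add: isCont_def)
qed

text \<open>Integrating first in \<open>q\<close> and then along the segment gives a finite integral over each
  ball, by local integrability of the gradient.\<close>

lemma AE_gw_line_integrable:
  "AE q in lborel. integrable unit_line (\<lambda>s. gw (q + s *\<^sub>R z) \<bullet> z)"
proof -
  interpret L: prob_space unit_line by (rule prob_space_unit_line)
  interpret P: pair_sigma_finite "lborel :: 'a measure" unit_line ..
  have "AE q in lborel. q \<in> ball (0::'a) (real R) \<longrightarrow> (\<integral>\<^sup>+s. ennreal (norm (gw (q + s *\<^sub>R z))) \<partial>unit_line) < \<infinity>" for R :: nat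
  proof -
    define N where "N = (\<integral>\<^sup>+x\<in>ball 0 (real R + norm z). ennreal (norm (gw x)) \<partial>lborel)"
    have N: "N < \<infinity>" unfolding N_def by (rule gw_int)
    have "(\<integral>\<^sup>+q. (\<integral>\<^sup>+s. ennreal (norm (gw (q + s *\<^sub>R z))) * indicator (ball 0 (real R)) q \<partial>unit_line) \<partial>lborel)
      = (\<integral>\<^sup>+s. (\<integral>\<^sup>+q. ennreal (norm (gw (q + s *\<^sub>R z))) * indicator (ball 0 (real R)) q \<partial>lborel) \<partial>unit_line)"
      by (rule P.Fubini'[symmetric]) measurable
    also have "\<dots> \<le> (\<integral>\<^sup>+s. N \<partial>unit_line)"
    proof (rule nn_integral_mono_AE)
      show "AE s in unit_line. (\<integral>\<^sup>+q. ennreal (norm (gw (q + s *\<^sub>R z))) * indicator (ball 0 (real R)) q \<partial>lborel) \<le> N"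
        using AE_unit_line
      proof eventually_elim
        case (elim s)
        have "norm q < real R + norm z" if "norm (q - s *\<^sub>R z) < real R" for q
        proof -
          have "norm q \<le> norm (q - s *\<^sub>R z) + norm (s *\<^sub>R z)" by (metis diff_add_cancel norm_triangle_ineq)
          moreover have "norm (s *\<^sub>R z) \<le> norm z" using elim by (simp add: mult_left_le_one_le)
          ultimately show ?thesis using that by linarith
        qed
        then have "(\<integral>\<^sup>+q. ennreal (norm (gw q)) * indicator (ball 0 (real R)) (q - s *\<^sub>R z) \<partial>lborel) \<le> N"
          unfolding N_def by (intro nn_integral_mono) (auto split: split_indicator simp: norm_minus_commute)
        also have "(\<integral>\<^sup>+q. ennreal (norm (gw q)) * indicator (ball 0 (real R)) (q - s *\<^sub>R z) \<partial>lborel)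
          = (\<integral>\<^sup>+q. ennreal (norm (gw (s *\<^sub>R z + q))) * indicator (ball 0 (real R)) ((s *\<^sub>R z + q) - s *\<^sub>R z) \<partial>lborel)"
          by (rule nn_integral_translate[symmetric, where f = "\<lambda>q. ennreal (norm (gw q)) * indicator (ball 0 (real R)) (q - s *\<^sub>R z)"])
             measurable
        finally show ?case by (simp add: add.commute)
      qed
    qed
    also have "\<dots> = N" using L.emeasure_space_1 by simp
    finally have "(\<integral>\<^sup>+q. (\<integral>\<^sup>+s. ennreal (norm (gw (q + s *\<^sub>R z))) * indicator (ball 0 (real R)) q \<partial>unit_line) \<partial>lborel) \<noteq> \<infinity>"
      using N by (auto simp: top_unique)
    then have "AE q in lborel. (\<integral>\<^sup>+s. ennreal (norm (gw (q + s *\<^sub>R z))) * indicator (ball 0 (real R)) q \<partial>unit_line) \<noteq> \<infinity>"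
      by (rule nn_integral_PInf_AE[rotated]) measurable
    then show ?thesis by eventually_elim (auto simp: less_top)
  qed
  then have "AE q in lborel. \<forall>R::nat. q \<in> ball (0::'a) (real R) \<longrightarrow> (\<integral>\<^sup>+s. ennreal (norm (gw (q + s *\<^sub>R z))) \<partial>unit_line) < \<infinity>"
    by (subst AE_all_countable) blast
  then show ?thesis
  proof eventually_elim
    case (elim q)
    obtain R :: nat where "norm q < real R" using reals_Archimedean2 by blast
    then have fin: "(\<integral>\<^sup>+s. ennreal (norm (gw (q + s *\<^sub>R z))) \<partial>unit_line) < \<infinity>" using elim by auto
    have "integrable unit_line (\<lambda>s. gw (q + s *\<^sub>R z))"
      by (rule integrableI_bounded) (use fin in \<open>simp_all\<close>)
    then show ?case by simp
  qed
qed

lemma AE_not_in_line: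
  assumes "DIM('a) \<noteq> 1"
  shows "AE q in lborel. q \<notin> span {z::'a}"
proof -
  have "dim (span {z}) \<le> 1" using dim_le_card'[of "{z}"] by (simp only: dim_span) simp
  then have "dim (span {z}) < DIM('a)" using assms DIM_positive[where 'a='a] by linarith
  then have "negligible (span {z})" by (rule negligible_lowdim)
  then have "span {z} \<in> null_sets lebesgue" by (simp add: negligible_iff_null_sets)
  moreover have "span {z} \<in> sets lborel" by (simp add: closed_subspace borel_closed)
  ultimately have "span {z} \<in> null_sets lborel" by (simp add: null_sets_completion_iff)
  then show ?thesis by (rule AE_not_in)
qed

text \<open>In dimension at least two, almost every segment with direction \<open>z\<close> misses the origin; in dimension
  one \<open>w\<close> is continuous across the origin and a single exceptional point is harmless.\<close>

lemma AE_w_FTC: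
  "AE q in lborel. (\<integral>s. gw (q + s *\<^sub>R z) \<bullet> z \<partial>unit_line) = w (q + z) - w q"
proof (cases "z = 0")
  case False
  have "AE q in lborel. DIM('a) = 1 \<or> q \<notin> span {z}"
    using AE_not_in_line[of z] by (cases "DIM('a) = 1") auto
  with AE_gw_line_integrable[of z] show ?thesis
  proof eventually_elim
    case (elim q)
    define S where "S = {s. q + s *\<^sub>R z = 0}"
    have inj: "s = t" if "q + s *\<^sub>R z = 0" "q + t *\<^sub>R z = 0" for s t
    proof -
      have "s *\<^sub>R z = t *\<^sub>R z" using that by (metis add_left_cancel)
      then show ?thesis using False by simp
    qed
    have S: "finite S"
    proof (cases "S = {}")
      case False
      then obtain s where "s \<in> S" by blast
      then have "S \<subseteq> {s}" unfolding S_def using inj by blast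
      then show ?thesis using finite_subset by blast
    qed simp
    have der: "((\<lambda>s. w (q + s *\<^sub>R z)) has_real_derivative gw (q + s *\<^sub>R z) \<bullet> z) (at s)" if "s \<notin> S" for s
    proof -
      have "((\<lambda>s. q + s *\<^sub>R z) has_derivative (\<lambda>s. s *\<^sub>R z)) (at s)"
        by (auto intro!: derivative_eq_intros)
      from has_derivative_compose[OF this has_derivative_gradient[OF w_diff]] that
      show ?thesis by (simp add: has_field_derivative_def mult_commute_abs S_def)
    qed
    have cont: "continuous_on {0..1} (\<lambda>s. w (q + s *\<^sub>R z))"
    proof (cases "DIM('a) = 1")
      case True
      show ?thesis by (rule continuous_on_compose2[OF w_cont_DIM_1[OF True]]) (auto intro!: continuous_intros)
    next
      case False
      then have q: "q \<notin> span {z}" using elim by simp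
      have "s \<notin> S" for s
      proof
        assume "s \<in> S"
        then have "q = (- s) *\<^sub>R z" unfolding S_def by (simp add: eq_neg_iff_add_eq_0)
        then have "q \<in> span {z}" by (simp only: span_mul span_base singletonI)
        then show False using q by blast
      qed
      then show ?thesis
        by (intro DERIV_continuous_on) (rule has_field_derivative_at_within[OF der])
    qed
    have "(\<integral>s. gw (q + s *\<^sub>R z) \<bullet> z \<partial>unit_line) = w (q + 1 *\<^sub>R z) - w (q + 0 *\<^sub>R z)"
      by (rule integral_unit_line_FTC[OF S _ cont elim(1)]) (use der in auto)
    then show ?case by simp
  qed
qed simp

text \<open>An upper bound for the average of \<open>|\<nabla>w|\<close> over any ball of radius \<open>r\<close> inside the ball of
  radius \<open>R\<close> around the origin.\<close>

definition grad_bound :: "real \<Rightarrow> real \<Rightarrow> real" where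
  "grad_bound r R = enn2real ((\<integral>\<^sup>+q\<in>ball 0 R. ennreal (norm (gw q)) \<partial>lborel) / emeasure lborel (ball (0::'a) r))"

lemma nn_gw_bound:
  assumes "r > 0" "norm c + r \<le> R"
  shows "(\<integral>\<^sup>+p. ennreal (norm (gw (c + p))) \<partial>ball_unif r) \<le> ennreal (grad_bound r R)"
proof -
  have "(\<integral>\<^sup>+q\<in>ball 0 R. ennreal (norm (gw q)) \<partial>lborel) / emeasure lborel (ball (0::'a) r) < \<infinity>"
    using gw_int[of R] emeasure_lborel_ball_pos[OF assms(1), of "0::'a"]
    by (simp add: ennreal_divide_eq_top_iff less_top[symmetric] top.not_eq_extremum[symmetric])
  then have e: "ennreal (grad_bound r R) = (\<integral>\<^sup>+q\<in>ball 0 R. ennreal (norm (gw q)) \<partial>lborel) / emeasure lborel (ball (0::'a) r)"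
    unfolding grad_bound_def by simp
  show ?thesis unfolding e
    by (rule nn_integral_ball_unif_le[OF _ assms(2), where f = "\<lambda>q. ennreal (norm (gw q))"]) measurable
qed

definition avg_gw :: "real \<Rightarrow> 'a \<Rightarrow> 'a" where
  "avg_gw r c = (\<integral>p. gw (c + p) \<partial>ball_unif r)"

definition avg_w :: "real \<Rightarrow> 'a \<Rightarrow> real" where
  "avg_w r c = (\<integral>p. w (c + p) \<partial>ball_unif r)"

lemma integrable_gw_ball:
  assumes "r > 0" shows "integrable (ball_unif r) (\<lambda>p. gw (c + p))"
proof (rule integrableI_bounded)
  have "(\<integral>\<^sup>+p. ennreal (norm (gw (c + p))) \<partial>ball_unif r) \<le> ennreal (grad_bound r (norm c + r))"
    by (rule nn_gw_bound[OF assms]) simp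
  then show "(\<integral>\<^sup>+p. ennreal (norm (gw (c + p))) \<partial>ball_unif r) < \<infinity>"
    by (rule le_less_trans) simp
qed measurable

lemma norm_avg_gw:
  assumes "r > 0" "norm c + r \<le> R"
  shows "norm (avg_gw r c) \<le> grad_bound r R"
proof -
  have "ennreal (norm (avg_gw r c)) \<le> (\<integral>\<^sup>+p. ennreal (norm (gw (c + p))) \<partial>ball_unif r)"
    unfolding avg_gw_def by (rule integral_norm_bound_ennreal[OF integrable_gw_ball[OF assms(1)]])
  also have "\<dots> \<le> ennreal (grad_bound r R)" by (rule nn_gw_bound[OF assms])
  finally show ?thesis by (simp add: grad_bound_def ennreal_le_iff)
qed

lemma avg_gw_meas[measurable]: "r > 0 \<Longrightarrow> avg_gw r \<in> borel_measurable borel"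
proof -
  assume "r > 0"
  interpret U: prob_space "ball_unif r :: 'a measure" by (rule prob_space_ball_unif) fact
  show "avg_gw r \<in> borel_measurable borel" unfolding avg_gw_def by measurable
qed

lemma avg_w_meas[measurable]: "r > 0 \<Longrightarrow> avg_w r \<in> borel_measurable borel"
proof -
  assume "r > 0"
  interpret U: prob_space "ball_unif r :: 'a measure" by (rule prob_space_ball_unif) fact
  show "avg_w r \<in> borel_measurable borel" unfolding avg_w_def by measurable
qed

lemma AE_k_eq: "AE p in ball_unif r. k (c + p) = ennreal (w (c + p))"
  by (rule AE_ball_unif[where P = "\<lambda>q. k q = ennreal (w q)"])
     (use AE_lborel_singleton[of "0::'a"] in \<open>eventually_elim, simp add: k_eq'\<close>)

text \<open>The analogous bound for the averages of the kernel.\<close>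

definition k_bound :: "real \<Rightarrow> real \<Rightarrow> real" where
  "k_bound r R = enn2real ((\<integral>\<^sup>+q\<in>ball 0 R. k q \<partial>lborel) / emeasure lborel (ball (0::'a) r))"

lemma nn_k_bound:
  assumes "r > 0" "norm c + r \<le> R"
  shows "(\<integral>\<^sup>+p. k (c + p) \<partial>ball_unif r) \<le> ennreal (k_bound r R)"
proof -
  have "(\<integral>\<^sup>+q\<in>ball 0 R. k q \<partial>lborel) / emeasure lborel (ball (0::'a) r) < \<infinity>"
    using k_int[of R] emeasure_lborel_ball_pos[OF assms(1), of "0::'a"]
    by (simp add: ennreal_divide_eq_top_iff less_top[symmetric] top.not_eq_extremum[symmetric])
  then have e: "ennreal (k_bound r R) = (\<integral>\<^sup>+q\<in>ball 0 R. k q \<partial>lborel) / emeasure lborel (ball (0::'a) r)"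
    unfolding k_bound_def by simp
  show ?thesis unfolding e by (rule nn_integral_ball_unif_le[OF _ assms(2)]) measurable
qed

lemma integrable_w_ball:
  assumes "r > 0" shows "integrable (ball_unif r) (\<lambda>p. w (c + p))"
    and avg_w_ennreal: "(\<integral>\<^sup>+p. k (c + p) \<partial>ball_unif r) = ennreal (avg_w r c)"
proof -
  have e: "(\<integral>\<^sup>+p. k (c + p) \<partial>ball_unif r) = (\<integral>\<^sup>+p. ennreal (w (c + p)) \<partial>ball_unif r)"
    by (rule nn_integral_cong_AE) (rule AE_k_eq)
  have "(\<integral>\<^sup>+p. k (c + p) \<partial>ball_unif r) \<le> ennreal (k_bound r (norm c + r))"
    by (rule nn_k_bound[OF assms]) simp
  then have "(\<integral>\<^sup>+p. ennreal (w (c + p)) \<partial>ball_unif r) < \<infinity>"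
    unfolding e by (rule le_less_trans) simp
  then show i: "integrable (ball_unif r) (\<lambda>p. w (c + p))"
    by (intro integrableI_nonneg) (auto simp: w_nonneg)
  show "(\<integral>\<^sup>+p. k (c + p) \<partial>ball_unif r) = ennreal (avg_w r c)"
    unfolding e avg_w_def by (rule nn_integral_eq_integral[OF i]) (simp add: w_nonneg)
qed

lemma avg_w_bounds:
  assumes "r > 0" "norm c + r \<le> R"
  shows "0 \<le> avg_w r c" "avg_w r c \<le> k_bound r R"
proof -
  show "0 \<le> avg_w r c" unfolding avg_w_def by (simp add: w_nonneg)
  have "ennreal (avg_w r c) \<le> ennreal (k_bound r R)"
    using nn_k_bound[OF assms] unfolding avg_w_ennreal[OF assms(1)] .
  then show "avg_w r c \<le> k_bound r R" by (simp add: k_bound_def ennreal_le_iff)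
qed

lemma norm_line_le: "s \<in> {0..1} \<Longrightarrow> norm (c + s *\<^sub>R z) \<le> norm c + norm (z::'a)"
  by (rule order_trans[OF norm_triangle_ineq]) (simp add: mult_left_le_one_le)

text \<open>Averaging turns the almost-everywhere identity \<open>AE_w_FTC\<close> into one that holds for all points.\<close>

lemma avg_w_diff:
  assumes r: "r > 0"
  shows "avg_w r (c + z) - avg_w r c = (\<integral>s. avg_gw r (c + s *\<^sub>R z) \<bullet> z \<partial>unit_line)"
proof -
  interpret L: prob_space unit_line by (rule prob_space_unit_line)
  interpret U: prob_space "ball_unif r :: 'a measure" by (rule prob_space_ball_unif[OF r])
  interpret P: pair_sigma_finite "ball_unif r :: 'a measure" unit_line ..
  let ?f = "\<lambda>p s. gw (c + p + s *\<^sub>R z) \<bullet> z"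
  have int: "integrable (ball_unif r \<Otimes>\<^sub>M unit_line) (case_prod ?f)"
  proof (rule integrableI_bounded)
    have "(\<integral>\<^sup>+x. ennreal (norm (case_prod ?f x)) \<partial>(ball_unif r \<Otimes>\<^sub>M unit_line))
        = (\<integral>\<^sup>+s. (\<integral>\<^sup>+p. ennreal (norm (?f p s)) \<partial>ball_unif r) \<partial>unit_line)"
      by (subst P.nn_integral_snd[symmetric]) auto
    also have "\<dots> \<le> (\<integral>\<^sup>+s. ennreal (norm z) * ennreal (grad_bound r (norm c + norm z + r)) \<partial>unit_line)"
    proof (rule nn_integral_mono_AE)
      show "AE s in unit_line. (\<integral>\<^sup>+p. ennreal (norm (?f p s)) \<partial>ball_unif r)
        \<le> ennreal (norm z) * ennreal (grad_bound r (norm c + norm z + r))"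
        using AE_unit_line
      proof eventually_elim
        case (elim s)
        have "(\<integral>\<^sup>+p. ennreal (norm (?f p s)) \<partial>ball_unif r)
          \<le> (\<integral>\<^sup>+p. ennreal (norm z) * ennreal (norm (gw ((c + s *\<^sub>R z) + p))) \<partial>ball_unif r)"
          by (intro nn_integral_mono)
             (auto simp: ennreal_mult''[symmetric] algebra_simps intro!: ennreal_leI order_trans[OF Cauchy_Schwarz_ineq2])
        also have "\<dots> = ennreal (norm z) * (\<integral>\<^sup>+p. ennreal (norm (gw ((c + s *\<^sub>R z) + p))) \<partial>ball_unif r)"
          by (rule nn_integral_cmult) measurable
        also have "\<dots> \<le> ennreal (norm z) * ennreal (grad_bound r (norm c + norm z + r))"
          by (rule mult_left_mono[OF nn_gw_bound[OF r]]) (use norm_line_le[OF elim] in auto)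
        finally show ?case .
      qed
    qed
    also have "\<dots> < \<infinity>" using L.emeasure_space_1 by (simp add: ennreal_mult_less_top)
    finally show "(\<integral>\<^sup>+x. ennreal (norm (case_prod ?f x)) \<partial>(ball_unif r \<Otimes>\<^sub>M unit_line)) < \<infinity>" .
  qed measurable
  have "avg_w r (c + z) - avg_w r c = (\<integral>p. w ((c + z) + p) - w (c + p) \<partial>ball_unif r)"
    unfolding avg_w_def by (rule Bochner_Integration.integral_diff[symmetric]) (rule integrable_w_ball[OF r])+
  also have "\<dots> = (\<integral>p. (\<integral>s. ?f p s \<partial>unit_line) \<partial>ball_unif r)"
  proof (rule integral_cong_AE)
    show "AE p in ball_unif r. w ((c + z) + p) - w (c + p) = (\<integral>s. ?f p s \<partial>unit_line)"
      using AE_ball_unif[OF AE_w_FTC[of z], where r = r and c = c] by eventually_elim (simp add: algebra_simps)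
  qed measurable
  also have "\<dots> = (\<integral>s. (\<integral>p. ?f p s \<partial>ball_unif r) \<partial>unit_line)"
    by (rule P.Fubini_integral[symmetric]) (rule int)
  also have "\<dots> = (\<integral>s. avg_gw r (c + s *\<^sub>R z) \<bullet> z \<partial>unit_line)"
  proof (rule Bochner_Integration.integral_cong[OF refl])
    fix s
    have "(\<integral>p. ?f p s \<partial>ball_unif r) = (\<integral>p. gw ((c + s *\<^sub>R z) + p) \<bullet> z \<partial>ball_unif r)"
      by (simp add: algebra_simps)
    also have "\<dots> = avg_gw r (c + s *\<^sub>R z) \<bullet> z"
      unfolding avg_gw_def by (rule integral_inner_left) (simp add: integrable_gw_ball[OF r])
    finally show "(\<integral>p. ?f p s \<partial>ball_unif r) = avg_gw r (c + s *\<^sub>R z) \<bullet> z" .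
  qed
  finally show ?thesis .
qed

end

section \<open>The potential of the density is continuously differentiable\<close>

text \<open>A function whose increments are line integrals of a continuous field has that field as its gradient.\<close>

lemma has_derivative_of_line_integral:
  fixes v :: "'a::euclidean_space \<Rightarrow> real"
  assumes g: "continuous_on UNIV g"
    and v: "\<And>x z. v (x + z) - v x = integral {0..1} (\<lambda>s. g (x + s *\<^sub>R z) \<bullet> z)"
  shows "(v has_derivative (\<lambda>z. g x \<bullet> z)) (at x)"
  unfolding has_derivative_at_alt
proof (intro conjI allI impI)
  show "bounded_linear ((\<bullet>) (g x))" by (rule bounded_linear_inner_right)
  fix e :: real assume e: "e > 0"
  have "isCont g x" using g by (simp add: continuous_on_eq_continuous_at)
  then obtain d where d: "d > 0" "\<And>y. dist y x < d \<Longrightarrow> dist (g y) (g x) < e"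
    using e unfolding continuous_at_eps_delta by metis
  show "\<exists>d>0. \<forall>y. norm (y - x) < d \<longrightarrow> norm (v y - v x - g x \<bullet> (y - x)) \<le> e * norm (y - x)"
  proof (intro exI[of _ d] conjI allI impI d(1))
    fix y assume y: "norm (y - x) < d"
    define z where "z = y - x"
    have cont: "continuous_on {0..1} (\<lambda>s. g (x + s *\<^sub>R z) \<bullet> z)"
      by (intro continuous_intros continuous_on_compose2[OF g]) auto
    have "v y - v x - g x \<bullet> z = integral {0..1} (\<lambda>s. g (x + s *\<^sub>R z) \<bullet> z) - integral {0..1} (\<lambda>s::real. g x \<bullet> z)"
      using v[of x z] by (simp add: z_def)
    also have "\<dots> = integral {0..1} (\<lambda>s. g (x + s *\<^sub>R z) \<bullet> z - g x \<bullet> z)"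
      by (rule Henstock_Kurzweil_Integration.integral_diff[symmetric])
         (auto intro: integrable_continuous_interval cont)
    also have "norm \<dots> \<le> (e * norm z) * (1 - 0)"
    proof (rule integral_bound)
      show "continuous_on {0..1} (\<lambda>s. g (x + s *\<^sub>R z) \<bullet> z - g x \<bullet> z)"
        by (intro continuous_intros cont)
      show "norm (g (x + s *\<^sub>R z) \<bullet> z - g x \<bullet> z) \<le> e * norm z" if s: "s \<in> {0..1}" for s
      proof -
        have "norm (s *\<^sub>R z) \<le> norm z" using s by (simp add: mult_left_le_one_le)
        then have "dist (x + s *\<^sub>R z) x < d" using y by (simp add: dist_norm z_def)
        then have "norm (g (x + s *\<^sub>R z) - g x) \<le> e" using d(2) by (simp add: dist_norm less_imp_le)
        moreover have "norm (g (x + s *\<^sub>R z) \<bullet> z - g x \<bullet> z) \<le> norm (g (x + s *\<^sub>R z) - g x) * norm z"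
          using Cauchy_Schwarz_ineq2[of "g (x + s *\<^sub>R z) - g x" z] by (simp add: inner_diff_left)
        ultimately show ?thesis by (meson mult_right_mono norm_ge_zero order_trans)
      qed
    qed simp
    finally show "norm (v y - v x - g x \<bullet> (y - x)) \<le> e * norm (y - x)" by (simp add: z_def)
  qed
qed

text \<open>The field \<open>g\<close> is the continuous representative of the convolution of \<open>\<nabla>w\<close> with \<open>\<rho>\<close>, and the
  ball of radius \<open>B\<close> carries all the mass.\<close>

locale kernel_density = kernel k w
  for k :: "'a::euclidean_space \<Rightarrow> ennreal" and w :: "'a \<Rightarrow> real" +
  fixes \<rho> :: "'a measure" and B :: real and g :: "'a \<Rightarrow> 'a"
  assumes prob: "prob_space \<rho>"
    and sets_\<rho>[simp, measurable_cong]: "sets \<rho> = sets borel"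
    and bounded: "AE y in \<rho>. norm y \<le> B"
    and g_cont: "continuous_on UNIV g"
    and g_eq: "AE x in lborel. integrable \<rho> (\<lambda>y. gw (x - y)) \<and> g x = (\<integral>y. gw (x - y) \<partial>\<rho>)"
begin

sublocale \<rho>: prob_space \<rho> by (rule prob)

lemma space_\<rho>[simp]: "space \<rho> = UNIV"
  using sets_eq_imp_space_eq[OF sets_\<rho>] by simp

lemma g_meas[measurable]: "g \<in> borel_measurable borel"
  using g_cont by (rule borel_measurable_continuous_onI)

definition pot :: "'a \<Rightarrow> ennreal" where "pot x = (\<integral>\<^sup>+y. k (x - y) \<partial>\<rho>)"

lemma pot_meas[measurable]: "pot \<in> borel_measurable borel"
  unfolding pot_def by measurable

definition avg_pot :: "real \<Rightarrow> 'a \<Rightarrow> real" where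
  "avg_pot r x = (\<integral>y. avg_w r (x - y) \<partial>\<rho>)"

lemma AE_norm_diff: "AE y in \<rho>. norm (x - y) \<le> norm x + B"
  using bounded by eventually_elim (rule order_trans[OF norm_triangle_ineq4], simp)

lemma integrable_avg_w:
  assumes r: "r > 0" shows "integrable \<rho> (\<lambda>y. avg_w r (x - y))"
proof (rule \<rho>.integrable_const_bound)
  show "AE y in \<rho>. norm (avg_w r (x - y)) \<le> k_bound r (norm x + B + r)"
    using AE_norm_diff[of x]
  proof eventually_elim
    case (elim y)
    have "norm (x - y) + r \<le> norm x + B + r" using elim by simp
    from avg_w_bounds[OF r this] show ?case by simp
  qed
  show "(\<lambda>y. avg_w r (x - y)) \<in> borel_measurable \<rho>"
    using avg_w_meas[OF r] by measurable
qed

lemma avg_pot_ennreal: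
  assumes r: "r > 0"
  shows "(\<integral>\<^sup>+p. pot (x + p) \<partial>ball_unif r) = ennreal (avg_pot r x)"
proof -
  interpret U: prob_space "ball_unif r :: 'a measure" by (rule prob_space_ball_unif[OF r])
  interpret P: pair_sigma_finite \<rho> "ball_unif r :: 'a measure" ..
  have "(\<integral>\<^sup>+p. pot (x + p) \<partial>ball_unif r) = (\<integral>\<^sup>+p. (\<integral>\<^sup>+y. k (x + p - y) \<partial>\<rho>) \<partial>ball_unif r)"
    unfolding pot_def ..
  also have "\<dots> = (\<integral>\<^sup>+y. (\<integral>\<^sup>+p. k (x + p - y) \<partial>ball_unif r) \<partial>\<rho>)"
    by (rule P.Fubini') measurable
  also have "\<dots> = (\<integral>\<^sup>+y. ennreal (avg_w r (x - y)) \<partial>\<rho>)"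
    by (intro nn_integral_cong) (simp add: avg_w_ennreal[OF r, symmetric] algebra_simps)
  also have "\<dots> = ennreal (avg_pot r x)"
    unfolding avg_pot_def
    by (rule nn_integral_eq_integral[OF integrable_avg_w[OF r]])
       (use avg_w_bounds(1)[OF r order_refl] in auto)
  finally show ?thesis .
qed

lemma avg_gw_conv:
  assumes r: "r > 0"
  shows "(\<integral>y. avg_gw r (c - y) \<partial>\<rho>) = (\<integral>p. g (c + p) \<partial>ball_unif r)"
proof -
  interpret U: prob_space "ball_unif r :: 'a measure" by (rule prob_space_ball_unif[OF r])
  interpret P: pair_sigma_finite \<rho> "ball_unif r :: 'a measure" ..
  let ?f = "\<lambda>y p. gw (c - y + p)"
  have int: "integrable (\<rho> \<Otimes>\<^sub>M ball_unif r) (case_prod ?f)"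
  proof (rule integrableI_bounded)
    have "(\<integral>\<^sup>+x. ennreal (norm (case_prod ?f x)) \<partial>(\<rho> \<Otimes>\<^sub>M ball_unif r))
        = (\<integral>\<^sup>+y. (\<integral>\<^sup>+p. ennreal (norm (?f y p)) \<partial>ball_unif r) \<partial>\<rho>)"
      by (subst U.nn_integral_fst[symmetric]) auto
    also have "\<dots> \<le> (\<integral>\<^sup>+y. ennreal (grad_bound r (norm c + B + r)) \<partial>\<rho>)"
      by (rule nn_integral_mono_AE)
         (use AE_norm_diff[of c] in eventually_elim, rule nn_gw_bound[OF r], simp)
    also have "\<dots> < \<infinity>" using \<rho>.emeasure_space_1 by simp
    finally show "(\<integral>\<^sup>+x. ennreal (norm (case_prod ?f x)) \<partial>(\<rho> \<Otimes>\<^sub>M ball_unif r)) < \<infinity>" .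
  qed measurable
  have "(\<integral>y. avg_gw r (c - y) \<partial>\<rho>) = (\<integral>p. (\<integral>y. ?f y p \<partial>\<rho>) \<partial>ball_unif r)"
    unfolding avg_gw_def by (rule P.Fubini_integral[symmetric]) (rule int)
  also have "\<dots> = (\<integral>p. g (c + p) \<partial>ball_unif r)"
  proof (rule integral_cong_AE)
    show "AE p in ball_unif r. (\<integral>y. ?f y p \<partial>\<rho>) = g (c + p)"
      using AE_ball_unif[OF g_eq, where r = r and c = c]
      by eventually_elim (auto simp: algebra_simps)
  qed measurable
  finally show ?thesis .
qed

text \<open>The line integral of \<open>g\<close> from \<open>x\<close> to \<open>x + z\<close>, which will turn out to be the increment of the
  potential.\<close>

definition G :: "'a \<Rightarrow> 'a \<Rightarrow> real" where
  "G x z = integral {0..1} (\<lambda>s. g (x + s *\<^sub>R z) \<bullet> z)"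

lemma G_cont: "continuous_on UNIV (\<lambda>x. G x z)"
  unfolding G_def
proof -
  have "continuous_on (UNIV \<times> cbox 0 1) (\<lambda>(x, s). g (x + s *\<^sub>R z) \<bullet> z)"
    unfolding split_beta by (intro continuous_intros continuous_on_compose2[OF g_cont]) auto
  from integral_continuous_on_param[OF this]
  show "continuous_on UNIV (\<lambda>x. integral {0..1} (\<lambda>s. g (x + s *\<^sub>R z) \<bullet> z))" by simp
qed

lemma G_unit_line: "(\<integral>s. g (x + s *\<^sub>R z) \<bullet> z \<partial>unit_line) = G x z"
proof -
  let ?f = "\<lambda>s. g (x + s *\<^sub>R z) \<bullet> z"
  have cont: "continuous_on {0..1} ?f"
    by (intro continuous_intros continuous_on_compose2[OF g_cont]) auto
  have d: "unit_line = density lborel (\<lambda>s. ennreal (indicator {0..1} s))"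
    unfolding uniform_measure_def by (intro density_cong) (auto split: split_indicator)
  have "set_integrable lborel {0..1} ?f" by (rule borel_integrable_atLeastAtMost') (rule cont)
  from set_borel_integral_eq_integral(2)[OF this]
  have "(\<integral>s. ?f s \<partial>unit_line) = integral {0..1} ?f"
    unfolding d set_lebesgue_integral_def by (subst integral_density) auto
  then show ?thesis unfolding G_def .
qed

lemma g_bounded_ball: "\<exists>M. \<forall>q. norm q \<le> R \<longrightarrow> norm (g q) \<le> M"
proof -
  have "bounded (g ` cball 0 R)"
    by (intro compact_imp_bounded compact_continuous_image continuous_on_subset[OF g_cont]) auto
  then obtain M where "\<forall>y\<in>g ` cball 0 R. norm y \<le> M" unfolding bounded_iff by (elim exE)
  then show ?thesis by (intro exI[of _ M]) simp
qed

text \<open>Fubini's theorem, applied to the product of \<open>\<rho>\<close>, the ball and the segment, moves the averages onto \<open>g\<close>. All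
  integrands are bounded, since the averages of \<open>\<nabla>w\<close> are locally bounded.\<close>

lemma avg_pot_diff:
  assumes r: "r > 0"
  shows "avg_pot r (x + z) - avg_pot r x = (\<integral>p. G (x + p) z \<partial>ball_unif r)"
proof -
  interpret L: prob_space unit_line by (rule prob_space_unit_line)
  interpret U: prob_space "ball_unif r :: 'a measure" by (rule prob_space_ball_unif[OF r])
  interpret P: pair_sigma_finite \<rho> unit_line ..
  interpret Q: pair_sigma_finite "ball_unif r :: 'a measure" unit_line ..
  note [measurable] = avg_gw_meas[OF r]
  have b1: "norm (avg_gw r (x - y + s *\<^sub>R z) \<bullet> z) \<le> grad_bound r (norm x + norm z + B + r) * norm z"
    if "norm (x - y) \<le> norm x + B" "s \<in> {0..1}" for y s
  proof -
    have "norm (x - y + s *\<^sub>R z) + r \<le> norm x + norm z + B + r"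
      using norm_line_le[OF that(2), of "x - y" z] that(1) by simp
    from norm_avg_gw[OF r this] show ?thesis
      by (intro order_trans[OF Cauchy_Schwarz_ineq2[unfolded real_norm_def[symmetric]]] mult_right_mono) auto
  qed
  have int1: "integrable (\<rho> \<Otimes>\<^sub>M unit_line) (\<lambda>(y, s). avg_gw r (x - y + s *\<^sub>R z) \<bullet> z)"
  proof -
    interpret PP: pair_prob_space \<rho> unit_line ..
    show ?thesis
    proof (rule PP.P.integrable_const_bound)
      show "AE ys in \<rho> \<Otimes>\<^sub>M unit_line. norm (case ys of (y, s) \<Rightarrow> avg_gw r (x - y + s *\<^sub>R z) \<bullet> z)
          \<le> grad_bound r (norm x + norm z + B + r) * norm z"
      proof (rule P.AE_pair_measure)
        show "AE y in \<rho>. AE s in unit_line. norm (case (y, s) of (y, s) \<Rightarrow> avg_gw r (x - y + s *\<^sub>R z) \<bullet> z)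
          \<le> grad_bound r (norm x + norm z + B + r) * norm z"
          using AE_norm_diff[of x]
        proof eventually_elim
          case (elim y)
          show ?case using AE_unit_line by eventually_elim (use b1[OF elim] in auto)
        qed
      qed measurable
    qed measurable
  qed
  have "avg_pot r (x + z) - avg_pot r x = (\<integral>y. avg_w r (x + z - y) - avg_w r (x - y) \<partial>\<rho>)"
    unfolding avg_pot_def by (rule Bochner_Integration.integral_diff[symmetric]) (rule integrable_avg_w[OF r])+
  also have "\<dots> = (\<integral>y. (\<integral>s. avg_gw r (x - y + s *\<^sub>R z) \<bullet> z \<partial>unit_line) \<partial>\<rho>)"
  proof (rule Bochner_Integration.integral_cong[OF refl])
    fix y
    have "x + z - y = (x - y) + z" by simp
    then show "avg_w r (x + z - y) - avg_w r (x - y) = (\<integral>s. avg_gw r (x - y + s *\<^sub>R z) \<bullet> z \<partial>unit_line)"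
      by (simp only: avg_w_diff[OF r])
  qed
  also have "\<dots> = (\<integral>s. (\<integral>y. avg_gw r (x - y + s *\<^sub>R z) \<bullet> z \<partial>\<rho>) \<partial>unit_line)"
    by (rule P.Fubini_integral[symmetric]) (rule int1)
  also have "\<dots> = (\<integral>s. (\<integral>p. g (x + p + s *\<^sub>R z) \<bullet> z \<partial>ball_unif r) \<partial>unit_line)"
  proof (rule integral_cong_AE)
    show "AE s in unit_line. (\<integral>y. avg_gw r (x - y + s *\<^sub>R z) \<bullet> z \<partial>\<rho>) = (\<integral>p. g (x + p + s *\<^sub>R z) \<bullet> z \<partial>ball_unif r)"
      using AE_unit_line
    proof eventually_elim
      case (elim s)
      let ?c = "x + s *\<^sub>R z"
      have i1: "integrable \<rho> (\<lambda>y. avg_gw r (?c - y))"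
      proof (rule \<rho>.integrable_const_bound)
        show "AE y in \<rho>. norm (avg_gw r (?c - y)) \<le> grad_bound r (norm ?c + B + r)"
          using AE_norm_diff[of ?c] by eventually_elim (rule norm_avg_gw[OF r], simp)
      qed measurable
      obtain M where M: "\<And>q. norm q \<le> norm ?c + r \<Longrightarrow> norm (g q) \<le> M" using g_bounded_ball by blast
      have i2: "integrable (ball_unif r) (\<lambda>p. g (?c + p))"
      proof (rule U.integrable_const_bound)
        show "AE p in ball_unif r. norm (g (?c + p)) \<le> M"
          using AE_ball_unif_norm[of r]
        proof eventually_elim
          case (elim p)
          then show ?case using norm_triangle_ineq[of ?c p] by (intro M) simp
        qed
      qed measurable
      have "(\<integral>y. avg_gw r (x - y + s *\<^sub>R z) \<bullet> z \<partial>\<rho>) = (\<integral>y. avg_gw r (?c - y) \<bullet> z \<partial>\<rho>)"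
        by (simp add: algebra_simps)
      also have "\<dots> = (\<integral>y. avg_gw r (?c - y) \<partial>\<rho>) \<bullet> z" by (rule integral_inner_left) (rule i1)
      also have "\<dots> = (\<integral>p. g (?c + p) \<partial>ball_unif r) \<bullet> z" by (simp only: avg_gw_conv[OF r])
      also have "\<dots> = (\<integral>p. g (?c + p) \<bullet> z \<partial>ball_unif r)" by (rule integral_inner_left[symmetric]) (rule i2)
      finally show ?case by (simp add: algebra_simps)
    qed
  qed measurable
  also have "\<dots> = (\<integral>p. (\<integral>s. g (x + p + s *\<^sub>R z) \<bullet> z \<partial>unit_line) \<partial>ball_unif r)"
  proof (rule Q.Fubini_integral)
    interpret QQ: pair_prob_space "ball_unif r :: 'a measure" unit_line ..
    obtain M where M: "\<And>q. norm q \<le> norm x + r + norm z \<Longrightarrow> norm (g q) \<le> M" using g_bounded_ball by blast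
    show "integrable (ball_unif r \<Otimes>\<^sub>M unit_line) (\<lambda>(p, s). g (x + p + s *\<^sub>R z) \<bullet> z)"
    proof (rule QQ.P.integrable_const_bound)
      show "AE ps in ball_unif r \<Otimes>\<^sub>M unit_line. norm (case ps of (p, s) \<Rightarrow> g (x + p + s *\<^sub>R z) \<bullet> z) \<le> M * norm z"
      proof (rule Q.AE_pair_measure)
        show "AE p in ball_unif r. AE s in unit_line. norm (case (p, s) of (p, s) \<Rightarrow> g (x + p + s *\<^sub>R z) \<bullet> z) \<le> M * norm z"
          using AE_ball_unif_norm[of r]
        proof eventually_elim
          case (elim p)
          show ?case using AE_unit_line
          proof eventually_elim
            case (elim s)
            have "norm (g (x + p + s *\<^sub>R z)) \<le> M"
              by (rule M, rule order_trans[OF norm_line_le[OF elim]])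
                 (use norm_triangle_ineq[of x p] \<open>norm p < r\<close> in simp)
            then show ?case
              by (auto intro!: order_trans[OF Cauchy_Schwarz_ineq2] mult_right_mono)
          qed
        qed
      qed measurable
    qed measurable
  qed
  also have "\<dots> = (\<integral>p. G (x + p) z \<partial>ball_unif r)" by (simp only: G_unit_line)
  finally show ?thesis .
qed

definition rad :: "nat \<Rightarrow> real" where "rad j = inverse (real (Suc j))"

lemma rad: "rad j > 0" "rad \<longlonglongrightarrow> 0" "rad j \<le> 1"
  unfolding rad_def using LIMSEQ_inverse_real_of_nat by (auto simp: field_simps rad_def[abs_def])

text \<open>Where the potential is finite, the averaging condition provides the integrable majorant
  \<open>C k (x - y)\<close>; where it is infinite, Fatou's lemma forces the averages to diverge.\<close>

lemma avg_pot_tendsto: "(\<lambda>j. \<integral>\<^sup>+p. pot (x + p) \<partial>ball_unif (rad j)) \<longlonglongrightarrow> pot x"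
proof -
  define f where "f j y = (\<integral>\<^sup>+p. k (x - y + p) \<partial>ball_unif (rad j))" for j y
  have [measurable]: "f j \<in> borel_measurable borel" for j
  proof -
    interpret U: prob_space "ball_unif (rad j) :: 'a measure" by (rule prob_space_ball_unif[OF rad(1)])
    show ?thesis unfolding f_def[abs_def] by measurable
  qed
  have avg: "(\<integral>\<^sup>+p. pot (x + p) \<partial>ball_unif (rad j)) = (\<integral>\<^sup>+y. f j y \<partial>\<rho>)" for j
  proof -
    interpret U: prob_space "ball_unif (rad j) :: 'a measure" by (rule prob_space_ball_unif[OF rad(1)])
    interpret P: pair_sigma_finite \<rho> "ball_unif (rad j) :: 'a measure" ..
    have "(\<integral>\<^sup>+p. pot (x + p) \<partial>ball_unif (rad j)) = (\<integral>\<^sup>+p. (\<integral>\<^sup>+y. k (x - y + p) \<partial>\<rho>) \<partial>ball_unif (rad j))"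
      unfolding pot_def by (simp add: algebra_simps)
    also have "\<dots> = (\<integral>\<^sup>+y. f j y \<partial>\<rho>)" unfolding f_def by (rule P.Fubini') measurable
    finally show ?thesis .
  qed
  have lim: "(\<lambda>j. f j y) \<longlonglongrightarrow> k (x - y)" for y
    unfolding f_def
    by (rule ball_unif_tendsto) (use k_cont rad in \<open>auto simp: continuous_on_eq_continuous_at\<close>)
  show ?thesis
  proof (cases "pot x < \<infinity>")
    case True
    have "\<bar>norm x + B\<bar> + 1 > 0" by linarith
    from k_avg[OF this] obtain C where C: "\<And>q r. norm q \<le> \<bar>norm x + B\<bar> + 1 \<Longrightarrow> 0 < r \<Longrightarrow> r \<le> \<bar>norm x + B\<bar> + 1 \<Longrightarrow>
        (\<integral>\<^sup>+p. k (q + p) \<partial>ball_unif r) \<le> ennreal C * k q" by blast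
    have "(\<lambda>j. \<integral>\<^sup>+y. f j y \<partial>\<rho>) \<longlonglongrightarrow> (\<integral>\<^sup>+y. k (x - y) \<partial>\<rho>)"
    proof (rule nn_integral_dominated_convergence[where w = "\<lambda>y. ennreal C * k (x - y)"])
      show "AE y in \<rho>. f j y \<le> ennreal C * k (x - y)" for j
        using AE_norm_diff[of x]
      proof eventually_elim
        case (elim y)
        show ?case unfolding f_def
          by (rule C) (use elim rad(1,3)[of j] in auto)
      qed
      have "(\<integral>\<^sup>+y. ennreal C * k (x - y) \<partial>\<rho>) = ennreal C * pot x"
        unfolding pot_def by (rule nn_integral_cmult) measurable
      then show "(\<integral>\<^sup>+y. ennreal C * k (x - y) \<partial>\<rho>) < \<infinity>" using True by (simp add: ennreal_mult_less_top)
    qed (use lim in auto)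
    then show ?thesis unfolding avg pot_def[of x] .
  next
    case False
    then have inf: "pot x = \<infinity>" by (simp add: less_top[symmetric])
    have "pot x = (\<integral>\<^sup>+y. liminf (\<lambda>j. f j y) \<partial>\<rho>)"
      unfolding pot_def by (intro nn_integral_cong) (simp add: lim_imp_Liminf[OF _ lim])
    also have "\<dots> \<le> liminf (\<lambda>j. \<integral>\<^sup>+y. f j y \<partial>\<rho>)" by (rule nn_integral_liminf) measurable
    finally have "liminf (\<lambda>j. \<integral>\<^sup>+y. f j y \<partial>\<rho>) = \<infinity>" using inf by (simp add: top_unique)
    moreover from this have "limsup (\<lambda>j. \<integral>\<^sup>+y. f j y \<partial>\<rho>) = \<infinity>"
      using Liminf_le_Limsup[OF sequentially_bot, of "\<lambda>j. \<integral>\<^sup>+y. f j y \<partial>\<rho>"] by (simp add: top_unique)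
    ultimately show ?thesis unfolding avg inf
      by (simp add: tendsto_iff_Liminf_eq_Limsup)
  qed
qed

definition v :: "'a \<Rightarrow> real" where "v x = enn2real (pot x)"

text \<open>The averages of the potential are finite, so it is finite at some \<open>x0\<close>. By \<open>avg_pot_diff\<close> the averages
  at any other point converge to a finite limit, which excludes an infinite value there.\<close>

lemma pot_finite_and_diff: "pot x = ennreal (v x)" "v (x + z) - v x = G x z"
proof -
  interpret U: prob_space "ball_unif 1 :: 'a measure" by (rule prob_space_ball_unif) simp
  obtain x0 where x0: "pot x0 \<noteq> \<infinity>"
  proof (rule ccontr)
    assume "\<not> thesis"
    then have "pot y = \<infinity>" for y using that by blast
    then have "(\<integral>\<^sup>+p. pot (0 + p) \<partial>ball_unif 1) = \<infinity>"
      using U.emeasure_space_1 by simp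
    then show False using avg_pot_ennreal[of 1 0] by simp
  qed
  have lim: "(\<lambda>j. ennreal (avg_pot (rad j) y)) \<longlonglongrightarrow> pot y" for y
    using avg_pot_tendsto[of y] by (simp add: avg_pot_ennreal rad)
  have nn: "0 \<le> avg_pot r y" if "r > 0" for r y
    unfolding avg_pot_def using avg_w_bounds(1)[OF that order_refl] by simp
  have limr: "(\<lambda>j. avg_pot (rad j) y) \<longlonglongrightarrow> v y" if "pot y \<noteq> \<infinity>" for y
  proof -
    have "pot y = ennreal (v y)" using that by (simp add: v_def less_top)
    then have "(\<lambda>j. ennreal (avg_pot (rad j) y)) \<longlonglongrightarrow> ennreal (v y)" using lim[of y] by simp
    then show ?thesis using nn[OF rad(1)] by (simp add: tendsto_ennreal_iff v_def)
  qed
  have limG: "(\<lambda>j. \<integral>p. G (y + p) z \<partial>ball_unif (rad j)) \<longlonglongrightarrow> G y z" for y z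
    by (rule ball_unif_tendsto_real[OF G_cont rad(1,2)])
  have fin: "pot y \<noteq> \<infinity>" for y
  proof -
    have "(\<lambda>j. avg_pot (rad j) x0 + (\<integral>p. G (x0 + p) (y - x0) \<partial>ball_unif (rad j))) \<longlonglongrightarrow> v x0 + G x0 (y - x0)"
      by (intro tendsto_add limr limG x0)
    moreover have "avg_pot (rad j) x0 + (\<integral>p. G (x0 + p) (y - x0) \<partial>ball_unif (rad j)) = avg_pot (rad j) y" for j
      using avg_pot_diff[OF rad(1), of j x0 "y - x0"] by simp
    ultimately have "(\<lambda>j. avg_pot (rad j) y) \<longlonglongrightarrow> v x0 + G x0 (y - x0)" by simp
    then have "(\<lambda>j. ennreal (avg_pot (rad j) y)) \<longlonglongrightarrow> ennreal (v x0 + G x0 (y - x0))"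
      by (rule tendsto_ennrealI)
    from LIMSEQ_unique[OF lim this] show ?thesis by simp
  qed
  then show "pot x = ennreal (v x)" by (simp add: v_def less_top)
  have "(\<lambda>j. avg_pot (rad j) (x + z) - avg_pot (rad j) x) \<longlonglongrightarrow> v (x + z) - v x"
    by (intro tendsto_diff limr fin)
  then have "(\<lambda>j. \<integral>p. G (x + p) z \<partial>ball_unif (rad j)) \<longlonglongrightarrow> v (x + z) - v x"
    by (simp add: avg_pot_diff rad)
  from LIMSEQ_unique[OF this limG] show "v (x + z) - v x = G x z" .
qed

lemma v_has_derivative: "(v has_derivative (\<lambda>z. g x \<bullet> z)) (at x)"
  by (rule has_derivative_of_line_integral[OF g_cont]) (simp add: pot_finite_and_diff(2) G_def)

lemma v_cont: "continuous_on UNIV v"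
  using v_has_derivative by (intro differentiable_imp_continuous_on)
    (auto simp: differentiable_on_def differentiable_def)

lemma v_nonneg: "0 \<le> v x" by (simp add: v_def)

end

section \<open>Mixtures, supports and transport maps\<close>

lemma sets_mix_measure[simp, measurable_cong]: "sets (mix_measure t \<mu> \<nu>) = sets borel"
proof -
  have "sets (borel :: 'a measure) = sigma_sets UNIV (sets borel)"
    using sets.sigma_sets_eq[of "borel :: 'a measure"] by simp
  then show ?thesis unfolding mix_measure_def by (subst sets_measure_of) auto
qed

lemma space_mix_measure[simp]: "space (mix_measure t \<mu> \<nu>) = UNIV"
  unfolding mix_measure_def by (subst space_measure_of) auto

lemma nn_integral_mix_measure:
  fixes \<mu> \<nu> :: "'a::euclidean_space measure"
  assumes s: "sets \<mu> = sets borel" "sets \<nu> = sets borel"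
    and f: "f \<in> borel_measurable borel"
  shows "(\<integral>\<^sup>+x. f x \<partial>mix_measure t \<mu> \<nu>) = ennreal (1 - t) * (\<integral>\<^sup>+x. f x \<partial>\<mu>) + ennreal t * (\<integral>\<^sup>+x. f x \<partial>\<nu>)"
  using f
proof (induction rule: borel_measurable_induct)
  case (cong f g)
  then have "f = g" by auto
  then show ?case using cong by simp
next
  case (set A)
  then show ?case using s by (simp add: emeasure_mix_measure)
next
  case (mult u c)
  have [measurable]: "u \<in> borel_measurable \<mu>" "u \<in> borel_measurable \<nu>" "u \<in> borel_measurable (mix_measure t \<mu> \<nu>)"
    using mult.hyps s by (auto simp: measurable_cong_sets[OF s(1) refl] measurable_cong_sets[OF s(2) refl]
        measurable_cong_sets[OF sets_mix_measure refl])
  show ?case using mult.IH by (simp add: nn_integral_cmult algebra_simps)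
next
  case (add u w)
  have [measurable]: "u \<in> borel_measurable \<mu>" "u \<in> borel_measurable \<nu>" "u \<in> borel_measurable (mix_measure t \<mu> \<nu>)"
      "w \<in> borel_measurable \<mu>" "w \<in> borel_measurable \<nu>" "w \<in> borel_measurable (mix_measure t \<mu> \<nu>)"
    using add.hyps s by (auto simp: measurable_cong_sets[OF s(1) refl] measurable_cong_sets[OF s(2) refl]
        measurable_cong_sets[OF sets_mix_measure refl])
  show ?case using add.IH by (simp add: nn_integral_add algebra_simps)
next
  case (seq U)
  have m: "U i \<in> borel_measurable \<mu>" "U i \<in> borel_measurable \<nu>" "U i \<in> borel_measurable (mix_measure t \<mu> \<nu>)" for i
    using seq.hyps s by (auto simp: measurable_cong_sets[OF s(1) refl] measurable_cong_sets[OF s(2) refl]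
        measurable_cong_sets[OF sets_mix_measure refl])
  have inc: "incseq (\<lambda>i. integral\<^sup>N M (U i))" for M
    using seq.hyps by (auto simp: incseq_def le_fun_def intro!: nn_integral_mono)
  have e: "(\<integral>\<^sup>+x. (SUP i. U i) x \<partial>M) = (SUP i. integral\<^sup>N M (U i))" if "\<And>i. U i \<in> borel_measurable M" for M
    unfolding SUP_apply by (rule nn_integral_monotone_convergence_SUP[OF seq.hyps(3) that])
  have "(\<integral>\<^sup>+x. (SUP i. U i) x \<partial>mix_measure t \<mu> \<nu>)
      = (SUP i. ennreal (1 - t) * integral\<^sup>N \<mu> (U i) + ennreal t * integral\<^sup>N \<nu> (U i))"
    unfolding e[OF m(3)] using seq.IH by simp
  also have "\<dots> = (SUP i. ennreal (1 - t) * integral\<^sup>N \<mu> (U i)) + (SUP i. ennreal t * integral\<^sup>N \<nu> (U i))"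
    by (rule ennreal_SUP_add) (use inc in \<open>auto simp: incseq_def intro!: mult_left_mono\<close>)
  also have "\<dots> = ennreal (1 - t) * (SUP i. integral\<^sup>N \<mu> (U i)) + ennreal t * (SUP i. integral\<^sup>N \<nu> (U i))"
    by (simp add: SUP_mult_left_ennreal)
  finally show ?case unfolding e[OF m(1)] e[OF m(2)] .
qed

lemma ennreal_convex_combination_self:
  assumes "0 \<le> t" "t \<le> 1" shows "ennreal (1 - t) * m + ennreal t * m = m"
proof -
  have "ennreal (1 - t) * m + ennreal t * m = (ennreal (1 - t) + ennreal t) * m"
    by (simp add: distrib_right)
  also have "ennreal (1 - t) + ennreal t = 1" using assms by (simp flip: ennreal_plus)
  finally show ?thesis by simp
qed

lemma borel_probD: 
  assumes "\<mu> \<in> borel_prob"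
  shows "prob_space \<mu>" "sets \<mu> = sets borel" "space \<mu> = UNIV" "emeasure \<mu> UNIV = 1"
proof -
  show *: "prob_space \<mu>" "sets \<mu> = sets borel" using assms unfolding borel_prob_def by auto
  then show "space \<mu> = UNIV" using sets_eq_imp_space_eq[of \<mu> borel] by simp
  then show "emeasure \<mu> UNIV = 1" using prob_space.emeasure_space_1[OF *(1)] by simp
qed

lemma mix_measure_prob:
  assumes "\<mu> \<in> borel_prob" "\<nu> \<in> borel_prob" "0 \<le> t" "t \<le> 1"
  shows "mix_measure t \<mu> \<nu> \<in> borel_prob"
proof -
  have "emeasure (mix_measure t \<mu> \<nu>) UNIV = 1"
    using ennreal_convex_combination_self[OF assms(3,4), of 1]
    by (subst emeasure_mix_measure) (use borel_probD[OF assms(1)] borel_probD[OF assms(2)] in auto)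
  then show ?thesis unfolding borel_prob_def by (auto intro!: prob_spaceI)
qed

lemma distr_prob:
  assumes "\<mu> \<in> borel_prob" "T \<in> borel_measurable borel"
  shows "distr \<mu> borel T \<in> borel_prob"
proof -
  have "T \<in> measurable \<mu> borel"
    using assms(2) borel_probD(2)[OF assms(1)] by (simp cong: measurable_cong_sets)
  then show ?thesis unfolding borel_prob_def
    using prob_space.prob_space_distr[OF borel_probD(1)[OF assms(1)]] by auto
qed

lemma distr_mix_measure:
  fixes \<mu> \<nu> :: "'a::euclidean_space measure" and f :: "'a \<Rightarrow> 'b::euclidean_space"
  assumes "sets \<mu> = sets borel" "sets \<nu> = sets borel" "f \<in> borel_measurable borel"
  shows "distr (mix_measure t \<mu> \<nu>) borel f = mix_measure t (distr \<mu> borel f) (distr \<nu> borel f)"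
proof (rule measure_eqI)
  fix A :: "'b set" assume "A \<in> sets (distr (mix_measure t \<mu> \<nu>) borel f)"
  then have A: "A \<in> sets borel" by simp
  have s: "space \<mu> = UNIV" "space \<nu> = UNIV"
    using assms sets_eq_imp_space_eq[of \<mu> borel] sets_eq_imp_space_eq[of \<nu> borel] by auto
  have m: "f \<in> measurable \<mu> borel" "f \<in> measurable \<nu> borel" "f \<in> measurable (mix_measure t \<mu> \<nu>) borel"
    using assms by (auto simp: measurable_cong_sets[OF assms(1) refl] measurable_cong_sets[OF assms(2) refl]
      measurable_cong_sets[OF sets_mix_measure refl])
  have fA: "f -` A \<in> sets borel" using measurable_sets[OF assms(3) A] by simp
  show "emeasure (distr (mix_measure t \<mu> \<nu>) borel f) A = emeasure (mix_measure t (distr \<mu> borel f) (distr \<nu> borel f)) A"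
    using A fA s m assms by (simp add: emeasure_distr emeasure_mix_measure)
qed simp

lemma mix_measure_self:
  fixes \<mu> :: "'a::euclidean_space measure"
  assumes "sets \<mu> = sets borel" "0 \<le> t" "t \<le> 1"
  shows "mix_measure t \<mu> \<mu> = \<mu>"
  by (rule measure_eqI)
     (use assms in \<open>auto simp: emeasure_mix_measure ennreal_convex_combination_self\<close>)

lemma measure_supp_closed: "closed (measure_supp \<mu>)"
proof -
  have "- measure_supp \<mu> = \<Union>{U. open U \<and> emeasure \<mu> U = 0}"
    unfolding measure_supp_def by (auto simp: not_gr_zero)
  then show ?thesis unfolding closed_def by auto
qed

lemma measure_supp_subset:
  assumes "closed C" "emeasure \<mu> (- C) = 0"
  shows "measure_supp \<mu> \<subseteq> C"
  using assms unfolding measure_supp_def by (auto simp: open_Compl)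

text \<open>The complement of the support is a union of null sets, and second countability makes it a countable union.\<close>

lemma AE_measure_supp:
  fixes \<mu> :: "'a::euclidean_space measure"
  assumes "sets \<mu> = sets borel"
  shows "AE x in \<mu>. x \<in> measure_supp \<mu>"
proof -
  obtain \<B> :: "'a set set" where B: "countable \<B>" "\<And>U. open U \<Longrightarrow> \<exists>C\<subseteq>\<B>. U = \<Union>C" "\<And>U. U \<in> \<B> \<Longrightarrow> open U"
    using univ_second_countable by (metis (no_types, lifting))
  define N where "N = {U \<in> \<B>. emeasure \<mu> U = 0}"
  have "- measure_supp \<mu> \<subseteq> \<Union>N"
  proof
    fix x assume "x \<in> - measure_supp \<mu>"
    then obtain U where U: "open U" "x \<in> U" "emeasure \<mu> U = 0"
      unfolding measure_supp_def by (auto simp: not_gr_zero)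
    obtain C where C: "C \<subseteq> \<B>" "U = \<Union>C" using B(2)[OF U(1)] by blast
    then obtain V where V: "V \<in> C" "x \<in> V" using U(2) by blast
    have "emeasure \<mu> V \<le> emeasure \<mu> U"
      using C V U(1) assms by (intro emeasure_mono) auto
    then have "V \<in> N" using U(3) V C unfolding N_def by auto
    then show "x \<in> \<Union>N" using V by blast
  qed
  moreover have "(\<Union>U\<in>N. U) \<in> null_sets \<mu>"
  proof (rule null_sets_UN')
    show "countable N" unfolding N_def using B(1) by (rule countable_subset[rotated]) auto
    show "U \<in> null_sets \<mu>" if "U \<in> N" for U
      using that B(3)[of U] assms by (auto simp: N_def null_sets_def)
  qed
  ultimately show ?thesis by (intro AE_I'[of "\<Union>N"]) auto
qed

lemma AE_compactly_supported:
  fixes \<mu> :: "'a::euclidean_space measure"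
  assumes "sets \<mu> = sets borel" "compactly_supported \<mu>"
  obtains B where "B \<ge> 0" "AE x in \<mu>. norm x \<le> B"
proof -
  have "bounded (measure_supp \<mu>)" using assms(2) unfolding compactly_supported_def by (rule compact_imp_bounded)
  then obtain B where B: "\<And>x. x \<in> measure_supp \<mu> \<Longrightarrow> norm x \<le> B" unfolding bounded_iff by blast
  have "AE x in \<mu>. norm x \<le> \<bar>B\<bar>"
    using AE_measure_supp[OF assms(1)] by eventually_elim (use B in fastforce)
  then show ?thesis using that[of "\<bar>B\<bar>"] by simp
qed

lemma compactly_supported_of_AE:
  fixes \<mu> :: "'a::euclidean_space measure"
  assumes "sets \<mu> = sets borel" "AE x in \<mu>. norm x \<le> B"
  shows "compactly_supported \<mu>" "measure_supp \<mu> \<subseteq> cball 0 B"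
proof -
  have "space \<mu> = UNIV" using sets_eq_imp_space_eq[OF assms(1)] by simp
  moreover have "- cball 0 B \<in> sets \<mu>" using assms(1) by auto
  moreover have "{x. \<not> norm x \<le> B} = - cball 0 B" by auto
  ultimately have "emeasure \<mu> (- cball 0 B) = 0"
    using AE_iff_measurable[of "- cball 0 B" \<mu> "\<lambda>x. norm x \<le> B"] assms(2) by simp
  then show *: "measure_supp \<mu> \<subseteq> cball 0 B" by (intro measure_supp_subset) auto
  show "compactly_supported \<mu>" unfolding compactly_supported_def
    using bounded_subset[OF bounded_cball *] measure_supp_closed by (simp add: compact_eq_bounded_closed)
qed

lemma AE_mix_measure:
  fixes \<mu> \<nu> :: "'a::euclidean_space measure"
  assumes s: "sets \<mu> = sets borel" "sets \<nu> = sets borel"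
    and P: "{x. P x} \<in> sets borel" and "AE x in \<mu>. P x" "AE x in \<nu>. P x"
  shows "AE x in mix_measure t \<mu> \<nu>. P x"
proof -
  have sp: "space \<mu> = UNIV" "space \<nu> = UNIV"
    using s sets_eq_imp_space_eq[of \<mu> borel] sets_eq_imp_space_eq[of \<nu> borel] by auto
  have m: "{x. \<not> P x} \<in> sets borel" using borel_comp[OF P] by (simp add: Collect_neg_eq)
  have "emeasure \<mu> {x. \<not> P x} = 0" using assms(4) AE_iff_measurable[of "{x. \<not> P x}" \<mu> P] m s sp by auto
  moreover have "emeasure \<nu> {x. \<not> P x} = 0" using assms(5) AE_iff_measurable[of "{x. \<not> P x}" \<nu> P] m s sp by auto
  ultimately have "emeasure (mix_measure t \<mu> \<nu>) {x. \<not> P x} = 0"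
    using emeasure_mix_measure[OF s m] by simp
  then show ?thesis using AE_iff_measurable[of "{x. \<not> P x}" "mix_measure t \<mu> \<nu>" P] m by auto
qed

text \<open>A plan for the mixture: leave the fraction \<open>1 - t\<close> of the mass in place and transport the
  rest along the map. It is concentrated on pairs of distance at most \<open>\<delta>\<close>, a closed set,
  which therefore contains its support.\<close>

lemma d_infty_mix_transport:
  fixes \<rho> :: "'a::euclidean_space measure"
  assumes \<rho>: "\<rho> \<in> borel_prob" and T: "T \<in> borel_measurable borel"
    and near: "AE x in \<rho>. norm (x - T x) \<le> \<delta>" and t: "0 \<le> t" "t \<le> 1" and \<delta>: "\<delta> \<ge> 0"
  shows "d_infty \<rho> (mix_measure t \<rho> (distr \<rho> borel T)) \<le> ennreal \<delta>"
proof -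
  note r = borel_probD[OF \<rho>]
  define \<pi>0 \<pi>1 where "\<pi>0 = distr \<rho> borel (\<lambda>x. (x, x))" and "\<pi>1 = distr \<rho> borel (\<lambda>x. (x, T x))"
  define \<pi> where "\<pi> = mix_measure t \<pi>0 \<pi>1"
  have m0: "(\<lambda>x. (x, x)) \<in> borel_measurable (borel :: 'a measure)" by measurable
  have m1: "(\<lambda>x. (x, T x)) \<in> borel_measurable borel" using T by measurable
  have mf: "fst \<in> borel_measurable (borel :: ('a \<times> 'a) measure)" "snd \<in> borel_measurable (borel :: ('a \<times> 'a) measure)"
    by (intro borel_measurable_continuous_onI continuous_intros)+
  have mr: "f \<in> measurable \<rho> borel" if "f \<in> borel_measurable borel" for f :: "'a \<Rightarrow> 'b::topological_space"
    using that r(2) by (simp cong: measurable_cong_sets)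
  have pp: "\<pi>0 \<in> borel_prob" "\<pi>1 \<in> borel_prob"
    unfolding \<pi>0_def \<pi>1_def using \<rho> m0 m1 by (auto intro: distr_prob)
  have id: "distr \<rho> borel (\<lambda>x. x) = \<rho>" using r(2) by (intro distr_id2) simp
  have "distr \<pi> borel fst = mix_measure t (distr \<pi>0 borel fst) (distr \<pi>1 borel fst)"
    unfolding \<pi>_def by (rule distr_mix_measure[OF _ _ mf(1)]) (simp_all add: \<pi>0_def \<pi>1_def)
  also have "\<dots> = mix_measure t \<rho> \<rho>"
    unfolding \<pi>0_def \<pi>1_def using mr[OF m0] mr[OF m1] mf by (simp add: distr_distr comp_def id)
  finally have 1: "distr \<pi> borel fst = \<rho>" using r t by (simp add: mix_measure_self)
  have "distr \<pi> borel snd = mix_measure t (distr \<pi>0 borel snd) (distr \<pi>1 borel snd)"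
    unfolding \<pi>_def by (rule distr_mix_measure[OF _ _ mf(2)]) (simp_all add: \<pi>0_def \<pi>1_def)
  also have "\<dots> = mix_measure t \<rho> (distr \<rho> borel T)"
    unfolding \<pi>0_def \<pi>1_def using mr[OF m0] mr[OF m1] mf by (simp add: distr_distr comp_def id)
  finally have 2: "distr \<pi> borel snd = mix_measure t \<rho> (distr \<rho> borel T)" .
  have "\<pi> \<in> borel_prob" unfolding \<pi>_def using pp t by (rule mix_measure_prob)
  then have c: "\<pi> \<in> couplings \<rho> (mix_measure t \<rho> (distr \<rho> borel T))"
    unfolding couplings_def using 1 2 by simp
  define C where "C = {p :: 'a \<times> 'a. norm (fst p - snd p) \<le> \<delta>}"
  have C: "closed C" unfolding C_def by (intro closed_Collect_le continuous_intros)
  then have Cb: "{p. p \<in> C} \<in> sets borel" by simp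
  have "AE p in \<pi>. p \<in> C" unfolding \<pi>_def
  proof (rule AE_mix_measure[OF _ _ Cb])
    show "AE p in \<pi>0. p \<in> C" unfolding \<pi>0_def
      by (subst AE_distr_iff[OF mr[OF m0]]) (use Cb \<delta> in \<open>auto simp: C_def\<close>)
    show "AE p in \<pi>1. p \<in> C" unfolding \<pi>1_def
      by (subst AE_distr_iff[OF mr[OF m1]]) (use Cb near in \<open>auto simp: C_def\<close>)
  qed (simp_all add: \<pi>0_def \<pi>1_def)
  then have "emeasure \<pi> (- C) = 0"
    using AE_iff_measurable[of "- C" \<pi> "\<lambda>p. p \<in> C"] Cb C by (auto simp: \<pi>_def)
  then have "measure_supp \<pi> \<subseteq> C" using C by (rule measure_supp_subset[rotated])
  then have "(SUP (x, y)\<in>measure_supp \<pi>. ennreal (norm (x - y))) \<le> ennreal \<delta>"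
    by (intro SUP_least) (auto simp: C_def intro!: ennreal_leI)
  then show ?thesis unfolding d_infty_def by (rule INF_lower2[OF c])
qed

section \<open>Small rotations\<close>

definition reflect :: "'a::euclidean_space \<Rightarrow> 'a \<Rightarrow> 'a" where
  "reflect a x = x - (2 * (x \<bullet> a)) *\<^sub>R a"

lemma linear_reflect: "linear (reflect a)"
  by (rule linearI) (auto simp: reflect_def algebra_simps inner_add_left)

lemma norm_reflect: assumes "norm a = 1" shows "norm (reflect a x) = norm x"
proof -
  have "a \<bullet> a = 1" using assms by (simp add: norm_eq_1)
  then have "reflect a x \<bullet> reflect a x = x \<bullet> x"
    unfolding reflect_def by (simp add: inner_diff_left inner_diff_right algebra_simps inner_commute)
  then show ?thesis by (simp add: norm_eq_sqrt_inner)
qed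

lemma reflect_reflect: assumes "norm a = 1" shows "reflect a (reflect a x) = x"
proof -
  have "a \<bullet> a = 1" using assms by (simp add: norm_eq_1)
  then show ?thesis unfolding reflect_def by (simp add: inner_diff_left algebra_simps)
qed

lemma norm_reflect_diff:
  assumes "norm a = 1" "norm b = 1"
  shows "norm (reflect a x - reflect b x) \<le> 4 * norm (a - b) * norm x"
proof -
  have "reflect a x - reflect b x = (2 * (x \<bullet> (b - a))) *\<^sub>R b + (2 * (x \<bullet> a)) *\<^sub>R (b - a)"
    unfolding reflect_def by (simp add: algebra_simps inner_diff_right)
  also have "norm \<dots> \<le> 2 * \<bar>x \<bullet> (b - a)\<bar> * norm b + 2 * \<bar>x \<bullet> a\<bar> * norm (b - a)"
    by (rule order_trans[OF norm_triangle_ineq]) (simp add: abs_mult)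
  also have "\<dots> \<le> 2 * (norm x * norm (b - a)) * norm b + 2 * (norm x * norm a) * norm (b - a)"
    by (intro add_mono mult_right_mono mult_left_mono Cauchy_Schwarz_ineq2) auto
  finally show ?thesis using assms by (simp add: norm_minus_commute mult_ac)
qed

text \<open>The composition of the reflections in two almost parallel mirrors is almost the identity. The first
  mirror contains \<open>x\<close>; the second one is the perpendicular bisector of \<open>x\<close> and \<open>y\<close>.\<close>

lemma small_rotation_exists:
  fixes x y :: "'a::euclidean_space"
  assumes xy: "norm x = norm y" "norm (x - y) < norm x"
  obtains T where "linear T" "\<And>q. norm (T q) = norm q" "T x = y"
    "\<And>q. norm (q - T q) \<le> 4 * (norm (x - y) / norm x) * norm q"
proof (cases "x = y")
  case True
  show ?thesis by (rule that[of "\<lambda>x. x"]) (use True in \<open>auto simp: linear_id[unfolded id_def]\<close>)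
next
  case False
  define r where "r = norm x"
  define l where "l = norm (x - y)"
  have r: "r > 0" using xy by (auto simp: r_def intro: le_less_trans[OF norm_ge_zero])
  have l: "l > 0" "l < r" using False xy by (auto simp: l_def r_def)
  have xx: "x \<bullet> x = r\<^sup>2" "y \<bullet> y = r\<^sup>2" using xy(1) by (simp_all add: power2_norm_eq_inner[symmetric] r_def)
  have ll: "l\<^sup>2 = 2 * r\<^sup>2 - 2 * (x \<bullet> y)" unfolding l_def power2_norm_eq_inner
    using xx by (simp add: inner_diff_left inner_diff_right inner_commute)
  define a where "a = (x - y) /\<^sub>R l"
  have na: "norm a = 1" unfolding a_def using l by (simp add: l_def)
  have xa: "x \<bullet> a = l / 2" 
  proof -
    have "x \<bullet> a = (r\<^sup>2 - x \<bullet> y) / l" unfolding a_def using xx by (simp add: inner_diff_right divide_inverse)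
    also have "r\<^sup>2 - x \<bullet> y = l\<^sup>2 / 2" using ll by simp
    finally show ?thesis using l by (simp add: power2_eq_square)
  qed
  \<comment> \<open>the unit normal \<open>a\<close> of the bisector is nearly orthogonal to \<open>x\<close>; project it onto the orthogonal complement\<close>
  define a' where "a' = a - (l / (2 * r\<^sup>2)) *\<^sub>R x"
  have aa': "norm (a - a') = l / (2 * r)"
    unfolding a'_def using r l by (simp add: r_def[symmetric] power2_eq_square)
  have xa': "x \<bullet> a' = 0" unfolding a'_def using xa xx r by (simp add: inner_diff_right)
  have "norm (a - a') < 1" unfolding aa' using l r by (simp add: field_simps)
  then have na': "norm a' > 0" using na by auto
  define b where "b = a' /\<^sub>R norm a'"
  have nb: "norm b = 1" unfolding b_def using na' by simp
  have "norm (a' - b) = \<bar>norm a' - 1\<bar>"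
  proof -
    have "a' - b = (norm a' - 1) *\<^sub>R b" unfolding b_def using na' by (simp add: algebra_simps)
    then show ?thesis using nb by simp
  qed
  also have "\<dots> \<le> norm (a - a')" using na norm_triangle_ineq3[of a' a] by (simp add: norm_minus_commute)
  finally have "norm (a - b) \<le> norm (a - a') + norm (a - a')"
    using norm_triangle_ineq[of "a - a'" "a' - b"] by simp
  also have "\<dots> = l / r" unfolding aa' by simp
  finally have ab: "norm (a - b) \<le> l / r" .
  show ?thesis
  proof (rule that[of "\<lambda>q. reflect a (reflect b q)"])
    show "linear (\<lambda>q. reflect a (reflect b q))"
      using linear_compose[OF linear_reflect linear_reflect, of a b] by (simp add: comp_def)
    show "norm (reflect a (reflect b q)) = norm q" for q by (simp add: norm_reflect na nb)
    have "reflect b x = x" unfolding reflect_def b_def using xa' by simp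
    moreover have "reflect a x = y" unfolding reflect_def xa unfolding a_def using l by simp
    ultimately show "reflect a (reflect b x) = y" by simp
    fix q
    have "q - reflect a (reflect b q) = reflect a (reflect a q - reflect b q)"
      using linear_diff[OF linear_reflect, of a "reflect a q" "reflect b q"] by (simp add: reflect_reflect na)
    then have "norm (q - reflect a (reflect b q)) = norm (reflect a q - reflect b q)" by (simp add: norm_reflect na)
    also have "\<dots> \<le> 4 * norm (a - b) * norm q" by (rule norm_reflect_diff[OF na nb])
    also have "\<dots> \<le> 4 * (l / r) * norm q" by (intro mult_right_mono mult_left_mono ab) auto
    finally show "norm (q - reflect a (reflect b q)) \<le> 4 * (norm (x - y) / norm x) * norm q"
      by (simp add: l_def r_def)
  qed
qed

section \<open>First variation of the energy\<close>

text \<open>The bilinear form of which the energy is half the diagonal.\<close>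

definition mutual :: "('a::euclidean_space \<Rightarrow> ennreal) \<Rightarrow> 'a measure \<Rightarrow> 'a measure \<Rightarrow> ennreal" where
  "mutual k \<mu> \<nu> = (\<integral>\<^sup>+x. (\<integral>\<^sup>+y. k (x - y) \<partial>\<nu>) \<partial>\<mu>)"

context kernel begin

lemma k_diff_sym: "k (x - y) = k (y - x)" using k_sym[of "x - y"] by simp

lemma mutual_sym:
  assumes "\<mu> \<in> borel_prob" "\<nu> \<in> borel_prob"
  shows "mutual k \<mu> \<nu> = mutual k \<nu> \<mu>"
proof -
  note m = borel_probD[OF assms(1)] and n = borel_probD[OF assms(2)]
  interpret M: prob_space \<mu> by (rule m)
  interpret N: prob_space \<nu> by (rule n)
  interpret P: pair_sigma_finite \<mu> \<nu> ..
  note [measurable_cong] = m(2) n(2)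
  have "mutual k \<mu> \<nu> = (\<integral>\<^sup>+y. (\<integral>\<^sup>+x. k (x - y) \<partial>\<mu>) \<partial>\<nu>)"
    unfolding mutual_def by (rule P.Fubini'[symmetric]) measurable
  then show ?thesis unfolding mutual_def by (simp add: k_diff_sym[of _ y for y] k_diff_sym)
qed

lemma mutual_mix:
  assumes "\<mu> \<in> borel_prob" "\<nu> \<in> borel_prob"
  defines "m t \<equiv> mix_measure t \<mu> \<nu>"
  shows "mutual k (m t) (m t) = ennreal (1 - t) * (ennreal (1 - t) * mutual k \<mu> \<mu> + ennreal t * mutual k \<mu> \<nu>)
     + ennreal t * (ennreal (1 - t) * mutual k \<mu> \<nu> + ennreal t * mutual k \<nu> \<nu>)"
proof -
  note m = borel_probD[OF assms(1)] and n = borel_probD[OF assms(2)]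
  interpret M: prob_space \<mu> by (rule m)
  interpret N: prob_space \<nu> by (rule n)
  note [measurable_cong] = m(2) n(2)
  have [measurable]: "(\<lambda>x. \<integral>\<^sup>+y. k (x - y) \<partial>\<mu>) \<in> borel_measurable borel"
    "(\<lambda>x. \<integral>\<^sup>+y. k (x - y) \<partial>\<nu>) \<in> borel_measurable borel" by measurable
  have e: "(\<integral>\<^sup>+x. ennreal (1 - t) * (\<integral>\<^sup>+y. k (x - y) \<partial>\<mu>) + ennreal t * (\<integral>\<^sup>+y. k (x - y) \<partial>\<nu>) \<partial>\<sigma>)
     = ennreal (1 - t) * mutual k \<sigma> \<mu> + ennreal t * mutual k \<sigma> \<nu>" if "sets \<sigma> = sets borel" for \<sigma>
  proof -
    note [measurable_cong] = that
    show ?thesis unfolding mutual_def by (simp add: nn_integral_add nn_integral_cmult)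
  qed
  have "mutual k (m t) (m t) = (\<integral>\<^sup>+x. ennreal (1 - t) * (\<integral>\<^sup>+y. k (x - y) \<partial>\<mu>) + ennreal t * (\<integral>\<^sup>+y. k (x - y) \<partial>\<nu>) \<partial>m t)"
    unfolding mutual_def m_def by (intro nn_integral_cong nn_integral_mix_measure m n) measurable
  also have "\<dots> = ennreal (1 - t) * (ennreal (1 - t) * mutual k \<mu> \<mu> + ennreal t * mutual k \<mu> \<nu>)
     + ennreal t * (ennreal (1 - t) * mutual k \<nu> \<mu> + ennreal t * mutual k \<nu> \<nu>)"
    unfolding m_def
    by (subst nn_integral_mix_measure[OF m(2) n(2)]) (simp_all add: e[OF m(2)] e[OF n(2)])
  finally show ?thesis by (simp add: mutual_sym[OF assms(1,2)])
qed

text \<open>The difference of the two energies is a quadratic polynomial in \<open>t\<close> that vanishes at \<open>0\<close> and is nonnegative on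
  \<open>(0, 1)\<close>; its linear coefficient is twice the difference of the two sides.\<close>

lemma first_variation:
  assumes "\<mu> \<in> borel_prob" "\<nu> \<in> borel_prob"
    and fin: "mutual k \<mu> \<mu> < \<infinity>" "mutual k \<nu> \<nu> < \<infinity>"
    and le: "\<And>t. 0 < t \<Longrightarrow> t < 1 \<Longrightarrow> mutual k \<mu> \<mu> \<le> mutual k (mix_measure t \<mu> \<nu>) (mix_measure t \<mu> \<nu>)"
  shows "mutual k \<mu> \<mu> \<le> mutual k \<mu> \<nu>"
proof (cases "mutual k \<mu> \<nu> < \<infinity>")
  case True
  obtain a b c where a: "mutual k \<mu> \<mu> = ennreal a" "a \<ge> 0" and b: "mutual k \<nu> \<nu> = ennreal b" "b \<ge> 0"
    and c: "mutual k \<mu> \<nu> = ennreal c" "c \<ge> 0"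
    using fin True by (metis ennreal_cases infinity_ennreal_def less_irrefl)
  have "a \<le> c"
  proof (rule ccontr)
    assume "\<not> a \<le> c"
    then have ac: "a - c > 0" by simp
    \<comment> \<open>small enough for the quadratic term \<open>t * (a + b)\<close> not to compensate the linear gain \<open>a - c\<close>\<close>
    define t where "t = min (1 / 2) ((a - c) / (a + b + 1))"
    have t: "0 < t" "t < 1" unfolding t_def using ac a b by auto
    have "t * (a + b + 1) \<le> a - c"
    proof -
      have "t * (a + b + 1) \<le> ((a - c) / (a + b + 1)) * (a + b + 1)"
        using a b by (intro mult_right_mono) (auto simp: t_def)
      then show ?thesis using a b by simp
    qed
    then have tt: "t * (a + b) < a - c" using t by (simp add: algebra_simps)
    have "ennreal a \<le> ennreal ((1 - t) * ((1 - t) * a + t * c) + t * ((1 - t) * c + t * b))"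
      using le[OF t] unfolding mutual_mix[OF assms(1,2)] a b c
      using t a b c by (simp add: ennreal_mult[symmetric] ennreal_plus[symmetric] del: ennreal_plus)
    then have "a \<le> (1 - t) * ((1 - t) * a + t * c) + t * ((1 - t) * c + t * b)"
      using t a b c by (subst (asm) ennreal_le_iff) auto
    then have "0 \<le> t * (2 * c - 2 * a + t * (a + b - 2 * c))" by (simp add: algebra_simps)
    then have "0 \<le> 2 * c - 2 * a + t * (a + b - 2 * c)" using t by (simp add: zero_le_mult_iff)
    moreover have "t * (a + b - 2 * c) \<le> t * (a + b)" using t c by (intro mult_left_mono) auto
    ultimately show False using tt ac by linarith
  qed
  then show ?thesis unfolding a c by (rule ennreal_leI)
qed (simp add: less_top[symmetric])

end

section \<open>Local minimizers: Euler--Lagrange inequality and rotational symmetry\<close>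

locale minimizer = kernel_density k w \<rho> B g
  for k :: "'a::euclidean_space \<Rightarrow> ennreal" and w \<rho> B g +
  fixes W :: "'a \<Rightarrow> ereal" and \<epsilon> :: real
  assumes k_W: "k x = e2ennreal (W x)"
    and k_rad: "norm x = norm y \<Longrightarrow> k x = k y"
    and B_nonneg: "0 \<le> B"
    and lic: "LIC W"
    and com: "center_of_mass \<rho> = 0"
    and \<epsilon>: "\<epsilon> > 0"
    and locmin: "\<nu> \<in> borel_prob \<Longrightarrow> compactly_supported \<nu> \<Longrightarrow> d_infty \<rho> \<nu> < ennreal \<epsilon> \<Longrightarrow>
        energy W \<rho> \<le> energy W \<nu>"
begin

lemma energy_mutual: "energy W \<mu> = mutual k \<mu> \<mu> / 2"
  unfolding energy_def mutual_def by (simp add: k_W)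

lemma half_le_iff: "(a::ennreal) / 2 \<le> b / 2 \<longleftrightarrow> a \<le> b"
proof
  assume "a / 2 \<le> b / 2"
  then have "2 * (a / 2) \<le> 2 * (b / 2)" by (rule mult_left_mono) simp
  then show "a \<le> b" by (simp add: ennreal_times_divide ennreal_mult_divide_eq mult.commute)
qed (rule divide_right_mono_ennreal)

lemma \<rho>_prob: "\<rho> \<in> borel_prob"
  unfolding borel_prob_def using prob by simp

lemma integrable_of_continuous:
  fixes f :: "'a \<Rightarrow> 'b::{banach, second_countable_topology}"
  assumes f: "continuous_on UNIV f"
  shows "integrable \<rho> f"
proof -
  have "bounded (f ` cball 0 B)"
    by (intro compact_imp_bounded compact_continuous_image continuous_on_subset[OF f]) auto
  then obtain M where "\<forall>y\<in>f ` cball 0 B. norm y \<le> M" unfolding bounded_iff by (elim exE)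
  then have M: "norm (f x) \<le> M" if "norm x \<le> B" for x using that by simp
  have [measurable]: "f \<in> borel_measurable borel" using f by (rule borel_measurable_continuous_onI)
  show ?thesis
    by (rule \<rho>.integrable_const_bound[where B = M]) (use bounded M in auto)
qed

lemma \<rho>_prob2: "\<rho> \<in> borel_prob2"
  unfolding borel_prob2_def using \<rho>_prob integrable_of_continuous[of "\<lambda>x. (norm x)\<^sup>2"]
  by (auto intro: continuous_intros)

lemma mutual_pot: "mutual k \<mu> \<rho> = (\<integral>\<^sup>+x. ennreal (v x) \<partial>\<mu>)"
  unfolding mutual_def by (simp add: pot_def[symmetric] pot_finite_and_diff(1))

lemma v_meas[measurable]: "v \<in> borel_measurable borel"
  using v_cont by (rule borel_measurable_continuous_onI)

lemma integrable_v_comp: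
  assumes T[measurable]: "T \<in> borel_measurable borel" and "AE x in \<rho>. norm (T x) \<le> C"
  shows "integrable \<rho> (\<lambda>x. v (T x))"
proof -
  have "bounded (v ` cball 0 C)"
    by (intro compact_imp_bounded compact_continuous_image continuous_on_subset[OF v_cont]) auto
  then obtain M where "\<forall>y\<in>v ` cball 0 C. norm y \<le> M" unfolding bounded_iff by (elim exE)
  then have M: "norm (v x) \<le> M" if "norm x \<le> C" for x using that by simp
  show ?thesis
  proof (rule \<rho>.integrable_const_bound[where B = M])
    show "AE x in \<rho>. norm (v (T x)) \<le> M" using assms(2) by eventually_elim (rule M)
  qed measurable
qed

lemma mutual_self: "mutual k \<rho> \<rho> = ennreal (\<integral>x. v x \<partial>\<rho>)"
  unfolding mutual_pot
  by (rule nn_integral_eq_integral[OF integrable_of_continuous[OF v_cont]]) (simp add: v_nonneg)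

lemma mutual_self_finite: "mutual k \<rho> \<rho> < \<infinity>"
  unfolding mutual_self by simp

lemma mutual_distr_T:
  assumes [measurable]: "T \<in> borel_measurable borel" and "AE x in \<rho>. norm (T x) \<le> C"
  shows "mutual k \<rho> (distr \<rho> borel T) = ennreal (\<integral>x. v (T x) \<partial>\<rho>)"
proof -
  have "mutual k \<rho> (distr \<rho> borel T) = (\<integral>\<^sup>+x. ennreal (v x) \<partial>distr \<rho> borel T)"
    unfolding mutual_sym[OF \<rho>_prob distr_prob[OF \<rho>_prob assms(1)]] mutual_pot ..
  also have "\<dots> = (\<integral>\<^sup>+x. ennreal (v (T x)) \<partial>\<rho>)" by (subst nn_integral_distr) auto
  also have "\<dots> = ennreal (\<integral>x. v (T x) \<partial>\<rho>)"
    by (rule nn_integral_eq_integral[OF integrable_v_comp[OF assms]]) (simp add: v_nonneg)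
  finally show ?thesis .
qed

lemma mutual_distr_self:
  assumes [measurable]: "T \<in> borel_measurable borel"
  shows "mutual k (distr \<rho> borel T) (distr \<rho> borel T) = (\<integral>\<^sup>+x. (\<integral>\<^sup>+y. k (T x - T y) \<partial>\<rho>) \<partial>\<rho>)"
proof -
  interpret D: prob_space "distr \<rho> borel T" by (rule \<rho>.prob_space_distr) simp
  have "mutual k (distr \<rho> borel T) (distr \<rho> borel T) = (\<integral>\<^sup>+x. (\<integral>\<^sup>+y. k (T x - y) \<partial>distr \<rho> borel T) \<partial>\<rho>)"
    unfolding mutual_def by (subst nn_integral_distr) auto
  also have "\<dots> = (\<integral>\<^sup>+x. (\<integral>\<^sup>+y. k (T x - T y) \<partial>\<rho>) \<partial>\<rho>)"
    by (intro nn_integral_cong) (subst nn_integral_distr, auto)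
  finally show ?thesis .
qed

lemma local_min_transport:
  assumes T[measurable]: "T \<in> borel_measurable borel"
    and near: "AE x in \<rho>. norm (x - T x) \<le> \<delta>" and \<delta>: "0 \<le> \<delta>" "\<delta> < \<epsilon>" and t: "0 \<le> t" "t \<le> 1"
  shows "energy W \<rho> \<le> energy W (mix_measure t \<rho> (distr \<rho> borel T))"
proof (rule locmin)
  show "mix_measure t \<rho> (distr \<rho> borel T) \<in> borel_prob"
    by (rule mix_measure_prob[OF \<rho>_prob distr_prob[OF \<rho>_prob T] t])
  have "AE x in mix_measure t \<rho> (distr \<rho> borel T). norm x \<le> B + \<delta>"
  proof (rule AE_mix_measure)
    show "AE x in \<rho>. norm x \<le> B + \<delta>" using bounded by eventually_elim (use \<delta> in simp)
    show "AE x in distr \<rho> borel T. norm x \<le> B + \<delta>"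
    proof (subst AE_distr_iff)
      show "AE x in \<rho>. norm (T x) \<le> B + \<delta>"
        using near bounded
      proof eventually_elim
        case (elim x)
        have "norm (T x) \<le> norm x + norm (x - T x)" using norm_triangle_ineq4[of x "x - T x"] by simp
        then show ?case using elim by linarith
      qed
    qed auto
  qed auto
  then show "compactly_supported (mix_measure t \<rho> (distr \<rho> borel T))"
    by (rule compactly_supported_of_AE(1)[rotated]) simp
  have "d_infty \<rho> (mix_measure t \<rho> (distr \<rho> borel T)) \<le> ennreal \<delta>"
    by (rule d_infty_mix_transport[OF \<rho>_prob T near t \<delta>(1)])
  also have "\<dots> < ennreal \<epsilon>" using \<delta> \<epsilon> by (simp add: ennreal_less_iff)
  finally show "d_infty \<rho> (mix_measure t \<rho> (distr \<rho> borel T)) < ennreal \<epsilon>" .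
qed

text \<open>First-order condition for competitors obtained by a transport map: moving mass within distance
  less than \<open>\<epsilon>\<close> cannot decrease the average of the potential.\<close>

lemma first_order:
  assumes T[measurable]: "T \<in> borel_measurable borel"
    and near: "AE x in \<rho>. norm (x - T x) \<le> \<delta>" and \<delta>: "0 \<le> \<delta>" "\<delta> < \<epsilon>"
    and fin: "(\<integral>\<^sup>+x. (\<integral>\<^sup>+y. k (T x - T y) \<partial>\<rho>) \<partial>\<rho>) < \<infinity>"
  shows "(\<integral>x. v x \<partial>\<rho>) \<le> (\<integral>x. v (T x) \<partial>\<rho>)"
proof -
  have b: "AE x in \<rho>. norm (T x) \<le> B + \<delta>"
    using near bounded
  proof eventually_elim
    case (elim x)
    have "norm (T x) \<le> norm x + norm (x - T x)" using norm_triangle_ineq4[of x "x - T x"] by simp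
    then show ?case using elim by linarith
  qed
  have "mutual k \<rho> \<rho> \<le> mutual k \<rho> (distr \<rho> borel T)"
  proof (rule first_variation[OF \<rho>_prob distr_prob[OF \<rho>_prob T] mutual_self_finite])
    show "mutual k (distr \<rho> borel T) (distr \<rho> borel T) < \<infinity>"
      unfolding mutual_distr_self[OF T] by (rule fin)
    fix t :: real assume "0 < t" "t < 1"
    then show "mutual k \<rho> \<rho> \<le> mutual k (mix_measure t \<rho> (distr \<rho> borel T)) (mix_measure t \<rho> (distr \<rho> borel T))"
      using local_min_transport[OF T near \<delta>, of t] by (simp add: energy_mutual half_le_iff)
  qed
  then have "ennreal (\<integral>x. v x \<partial>\<rho>) \<le> ennreal (\<integral>x. v (T x) \<partial>\<rho>)"
    unfolding mutual_self mutual_distr_T[OF T b] .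
  then show ?thesis by (subst (asm) ennreal_le_iff) (auto simp: v_nonneg)
qed

text \<open>If \<open>v (x0 + z) < v x0\<close>, then by continuity every point of a neighbourhood of \<open>x0\<close> gains a definite amount
  when it is shifted by \<open>z\<close>. That neighbourhood has positive mass, so the shift contradicts \<open>first_order\<close>.\<close>

lemma euler_lagrange:
  assumes x0: "x0 \<in> measure_supp \<rho>" and z: "norm z < \<epsilon>"
  shows "v x0 \<le> v (x0 + z)"
proof (rule ccontr)
  assume "\<not> v x0 \<le> v (x0 + z)"
  define c where "c = (v x0 - v (x0 + z)) / 2"
  have c: "c > 0" using \<open>\<not> v x0 \<le> v (x0 + z)\<close> by (simp add: c_def)
  have cont: "continuous_on UNIV (\<lambda>x. v x - v (x + z))"
    by (intro continuous_intros continuous_on_compose2[OF v_cont]) auto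
  have "open ((\<lambda>x. v x - v (x + z)) -` {c<..})"
    by (rule open_vimage[OF _ cont]) simp
  moreover have "x0 \<in> (\<lambda>x. v x - v (x + z)) -` {c<..}" using c by (simp add: c_def)
  ultimately obtain A where A: "A = (\<lambda>x. v x - v (x + z)) -` {c<..}" "open A" "x0 \<in> A" by blast
  have Ab[measurable]: "A \<in> sets borel" using A by simp
  have pos: "emeasure \<rho> A > 0" using x0 A unfolding measure_supp_def by blast
  define T where "T x = (if x \<in> A then x + z else x)" for x
  have T[measurable]: "T \<in> borel_measurable borel" unfolding T_def by measurable
  have [measurable]: "(\<lambda>x. \<integral>\<^sup>+y. k (x + z - y) \<partial>\<rho>) \<in> borel_measurable borel"
    "(\<lambda>x. \<integral>\<^sup>+y. k (y + z - x) \<partial>\<rho>) \<in> borel_measurable borel" by measurable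
  \<comment> \<open>\<open>T x - T y\<close> is \<open>x - y\<close> if both points or none of them move, and a difference with one
    shifted point otherwise; the latter integrate to values of the potential, so the competitor has finite energy\<close>
  have kT: "k (T x - T y) \<le> k (x - y) + (k (x + z - y) + k (y + z - x))" for x y
  proof -
    have "x - (y + z) = - (y + z - x)" by simp
    then have "k (x - (y + z)) = k (y + z - x)" by (metis k_sym)
    then show ?thesis unfolding T_def by (auto simp: add_increasing add_increasing2)
  qed
  interpret P: pair_sigma_finite \<rho> \<rho> ..
  have shift: "(\<integral>\<^sup>+x. (\<integral>\<^sup>+y. k (x + z - y) \<partial>\<rho>) \<partial>\<rho>) < \<infinity>"
  proof -
    have "(\<integral>\<^sup>+x. (\<integral>\<^sup>+y. k (x + z - y) \<partial>\<rho>) \<partial>\<rho>) = (\<integral>\<^sup>+x. ennreal (v (x + z)) \<partial>\<rho>)"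
      by (simp add: pot_def[symmetric] pot_finite_and_diff(1))
    also have "\<dots> = ennreal (\<integral>x. v (x + z) \<partial>\<rho>)"
      by (rule nn_integral_eq_integral, rule integrable_of_continuous)
         (auto intro!: continuous_on_compose2[OF v_cont] continuous_intros simp: v_nonneg)
    finally show ?thesis by simp
  qed
  have shift2: "(\<integral>\<^sup>+x. (\<integral>\<^sup>+y. k (y + z - x) \<partial>\<rho>) \<partial>\<rho>) < \<infinity>"
    using shift by (subst P.Fubini') measurable
  have "(\<integral>\<^sup>+x. (\<integral>\<^sup>+y. k (T x - T y) \<partial>\<rho>) \<partial>\<rho>)
     \<le> (\<integral>\<^sup>+x. (\<integral>\<^sup>+y. k (x - y) + (k (x + z - y) + k (y + z - x)) \<partial>\<rho>) \<partial>\<rho>)"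
    by (intro nn_integral_mono kT)
  also have "\<dots> = mutual k \<rho> \<rho> + ((\<integral>\<^sup>+x. (\<integral>\<^sup>+y. k (x + z - y) \<partial>\<rho>) \<partial>\<rho>) + (\<integral>\<^sup>+x. (\<integral>\<^sup>+y. k (y + z - x) \<partial>\<rho>) \<partial>\<rho>))"
    unfolding mutual_def by (simp add: nn_integral_add)
  also have "\<dots> < \<infinity>" using mutual_self_finite shift shift2 by simp
  finally have fin: "(\<integral>\<^sup>+x. (\<integral>\<^sup>+y. k (T x - T y) \<partial>\<rho>) \<partial>\<rho>) < \<infinity>" .
  have near: "norm (x - T x) \<le> norm z" for x unfolding T_def by simp
  have "(\<integral>x. v x \<partial>\<rho>) \<le> (\<integral>x. v (T x) \<partial>\<rho>)"
    by (rule first_order[OF T _ _ z fin]) (use near in auto)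
  have i1: "integrable \<rho> v" by (rule integrable_of_continuous[OF v_cont])
  have i2: "integrable \<rho> (\<lambda>x. v (T x))"
  proof (rule integrable_v_comp[OF T])
    show "AE x in \<rho>. norm (T x) \<le> B + norm z"
      using bounded
    proof eventually_elim
      case (elim x)
      have "norm (T x) \<le> norm x + norm (x - T x)" using norm_triangle_ineq4[of x "x - T x"] by simp
      then show ?case using elim near[of x] by linarith
    qed
  qed
  have i3: "integrable \<rho> (\<lambda>x. c * indicator A x)"
    by (rule \<rho>.integrable_const_bound[where B = c]) (use c in \<open>auto split: split_indicator\<close>)
  have "(\<integral>x. c * indicator A x \<partial>\<rho>) \<le> (\<integral>x. v x - v (T x) \<partial>\<rho>)"
  proof (rule integral_mono[OF i3])
    show "integrable \<rho> (\<lambda>x. v x - v (T x))" using i1 i2 by simp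
    fix x show "c * indicator A x \<le> v x - v (T x)"
    proof (cases "x \<in> A")
      case True
      then have "c < v x - v (x + z)" unfolding A(1) by simp
      then show ?thesis using True by (simp add: T_def)
    qed (simp add: T_def)
  qed
  also have "\<dots> = (\<integral>x. v x \<partial>\<rho>) - (\<integral>x. v (T x) \<partial>\<rho>)" using i1 i2 by simp
  also have "\<dots> \<le> 0" using \<open>(\<integral>x. v x \<partial>\<rho>) \<le> (\<integral>x. v (T x) \<partial>\<rho>)\<close> by simp
  finally have "c * measure \<rho> A \<le> 0" by simp
  moreover have "measure \<rho> A > 0" using pos by (simp add: \<rho>.emeasure_eq_measure)
  ultimately show False using c by (simp add: mult_le_0_iff)
qed

lemma g_zero_on_supp:
  assumes "x0 \<in> measure_supp \<rho>" shows "g x0 = 0"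
proof -
  have "(\<lambda>z. g x0 \<bullet> z) = (\<lambda>z. 0)"
  proof (rule differential_zero_maxmin[OF _ open_ball v_has_derivative])
    show "x0 \<in> ball x0 \<epsilon>" using \<epsilon> by simp
    show "(\<forall>y\<in>ball x0 \<epsilon>. v y \<le> v x0) \<or> (\<forall>y\<in>ball x0 \<epsilon>. v x0 \<le> v y)"
      using euler_lagrange[OF assms, of "y - x0" for y] by (auto simp: dist_norm norm_minus_commute)
  qed
  then have "g x0 \<bullet> g x0 = 0" by meson
  then show ?thesis by simp
qed

text \<open>The image of \<open>\<rho>\<close> has the same energy and the same center of mass. If it were different from \<open>\<rho>\<close>,
  strict convexity would make the midpoint of the two better than \<open>\<rho>\<close>, and the midpoint is
  an admissible competitor.\<close>

lemma invariant_under_small_isometry: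
  assumes lin: "linear T" and iso: "\<And>q. norm (T q) = norm q"
    and near: "\<And>q. norm q \<le> B \<Longrightarrow> norm (q - T q) \<le> \<delta>" and \<delta>: "0 \<le> \<delta>" "\<delta> < \<epsilon>"
  shows "distr \<rho> borel T = \<rho>"
proof (rule ccontr)
  assume neq: "distr \<rho> borel T \<noteq> \<rho>"
  let ?\<nu> = "distr \<rho> borel T"
  have bl: "bounded_linear T" using lin by (simp add: linear_conv_bounded_linear)
  then have Tc: "continuous_on UNIV T" by (intro linear_continuous_on)
  then have T[measurable]: "T \<in> borel_measurable borel" by (rule borel_measurable_continuous_onI)
  have nearAE: "AE x in \<rho>. norm (x - T x) \<le> \<delta>" using bounded by eventually_elim (rule near)
  have \<nu>p: "?\<nu> \<in> borel_prob" by (rule distr_prob[OF \<rho>_prob T])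
  have \<nu>2: "?\<nu> \<in> borel_prob2"
    unfolding borel_prob2_def using \<nu>p integrable_of_continuous[of "\<lambda>x. (norm x)\<^sup>2"]
    by (auto simp: integrable_distr_eq iso intro!: continuous_intros)
  have "center_of_mass ?\<nu> = (\<integral>x. T x \<partial>\<rho>)"
    unfolding center_of_mass_def by (subst integral_distr) auto
  also have "\<dots> = T (\<integral>x. x \<partial>\<rho>)"
    by (rule integral_bounded_linear[OF bl]) (rule integrable_of_continuous[OF continuous_on_id])
  also have "\<dots> = 0" using com lin by (simp add: center_of_mass_def linear_0)
  finally have com\<nu>: "center_of_mass ?\<nu> = center_of_mass \<rho>" using com by simp
  have "mutual k ?\<nu> ?\<nu> = mutual k \<rho> \<rho>"
    unfolding mutual_distr_self[OF T] unfolding mutual_def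
    by (intro nn_integral_cong k_rad) (simp add: linear_diff[OF lin, symmetric] iso)
  then have en: "energy W ?\<nu> = energy W \<rho>" by (simp add: energy_mutual)
  have fin: "energy W \<rho> < \<infinity>"
    using mutual_self_finite unfolding energy_mutual by (simp add: ennreal_divide_eq_top_iff less_top[symmetric])
  have "strictly_convex_on {0..1} (\<lambda>t. energy W (mix_measure t \<rho> ?\<nu>))"
    using lic \<rho>_prob2 \<nu>2 neq com\<nu> fin en unfolding LIC_def by auto
  then have "energy W (mix_measure ((1 - 1/2) * 0 + (1/2) * 1) \<rho> ?\<nu>)
    < ennreal (1 - 1/2) * energy W (mix_measure 0 \<rho> ?\<nu>) + ennreal (1/2) * energy W (mix_measure 1 \<rho> ?\<nu>)"
    unfolding strictly_convex_on_def by (elim ballE[where x = 0] ballE[where x = 1] allE[where x = "1/2"]) auto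
  moreover have "mix_measure 0 \<rho> ?\<nu> = \<rho>" "mix_measure 1 \<rho> ?\<nu> = ?\<nu>"
    by (auto intro!: measure_eqI simp: emeasure_mix_measure)
  ultimately have "energy W (mix_measure (1/2) \<rho> ?\<nu>) < energy W \<rho>"
    using ennreal_convex_combination_self[of "1/2" "energy W \<rho>"] by (simp add: en)
  moreover have "energy W \<rho> \<le> energy W (mix_measure (1/2) \<rho> ?\<nu>)"
    by (rule local_min_transport[OF T nearAE \<delta>]) auto
  ultimately show False by simp
qed

lemma invariance_consequences:
  assumes lin: "linear T" and iso: "\<And>q. norm (T q) = norm q" and inv: "distr \<rho> borel T = \<rho>"
  shows "v (T x) = v x" "T x \<in> measure_supp \<rho> \<longleftrightarrow> x \<in> measure_supp \<rho>"
proof -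
  have bl: "bounded_linear T" using lin by (simp add: linear_conv_bounded_linear)
  then have Tc: "continuous_on UNIV T" by (intro linear_continuous_on)
  then have T[measurable]: "T \<in> borel_measurable borel" by (rule borel_measurable_continuous_onI)
  have "pot (T x) = (\<integral>\<^sup>+y. k (T x - y) \<partial>distr \<rho> borel T)" unfolding inv pot_def ..
  also have "\<dots> = (\<integral>\<^sup>+y. k (T x - T y) \<partial>\<rho>)" by (subst nn_integral_distr) auto
  also have "\<dots> = pot x" unfolding pot_def
    by (intro nn_integral_cong k_rad) (simp add: linear_diff[OF lin, symmetric] iso)
  finally show "v (T x) = v x" by (simp add: v_def)
  have em: "emeasure \<rho> (T -` U) = emeasure \<rho> U" if "open U" for U
    using that emeasure_distr[of T \<rho> borel U] by (simp add: inv)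
  show "T x \<in> measure_supp \<rho> \<longleftrightarrow> x \<in> measure_supp \<rho>"
  proof
    assume a: "x \<in> measure_supp \<rho>"
    show "T x \<in> measure_supp \<rho>" unfolding measure_supp_def
    proof safe
      fix U assume U: "open U" "T x \<in> U"
      then have "open (T -` U)" "x \<in> T -` U" using open_vimage[OF _ Tc] by auto
      then have "emeasure \<rho> (T -` U) > 0" using a unfolding measure_supp_def by blast
      then show "0 < emeasure \<rho> U" using em[OF U(1)] by simp
    qed
  next
    assume a: "T x \<in> measure_supp \<rho>"
    show "x \<in> measure_supp \<rho>" unfolding measure_supp_def
    proof safe
      fix U assume U: "open U" "x \<in> U"
      then obtain d where d: "d > 0" "ball x d \<subseteq> U" using open_contains_ball by blast
      have "T -` ball (T x) d = ball x d"
        by (auto simp: dist_norm linear_diff[OF lin, symmetric] iso)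
      then have "emeasure \<rho> (ball x d) = emeasure \<rho> (ball (T x) d)" using em[of "ball (T x) d"] by simp
      also have "\<dots> > 0" using a d unfolding measure_supp_def by auto
      finally have "emeasure \<rho> (ball x d) > 0" .
      also have "emeasure \<rho> (ball x d) \<le> emeasure \<rho> U" using d U by (intro emeasure_mono) auto
      finally show "0 < emeasure \<rho> U" .
    qed
  qed
qed

text \<open>By the previous lemmas \<open>v\<close> and the support are locally constant along spheres, and spheres are connected in dimension
  at least two.\<close>

lemma radial:
  assumes d: "DIM('a) \<ge> 2" and xy: "norm x = norm y"
  shows "v x = v y" "x \<in> measure_supp \<rho> \<longleftrightarrow> y \<in> measure_supp \<rho>"
proof -
  define r where "r = norm x"
  have "(v x, x \<in> measure_supp \<rho>) = (v y, y \<in> measure_supp \<rho>)"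
  proof (cases "r = 0")
    case True
    then show ?thesis using xy unfolding r_def by auto
  next
    case False
    then have r: "r > 0" by (simp add: r_def)
    show ?thesis
    proof (rule connected_local_const[where A = "sphere 0 r" and f = "\<lambda>x. (v x, x \<in> measure_supp \<rho>)"])
      show "connected (sphere (0::'a) r)" by (rule connected_sphere[OF d])
      show "x \<in> sphere 0 r" "y \<in> sphere 0 r" using xy by (auto simp: r_def)
      show "\<forall>a\<in>sphere 0 r. \<forall>\<^sub>F b in at a within sphere 0 r.
          (v a, a \<in> measure_supp \<rho>) = (v b, b \<in> measure_supp \<rho>)"
      proof
        fix a :: 'a assume a: "a \<in> sphere 0 r"
        \<comment> \<open>the rotation moving \<open>a\<close> to \<open>b\<close> then displaces points of norm at most \<open>B\<close> by at most \<open>\<epsilon> / 2\<close>\<close>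
        define \<eta> where "\<eta> = min r (r * \<epsilon> / (8 * (B + 1)))"
        have \<eta>: "\<eta> > 0" unfolding \<eta>_def using r \<epsilon> B_nonneg by auto
        show "\<forall>\<^sub>F b in at a within sphere 0 r. (v a, a \<in> measure_supp \<rho>) = (v b, b \<in> measure_supp \<rho>)"
          unfolding eventually_at
        proof (intro exI[of _ \<eta>] conjI \<eta> ballI impI)
          fix b assume b: "b \<in> sphere 0 r" "b \<noteq> a \<and> dist b a < \<eta>"
          have ab: "norm a = norm b" "norm (a - b) < norm a"
            using a b by (auto simp: \<eta>_def dist_norm norm_minus_commute)
          obtain T where T: "linear T" "\<And>q. norm (T q) = norm q" "T a = b"
            "\<And>q. norm (q - T q) \<le> 4 * (norm (a - b) / norm a) * norm q"
            using small_rotation_exists[OF ab] by blast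
          have "norm (a - b) \<le> r * \<epsilon> / (8 * (B + 1))"
            using b by (simp add: \<eta>_def dist_norm norm_minus_commute)
          then have "norm (a - b) / r \<le> \<epsilon> / (8 * (B + 1))" using r by (simp add: field_simps)
          then have small: "norm (a - b) / norm a \<le> \<epsilon> / (8 * (B + 1))" using a by simp
          have "distr \<rho> borel T = \<rho>"
          proof (rule invariant_under_small_isometry[OF T(1,2)])
            fix q :: 'a assume q: "norm q \<le> B"
            have "norm (q - T q) \<le> 4 * (norm (a - b) / norm a) * norm q" by (rule T(4))
            also have "\<dots> \<le> 4 * (\<epsilon> / (8 * (B + 1))) * (B + 1)"
              using q small \<epsilon> B_nonneg by (intro mult_mono mult_left_mono) auto
            also have "\<dots> = \<epsilon> / 2" using B_nonneg by (simp add: field_simps)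
            finally show "norm (q - T q) \<le> \<epsilon> / 2" .
          qed (use \<epsilon> in auto)
          from invariance_consequences[OF T(1,2) this, of a] T(3)
          show "(v a, a \<in> measure_supp \<rho>) = (v b, b \<in> measure_supp \<rho>)" by simp
        qed
      qed
    qed
  qed
  then show "v x = v y" "x \<in> measure_supp \<rho> \<longleftrightarrow> y \<in> measure_supp \<rho>" by auto
qed

end

section \<open>Smoothness of the potential off the support\<close>

context kernel_density begin

abbreviation K :: "'a set" where "K \<equiv> measure_supp \<rho>"

lemma AE_K: "AE y in \<rho>. y \<in> K"
  by (rule AE_measure_supp[OF sets_\<rho>])

lemma K_subset: "K \<subseteq> cball 0 B"
  by (rule compactly_supported_of_AE(2)[OF sets_\<rho> bounded])

lemma K_compact: "compact K"
  using compactly_supported_of_AE(1)[OF sets_\<rho> bounded] unfolding compactly_supported_def .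

lemma open_compl_K: "open (- K)"
  by (rule open_Compl[OF measure_supp_closed])

lemma K_nonempty: "K \<noteq> {}"
proof
  assume "K = {}"
  then have "AE y in \<rho>. False" using AE_K by simp
  then show False using \<rho>.AE_False by simp
qed

text \<open>Convolution with \<open>\<rho>\<close>; meaningful at points off the support even if \<open>f\<close> is singular at the origin.\<close>

definition conv :: "('a \<Rightarrow> 'b::euclidean_space) \<Rightarrow> 'a \<Rightarrow> 'b" where
  "conv f x = (\<integral>y. f (x - y) \<partial>\<rho>)"

lemma punctured_measurable:
  fixes f :: "'a \<Rightarrow> 'b::euclidean_space"
  assumes "continuous_on (- {0}) f" shows "f \<in> borel_measurable borel"
proof -
  have "(\<lambda>x. if x \<in> - {0} then f x else f 0) \<in> borel_measurable borel"
    by (rule borel_measurable_continuous_on_if) (auto intro: assms)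
  moreover have "(\<lambda>x. if x \<in> - {0} then f x else f 0) = f" by auto
  ultimately show ?thesis by simp
qed

lemma conv_integrable:
  fixes f :: "'a \<Rightarrow> 'b::euclidean_space"
  assumes f: "continuous_on (- {0}) f" and x: "x \<notin> K"
  shows "integrable \<rho> (\<lambda>y. f (x - y))"
proof -
  note [measurable] = punctured_measurable[OF f]
  have "compact ((\<lambda>y. x - y) ` K)"
    by (intro compact_continuous_image K_compact continuous_intros)
  moreover have "continuous_on ((\<lambda>y. x - y) ` K) f"
    by (rule continuous_on_subset[OF f]) (use x in auto)
  ultimately have "bounded (f ` (\<lambda>y. x - y) ` K)"
    by (intro compact_imp_bounded) (rule compact_continuous_image)
  then obtain M where "\<forall>y\<in>f ` (\<lambda>y. x - y) ` K. norm y \<le> M" unfolding bounded_iff by (elim exE)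
  then have M: "norm (f (x - y)) \<le> M" if "y \<in> K" for y using that by blast
  show ?thesis
  proof (rule \<rho>.integrable_const_bound[where B = M])
    show "AE y in \<rho>. norm (f (x - y)) \<le> M" using AE_K by eventually_elim (rule M)
  qed measurable
qed

text \<open>For \<open>x\<close> off the compact support, the differences \<open>x - y\<close> stay in a compact set away from the
  origin, where \<open>f\<close> is uniformly continuous. This uniformity replaces dominated convergence when
  differentiating under the integral sign.\<close>

lemma uniform_modulus:
  fixes f :: "'a \<Rightarrow> 'b::euclidean_space"
  assumes f: "continuous_on (- {0}) f" and x: "x \<notin> K" and e: "e > 0"
  obtains \<eta> where "\<eta> > 0" "\<And>y z. y \<in> K \<Longrightarrow> norm z < \<eta> \<Longrightarrow> x - y + z \<noteq> 0"
    "\<And>y z. y \<in> K \<Longrightarrow> norm z < \<eta> \<Longrightarrow> norm (f (x - y + z) - f (x - y)) < e"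
proof -
  obtain d where d: "d > 0" "\<And>y. y \<in> K \<Longrightarrow> d \<le> dist x y"
    using separate_point_closed[OF measure_supp_closed x] by blast
  define Q where "Q = {q + p | q p. q \<in> (\<lambda>y. x - y) ` K \<and> p \<in> cball (0::'a) (d / 2)}"
  have "compact Q" unfolding Q_def
    by (intro compact_sums compact_continuous_image K_compact continuous_intros compact_cball)
  have nz: "x - y + z \<noteq> 0" if "y \<in> K" "norm z \<le> d / 2" for y z
  proof
    assume "x - y + z = 0"
    then have "x - y = - z" by (simp add: eq_neg_iff_add_eq_0)
    then have "dist x y = norm z" by (simp add: dist_norm)
    then show False using d(2)[OF that(1)] that(2) d(1) by simp
  qed
  then have "continuous_on Q f"
    by (intro continuous_on_subset[OF f]) (auto simp: Q_def)
  then have "uniformly_continuous_on Q f" using \<open>compact Q\<close> by (rule compact_uniformly_continuous)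
  then obtain \<eta> where \<eta>: "\<eta> > 0" "\<And>q q'. q \<in> Q \<Longrightarrow> q' \<in> Q \<Longrightarrow> dist q' q < \<eta> \<Longrightarrow> dist (f q') (f q) < e"
    using e unfolding uniformly_continuous_on_def by metis
  have inQ: "x - y + z \<in> Q" if "y \<in> K" "norm z \<le> d / 2" for y z
    unfolding Q_def using that by force
  show ?thesis
  proof (rule that[of "min \<eta> (d / 2)"])
    show "norm (f (x - y + z) - f (x - y)) < e" if "y \<in> K" "norm z < min \<eta> (d / 2)" for y z
      using \<eta>(2)[OF inQ[OF that(1), of 0] inQ[OF that(1), of z]] that d(1) by (simp add: dist_norm)
    show "x - y + z \<noteq> 0" if "y \<in> K" "norm z < min \<eta> (d / 2)" for y z
      using nz[OF that(1), of z] that by simp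
  qed (use \<eta> d in auto)
qed

lemma conv_continuous:
  fixes f :: "'a \<Rightarrow> real"
  assumes f: "continuous_on (- {0}) f"
  shows "continuous_on (- K) (conv f)"
  unfolding continuous_on_eq_continuous_at[OF open_compl_K]
proof
  fix x assume "x \<in> - K"
  then have x: "x \<notin> K" by simp
  show "isCont (conv f) x"
    unfolding continuous_at_eps_delta
  proof (intro allI impI)
    fix e :: real assume e: "e > 0"
    obtain \<eta> where \<eta>: "\<eta> > 0" "\<And>y z. y \<in> K \<Longrightarrow> norm z < \<eta> \<Longrightarrow> x - y + z \<noteq> 0"
      "\<And>y z. y \<in> K \<Longrightarrow> norm z < \<eta> \<Longrightarrow> norm (f (x - y + z) - f (x - y)) < e / 2"
      using uniform_modulus[OF f x, of "e / 2"] e by (metis half_gt_zero)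
    show "\<exists>d>0. \<forall>x'. dist x' x < d \<longrightarrow> dist (conv f x') (conv f x) < e"
    proof (intro exI[of _ \<eta>] conjI allI impI \<eta>(1))
      fix x' assume d: "dist x' x < \<eta>"
      define z where "z = x' - x"
      have z: "norm z < \<eta>" using d by (simp add: z_def dist_norm)
      have x': "x' \<notin> K" using \<eta>(2)[of x' z] z by (auto simp: z_def)
      note i = conv_integrable[OF f x'] conv_integrable[OF f x]
      have "conv f x' - conv f x = (\<integral>y. f (x' - y) - f (x - y) \<partial>\<rho>)"
        unfolding conv_def using i by simp
      also have "norm \<dots> \<le> (\<integral>y. norm (f (x' - y) - f (x - y)) \<partial>\<rho>)" by (rule integral_norm_bound)
      also have "\<dots> \<le> (\<integral>y. e / 2 \<partial>\<rho>)"
      proof (rule integral_mono_AE)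
        show "AE y in \<rho>. norm (f (x' - y) - f (x - y)) \<le> e / 2"
          using AE_K
        proof eventually_elim
          case (elim y)
          have eq: "x - y + z = x' - y" by (simp add: z_def)
          show ?case using \<eta>(3)[OF elim z] unfolding eq by simp
        qed
      qed (use i in auto)
      also have "\<dots> < e" using e by (simp add: \<rho>.prob_space[simplified])
      finally show "dist (conv f x') (conv f x) < e" by (simp add: dist_norm)
    qed
  qed
qed

lemma gradient_continuous:
  fixes f :: "'a \<Rightarrow> real"
  assumes "Ck_on (Suc j) f (- {0})"
  shows "continuous_on (- {0}) (gradient f)"
  unfolding gradient_def
  by (intro continuous_intros Ck_on_continuous[OF Ck_on_partial[OF assms]])

text \<open>By the mean value theorem the error of the linear approximation of \<open>f (x - y + z)\<close> is at most
  \<open>|z|\<close> times the oscillation of the gradient, which is small uniformly in \<open>y\<close>.\<close>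

lemma conv_has_derivative:
  fixes f :: "'a \<Rightarrow> real"
  assumes f: "Ck_on (Suc j) f (- {0})" and x: "x \<notin> K"
  shows "(conv f has_derivative (\<lambda>z. conv (gradient f) x \<bullet> z)) (at x)"
  unfolding has_derivative_at_alt
proof (intro conjI allI impI)
  show "bounded_linear ((\<bullet>) (conv (gradient f) x))" by (rule bounded_linear_inner_right)
  fix e :: real assume e: "e > 0"
  note gc = gradient_continuous[OF f] and fc = Ck_on_continuous[OF f]
  obtain \<eta> where \<eta>: "\<eta> > 0" "\<And>y z. y \<in> K \<Longrightarrow> norm z < \<eta> \<Longrightarrow> x - y + z \<noteq> 0"
    "\<And>y z. y \<in> K \<Longrightarrow> norm z < \<eta> \<Longrightarrow> norm (gradient f (x - y + z) - gradient f (x - y)) < e"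
    using uniform_modulus[OF gc x e] by metis
  show "\<exists>d>0. \<forall>x'. norm (x' - x) < d \<longrightarrow>
      norm (conv f x' - conv f x - conv (gradient f) x \<bullet> (x' - x)) \<le> e * norm (x' - x)"
  proof (intro exI[of _ \<eta>] conjI allI impI \<eta>(1))
    fix x' assume d: "norm (x' - x) < \<eta>"
    define z where "z = x' - x"
    have z: "norm z < \<eta>" using d by (simp add: z_def)
    have x': "x' \<notin> K" using \<eta>(2)[of x' z] z by (auto simp: z_def)
    have pointwise: "norm (f (x' - y) - f (x - y) - gradient f (x - y) \<bullet> z) \<le> e * norm z" if y: "y \<in> K" for y
    proof -
      define q where "q = x - y"
      have sz: "norm (s *\<^sub>R z) < \<eta>" if "0 \<le> s" "s \<le> 1" for s
        using z that by (intro le_less_trans[OF _ z]) (simp add: mult_left_le_one_le)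
      have der: "((\<lambda>s. f (q + s *\<^sub>R z) - s * (gradient f q \<bullet> z)) has_real_derivative
          (gradient f (q + s *\<^sub>R z) - gradient f q) \<bullet> z) (at s)" if s: "0 \<le> s" "s \<le> 1" for s
      proof -
        have "q + s *\<^sub>R z \<noteq> 0" using \<eta>(2)[OF y sz[OF s]] by (simp add: q_def)
        then have "f differentiable (at (q + s *\<^sub>R z))"
          by (intro Ck_on_differentiable[OF open_punctured _ f]) simp
        moreover have "((\<lambda>s. q + s *\<^sub>R z) has_derivative (\<lambda>s. s *\<^sub>R z)) (at s)"
          by (auto intro!: derivative_eq_intros)
        ultimately have "((\<lambda>s. f (q + s *\<^sub>R z)) has_derivative (\<lambda>h. gradient f (q + s *\<^sub>R z) \<bullet> (h *\<^sub>R z))) (at s)"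
          using has_derivative_compose has_derivative_gradient by blast
        then have "((\<lambda>s. f (q + s *\<^sub>R z)) has_real_derivative gradient f (q + s *\<^sub>R z) \<bullet> z) (at s)"
          by (simp add: has_field_derivative_def mult_commute_abs)
        then show ?thesis
          by (auto intro!: derivative_eq_intros simp: inner_diff_left)
      qed
      have "\<exists>s. 0 < s \<and> s < 1 \<and> (f (q + 1 *\<^sub>R z) - 1 * (gradient f q \<bullet> z)) - (f (q + 0 *\<^sub>R z) - 0 * (gradient f q \<bullet> z))
         = (1 - 0) * ((gradient f (q + s *\<^sub>R z) - gradient f q) \<bullet> z)"
        by (rule MVT2) (use der in auto)
      then obtain s where s: "0 < s" "s < 1"
        "f (q + z) - gradient f q \<bullet> z - f q = (gradient f (q + s *\<^sub>R z) - gradient f q) \<bullet> z" by auto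
      have "norm ((gradient f (q + s *\<^sub>R z) - gradient f q) \<bullet> z) \<le> norm (gradient f (q + s *\<^sub>R z) - gradient f q) * norm z"
        using Cauchy_Schwarz_ineq2 by simp
      also have "\<dots> \<le> e * norm z"
        using \<eta>(3)[OF y sz[of s]] s by (intro mult_right_mono) (auto simp: q_def)
      finally have "norm (f (q + z) - gradient f q \<bullet> z - f q) \<le> e * norm z" using s(3) by simp
      moreover have "q + z = x' - y" by (simp add: q_def z_def)
      ultimately show ?thesis by (simp add: q_def algebra_simps)
    qed
    note i = conv_integrable[OF fc x'] conv_integrable[OF fc x] conv_integrable[OF gc x]
    have "conv (gradient f) x \<bullet> z = (\<integral>y. gradient f (x - y) \<bullet> z \<partial>\<rho>)"
      unfolding conv_def by (rule integral_inner_left[symmetric]) (rule i(3))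
    then have "conv f x' - conv f x - conv (gradient f) x \<bullet> z
      = (\<integral>y. f (x' - y) - f (x - y) - gradient f (x - y) \<bullet> z \<partial>\<rho>)"
      unfolding conv_def using i by simp
    also have "norm \<dots> \<le> (\<integral>y. norm (f (x' - y) - f (x - y) - gradient f (x - y) \<bullet> z) \<partial>\<rho>)"
      by (rule integral_norm_bound)
    also have "\<dots> \<le> (\<integral>y. e * norm z \<partial>\<rho>)"
      by (rule integral_mono_AE) (use i AE_K pointwise in auto)
    also have "\<dots> = e * norm z" by (simp add: \<rho>.prob_space[simplified])
    finally show "norm (conv f x' - conv f x - conv (gradient f) x \<bullet> (x' - x)) \<le> e * norm (x' - x)"
      by (simp add: z_def)
  qed
qed

lemma partial_deriv_conv:
  assumes f: "Ck_on (Suc j) f (- {0})" and x: "x \<notin> K" and b: "b \<in> Basis"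
  shows "partial_deriv b (conv f) x = conv (partial_deriv b f) x"
proof -
  have "partial_deriv b (conv f) x = conv (gradient f) x \<bullet> b"
    by (rule partial_deriv_eqI[OF conv_has_derivative[OF f x]])
  also have "\<dots> = conv (partial_deriv b f) x"
    unfolding conv_def
    by (subst integral_inner_left[symmetric])
       (simp_all add: conv_integrable[OF gradient_continuous[OF f] x] gradient_inner_Basis[OF b])
  finally show ?thesis .
qed

lemma Ck_on_conv: "Ck_on j f (- {0}) \<Longrightarrow> Ck_on j (conv f) (- K)"
proof (induction j arbitrary: f)
  case 0
  then show ?case by (simp add: conv_continuous)
next
  case (Suc j)
  have "Ck_on j (partial_deriv b (conv f)) (- K)" if b: "b \<in> Basis" for b
  proof -
    have "Ck_on j (conv (partial_deriv b f)) (- K)"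
      by (rule Suc.IH) (rule Ck_on_partial[OF Suc.prems b])
    then show ?thesis
      using Ck_on_cong[OF open_compl_K, of "partial_deriv b (conv f)" "conv (partial_deriv b f)" j]
        partial_deriv_conv[OF Suc.prems _ b] by simp
  qed
  moreover have "conv f differentiable_on (- K)"
    unfolding differentiable_on_eq_differentiable_at[OF open_compl_K]
    using conv_has_derivative[OF Suc.prems] unfolding differentiable_def by blast
  ultimately show ?case by simp
qed

lemma laplacian_conv:
  assumes f: "Ck_on (Suc (Suc j)) f (- {0})" and x: "x \<notin> K"
  shows "laplacian (conv f) x = conv (laplacian f) x"
proof -
  have "partial_deriv b (partial_deriv b (conv f)) x = conv (partial_deriv b (partial_deriv b f)) x"
    if b: "b \<in> Basis" for b
  proof -
    have "partial_deriv b (partial_deriv b (conv f)) x = partial_deriv b (conv (partial_deriv b f)) x"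
      by (rule partial_deriv_cong[OF open_compl_K]) (use x partial_deriv_conv[OF f _ b] in auto)
    also have "\<dots> = conv (partial_deriv b (partial_deriv b f)) x"
      by (rule partial_deriv_conv[OF Ck_on_partial[OF f b] x b])
    finally show ?thesis .
  qed
  then have "laplacian (conv f) x = (\<Sum>b\<in>Basis. conv (partial_deriv b (partial_deriv b f)) x)"
    unfolding laplacian_def by simp
  also have "\<dots> = conv (laplacian f) x"
    unfolding conv_def laplacian_def
    by (rule Bochner_Integration.integral_sum[symmetric])
       (intro conv_integrable[OF _ x] Ck_on_continuous[OF Ck_on_partial[OF Ck_on_partial[OF f]]])
  finally show ?thesis .
qed

lemma v_eq_conv:
  assumes x: "x \<notin> K" shows "v x = conv w x"
proof -
  have wc: "continuous_on (- {0}) w" by (rule Ck_on_continuous[OF w4])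
  have "pot x = (\<integral>\<^sup>+y. ennreal (w (x - y)) \<partial>\<rho>)"
    unfolding pot_def
    by (rule nn_integral_cong_AE) (use AE_K in eventually_elim, use x in \<open>auto intro!: k_eq'\<close>)
  also have "\<dots> = ennreal (conv w x)"
    unfolding conv_def by (rule nn_integral_eq_integral[OF conv_integrable[OF wc x]]) (simp add: w_nonneg)
  finally show ?thesis unfolding v_def using w_nonneg by (simp add: conv_def)
qed

lemma w_Ck: "Ck_on (Suc (Suc 2)) w (- {0})"
  using w4 by (simp add: eval_nat_numeral del: Ck_on.simps)

lemma lap_w_Ck: "Ck_on 2 (laplacian w) (- {0})"
  by (rule Ck_on_laplacian[OF open_punctured w_Ck])

lemma v_Ck: "Ck_on (Suc (Suc 2)) v (- K)"
  using Ck_on_conv[OF w_Ck] Ck_on_cong[OF open_compl_K, of v "conv w"] v_eq_conv by blast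

lemma v_Ck2: "Ck_on 2 v (- K)"
  using Ck_on_lower[OF Ck_on_lower[OF v_Ck]] .

text \<open>\<open>laplacian_conv\<close> speaks about \<open>conv w\<close>, which agrees with \<open>v\<close> off the support only; this is enough
  because the complement of the support is open.\<close>

lemma lap_v: "x \<notin> K \<Longrightarrow> laplacian v x = conv (laplacian w) x"
proof -
  assume x: "x \<notin> K"
  have p: "partial_deriv b v y = partial_deriv b (conv w) y" if "y \<in> - K" for b y
    by (rule partial_deriv_cong[OF open_compl_K that]) (simp add: v_eq_conv)
  have "partial_deriv b (partial_deriv b v) x = partial_deriv b (partial_deriv b (conv w)) x" for b
    by (rule partial_deriv_cong[OF open_compl_K]) (use x p in auto)
  then have "laplacian v x = laplacian (conv w) x" unfolding laplacian_def by simp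
  then show ?thesis using laplacian_conv[OF w_Ck x] by simp
qed

lemma lap_v_Ck: "Ck_on 2 (laplacian v) (- K)"
  by (rule Ck_on_laplacian[OF open_compl_K v_Ck])

lemma lap_lap_v_neg: assumes x: "x \<notin> K" shows "laplacian (laplacian v) x < 0"
proof -
  have p: "partial_deriv b (laplacian v) y = partial_deriv b (conv (laplacian w)) y" if "y \<in> - K" for b y
    by (rule partial_deriv_cong[OF open_compl_K that]) (simp add: lap_v)
  have "partial_deriv b (partial_deriv b (laplacian v)) x = partial_deriv b (partial_deriv b (conv (laplacian w))) x" for b
    by (rule partial_deriv_cong[OF open_compl_K]) (use x p in auto)
  then have "laplacian (laplacian v) x = laplacian (conv (laplacian w)) x" unfolding laplacian_def by simp
  also have "\<dots> = conv (laplacian (laplacian w)) x"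
    using laplacian_conv[of 0 "laplacian w" x] lap_w_Ck x by (simp add: numeral_2_eq_2)
  also have "\<dots> < (\<integral>y. 0 \<partial>\<rho>)"
    unfolding conv_def
  proof (rule \<rho>.integral_less_AE_space)
    have "Ck_on (Suc (Suc 0)) (laplacian w) (- {0})" using lap_w_Ck by (simp add: numeral_2_eq_2)
    from Ck_on_laplacian[OF open_punctured this]
    have "continuous_on (- {0}) (laplacian (laplacian w))" by simp
    then show "integrable \<rho> (\<lambda>y. laplacian (laplacian w) (x - y))" by (rule conv_integrable[OF _ x])
    show "AE y in \<rho>. laplacian (laplacian w) (x - y) < 0"
      using AE_K by eventually_elim (use x in \<open>auto intro!: lap2\<close>)
    show "emeasure \<rho> (space \<rho>) \<noteq> 0" using \<rho>.emeasure_space_1 by simp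
  qed simp
  finally show ?thesis by simp
qed

lemma gradient_v: "gradient v x = g x"
proof (rule euclidean_eqI)
  fix b :: 'a assume b: "b \<in> Basis"
  show "gradient v x \<bullet> b = g x \<bullet> b"
    using gradient_inner_Basis[OF b, of v x] partial_deriv_eqI[OF v_has_derivative, of b x] by simp
qed

lemma v_line: "((\<lambda>s. v (s *\<^sub>R e)) has_real_derivative g (r *\<^sub>R e) \<bullet> e) (at r)"
  using line_has_derivative[of v r e] v_has_derivative unfolding gradient_v differentiable_def by blast

end

section \<open>The support has no gaps\<close>

context minimizer begin

lemma lap_v_radial:
  assumes d: "DIM('a) \<ge> 2" and x: "x \<notin> K" and xy: "norm x = norm y"
  shows "laplacian v x = laplacian v y"
proof (cases "x = 0")
  case True
  then show ?thesis using xy by simp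
next
  case False
  show ?thesis
  proof (rule laplacian_radial[OF open_compl_K v_Ck2 _ _ _ False xy])
    fix a b :: 'a assume ab: "norm a = norm b"
    show "b \<in> - K" if "a \<in> - K" using radial(2)[OF d ab] that by blast
    show "v a = v b" by (rule radial(1)[OF d ab])
  next
    show "x \<in> - K" using x by simp
  qed
qed

text \<open>The radial flux \<open>r^(d-1) \<partial>\<^sub>rv\<close> along the ray of direction \<open>e\<close>.\<close>

definition flux :: "'a \<Rightarrow> real \<Rightarrow> real" where
  "flux e s = s ^ (DIM('a) - 1) * (g (s *\<^sub>R e) \<bullet> e)"

text \<open>The radial flux of \<open>\<Delta>v\<close>. Its derivative is \<open>r^(d-1) \<Delta>\<^sup>2v\<close>.\<close>

definition lap_flux :: "'a \<Rightarrow> real \<Rightarrow> real" where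
  "lap_flux e s = s ^ (DIM('a) - 1) * (gradient (laplacian v) (s *\<^sub>R e) \<bullet> e)"

lemma flux_deriv:
  assumes "norm e = 1" "r *\<^sub>R e \<notin> K" "DIM('a) = 1 \<or> r > 0"
  shows "(flux e has_real_derivative r ^ (DIM('a) - 1) * laplacian v (r *\<^sub>R e)) (at r)"
proof -
  have "DIM('a) = 1 \<or> r > 0 \<and> (\<forall>x\<in>-K. \<forall>y\<in>-K. norm x = norm y \<longrightarrow> v x = v y)"
  proof (cases "DIM('a) = 1")
    case False
    then have "DIM('a) \<ge> 2" using DIM_positive[where 'a='a] by linarith
    then show ?thesis using radial(1) assms(3) False by blast
  qed simp
  from laplacian_along_line[OF open_compl_K v_Ck2 _ assms(1) this]
  show ?thesis using assms(2) unfolding flux_def[abs_def] gradient_v by simp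
qed

lemma lap_flux_deriv:
  assumes "norm e = 1" "r *\<^sub>R e \<notin> K" "DIM('a) = 1 \<or> r > 0"
  shows "(lap_flux e has_real_derivative r ^ (DIM('a) - 1) * laplacian (laplacian v) (r *\<^sub>R e)) (at r)"
proof -
  have "DIM('a) = 1 \<or> r > 0 \<and> (\<forall>x\<in>-K. \<forall>y\<in>-K. norm x = norm y \<longrightarrow> laplacian v x = laplacian v y)"
  proof (cases "DIM('a) = 1")
    case False
    then have "DIM('a) \<ge> 2" using DIM_positive[where 'a='a] by linarith
    then have "laplacian v x = laplacian v y" if "x \<in> - K" "norm x = norm y" for x y
      using lap_v_radial that by blast
    then show ?thesis using assms(3) False by blast
  qed simp
  from laplacian_along_line[OF open_compl_K lap_v_Ck _ assms(1) this]
  show ?thesis using assms(2) unfolding lap_flux_def[abs_def] by simp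
qed

lemma lap_line:
  assumes "r *\<^sub>R e \<notin> K"
  shows "((\<lambda>s. laplacian v (s *\<^sub>R e)) has_real_derivative gradient (laplacian v) (r *\<^sub>R e) \<bullet> e) (at r)"
proof (rule line_has_derivative)
  have "Ck_on (Suc 1) (laplacian v) (- K)" using lap_v_Ck by (simp add: numeral_2_eq_2)
  then show "laplacian v differentiable (at (r *\<^sub>R e))"
    using Ck_on_differentiable[OF open_compl_K] assms by blast
qed

lemma lap_flux_decreasing:
  assumes e: "norm e = 1" and rs: "r < s" and J: "\<And>q. q \<in> {r..s} \<Longrightarrow> q *\<^sub>R e \<notin> K \<and> (DIM('a) = 1 \<or> q > 0)"
  shows "lap_flux e s < lap_flux e r"
proof (rule strict_dec_of_neg_deriv[where J = "{r..s}" and f = "lap_flux e", OF _ _ order_refl rs])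
  fix q assume q: "q \<in> {r..s}"
  show "(lap_flux e has_real_derivative q ^ (DIM('a) - 1) * laplacian (laplacian v) (q *\<^sub>R e)) (at q)"
    using lap_flux_deriv[OF e] J[OF q] by blast
  have "q ^ (DIM('a) - 1) > 0" using J[OF q] by (cases "DIM('a) = 1") auto
  then show "q ^ (DIM('a) - 1) * laplacian (laplacian v) (q *\<^sub>R e) < 0"
    using lap_lap_v_neg J[OF q] by (simp add: mult_less_0_iff)
qed

lemma flux_cont: "continuous_on UNIV (flux e)"
  unfolding flux_def[abs_def]
  by (intro continuous_intros continuous_on_compose2[OF g_cont]) auto

lemma flux_tendsto: "(flux e \<longlongrightarrow> flux e a) (at a within S)"
  using flux_cont by (metis UNIV_I continuous_on_def tendsto_within_subset top_greatest)

lemma flux_zero: "a *\<^sub>R e \<in> K \<Longrightarrow> flux e a = 0"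
  by (simp add: flux_def g_zero_on_supp)

lemma line_cont: "continuous_on S (\<lambda>s. v (s *\<^sub>R e))"
  by (intro continuous_on_compose2[OF v_cont] continuous_intros) auto

text \<open>At a point of the support the flux vanishes and \<open>v\<close> is minimal within distance \<open>\<epsilon>\<close>.\<close>

lemma lap_nonneg_right_of_supp:
  assumes e: "norm e = 1" and a: "a *\<^sub>R e \<in> K" "DIM('a) = 1 \<or> a \<ge> 0" and ac: "a < c"
    and J: "\<And>q. q \<in> {a<..<c} \<Longrightarrow> q *\<^sub>R e \<notin> K"
  shows "\<exists>r. r \<in> {a<..<c} \<and> laplacian v (r *\<^sub>R e) \<ge> 0"
proof -
  define c' where "c' = min c (a + \<epsilon>)"
  have c': "a < c'" "c' \<le> c" using ac \<epsilon> by (auto simp: c'_def)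
  have J': "q *\<^sub>R e \<notin> K" "DIM('a) = 1 \<or> q > 0" "q ^ (DIM('a) - 1) > 0" if "q \<in> {a<..<c'}" for q
  proof -
    show 1: "q *\<^sub>R e \<notin> K" using J that c' by auto
    show 2: "DIM('a) = 1 \<or> q > 0" using a(2) that by auto
    then show "q ^ (DIM('a) - 1) > 0" by (cases "DIM('a) = 1") auto
  qed
  have "\<exists>r. r \<in> {a<..<c'} \<and> laplacian v (r *\<^sub>R e) \<ge> 0"
  proof (rule nonneg_near_left_end[where m = "flux e" and p = "\<lambda>r. r ^ (DIM('a) - 1)" and v = "\<lambda>s. v (s *\<^sub>R e)", OF c'(1)])
    fix r assume r: "r \<in> {a<..<c'}"
    note J'' = J'[OF r]
    show "(flux e has_real_derivative r ^ (DIM('a) - 1) * laplacian v (r *\<^sub>R e)) (at r)"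
      by (rule flux_deriv[OF e J''(1,2)])
    show "r ^ (DIM('a) - 1) > 0" by (rule J''(3))
    have "flux e r / r ^ (DIM('a) - 1) = g (r *\<^sub>R e) \<bullet> e" unfolding flux_def
      by (rule nonzero_mult_div_cancel_left) (use J''(3) in linarith)
    then show "((\<lambda>s. v (s *\<^sub>R e)) has_real_derivative flux e r / r ^ (DIM('a) - 1)) (at r)"
      using v_line by simp
    have "norm ((r - a) *\<^sub>R e) < \<epsilon>" using r e by (auto simp: c'_def)
    from euler_lagrange[OF a(1) this] show "v (a *\<^sub>R e) \<le> v (r *\<^sub>R e)" by (simp add: algebra_simps)
  next
    show "(flux e \<longlongrightarrow> 0) (at_right a)" using flux_tendsto[of e a] flux_zero[OF a(1)] by simp
  qed (rule line_cont)
  then show ?thesis using c' by auto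
qed

lemma lap_nonneg_left_of_supp:
  assumes e: "norm e = 1" and b: "b *\<^sub>R e \<in> K" and cb: "c < b" and c: "DIM('a) = 1 \<or> c \<ge> 0"
    and J: "\<And>q. q \<in> {c<..<b} \<Longrightarrow> q *\<^sub>R e \<notin> K"
  shows "\<exists>r. r \<in> {c<..<b} \<and> laplacian v (r *\<^sub>R e) \<ge> 0"
proof -
  define c' where "c' = max c (b - \<epsilon>)"
  have c': "c' < b" "c \<le> c'" using cb \<epsilon> by (auto simp: c'_def)
  have J': "q *\<^sub>R e \<notin> K" "DIM('a) = 1 \<or> q > 0" "q ^ (DIM('a) - 1) > 0" if "q \<in> {c'<..<b}" for q
  proof -
    show 1: "q *\<^sub>R e \<notin> K" using J that c' by auto
    show 2: "DIM('a) = 1 \<or> q > 0" using c that c' by auto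
    then show "q ^ (DIM('a) - 1) > 0" by (cases "DIM('a) = 1") auto
  qed
  have "\<exists>r. r \<in> {c'<..<b} \<and> laplacian v (r *\<^sub>R e) \<ge> 0"
  proof (rule nonneg_near_right_end[where m = "flux e" and p = "\<lambda>r. r ^ (DIM('a) - 1)" and v = "\<lambda>s. v (s *\<^sub>R e)", OF c'(1)])
    fix r assume r: "r \<in> {c'<..<b}"
    note J'' = J'[OF r]
    show "(flux e has_real_derivative r ^ (DIM('a) - 1) * laplacian v (r *\<^sub>R e)) (at r)"
      by (rule flux_deriv[OF e J''(1,2)])
    show "r ^ (DIM('a) - 1) > 0" by (rule J''(3))
    have "flux e r / r ^ (DIM('a) - 1) = g (r *\<^sub>R e) \<bullet> e" unfolding flux_def
      by (rule nonzero_mult_div_cancel_left) (use J''(3) in linarith)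
    then show "((\<lambda>s. v (s *\<^sub>R e)) has_real_derivative flux e r / r ^ (DIM('a) - 1)) (at r)"
      using v_line by simp
    have "norm ((r - b) *\<^sub>R e) < \<epsilon>" using r e by (auto simp: c'_def)
    from euler_lagrange[OF b this] show "v (b *\<^sub>R e) \<le> v (r *\<^sub>R e)" by (simp add: algebra_simps)
  next
    show "(flux e \<longlongrightarrow> 0) (at_left b)" using flux_tendsto[of e b] flux_zero[OF b] by simp
  qed (rule line_cont)
  then obtain r where "r \<in> {c'<..<b}" "laplacian v (r *\<^sub>R e) \<ge> 0" by blast
  then show ?thesis using c' by (intro exI[of _ r]) auto
qed

text \<open>The last premise covers two kinds of gaps: those between two points of the support, and, in
  dimension at least two, a gap around the origin. At the origin the flux vanishes because of its
  weight, and \<open>\<Delta>v\<close> decreases outwards, so its sign at the inner end is inherited from the outer end.\<close>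

lemma no_bounded_gap:
  assumes e: "norm e = 1" and ab: "a < b" and dim: "DIM('a) = 1 \<or> a \<ge> 0"
    and b: "b *\<^sub>R e \<in> K" and J: "\<And>q. q \<in> {a<..<b} \<Longrightarrow> q *\<^sub>R e \<notin> K"
    and a: "a *\<^sub>R e \<in> K \<or> a = 0 \<and> DIM('a) \<ge> 2 \<and> 0 \<notin> K"
  shows False
proof (rule no_gap[where m = "flux e" and p = "\<lambda>r. r ^ (DIM('a) - 1)" and u = "\<lambda>s. laplacian v (s *\<^sub>R e)"
      and ?u1.0 = "\<lambda>r. gradient (laplacian v) (r *\<^sub>R e) \<bullet> e", OF ab])
  have pos: "DIM('a) = 1 \<or> q > 0" if "q \<in> {a<..<b}" for q using dim that by auto
  show "(flux e has_real_derivative r ^ (DIM('a) - 1) * laplacian v (r *\<^sub>R e)) (at r)" if "r \<in> {a<..<b}" for r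
    by (rule flux_deriv[OF e J[OF that] pos[OF that]])
  show "((\<lambda>s. laplacian v (s *\<^sub>R e)) has_real_derivative gradient (laplacian v) (r *\<^sub>R e) \<bullet> e) (at r)"
    if "r \<in> {a<..<b}" for r by (rule lap_line[OF J[OF that]])
  show "r ^ (DIM('a) - 1) > 0" if "r \<in> {a<..<b}" for r using pos[OF that] by (cases "DIM('a) = 1") auto
  have dec: "lap_flux e s < lap_flux e r" if "r \<in> {a<..<b}" "s \<in> {a<..<b}" "r < s" for r s
    by (rule lap_flux_decreasing[OF e that(3)]) (use that J pos in auto)
  show "s ^ (DIM('a) - 1) * (gradient (laplacian v) (s *\<^sub>R e) \<bullet> e) < r ^ (DIM('a) - 1) * (gradient (laplacian v) (r *\<^sub>R e) \<bullet> e)"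
    if "r \<in> {a<..<b}" "s \<in> {a<..<b}" "r < s" for r s
    using dec[OF that] unfolding lap_flux_def .
  have right: "\<exists>r. r \<in> {c<..<b} \<and> laplacian v (r *\<^sub>R e) \<ge> 0" if c: "c \<in> {a<..<b}" for c
    by (rule lap_nonneg_left_of_supp[OF e b]) (use c dim J in auto)
  then show "\<exists>r. r \<in> {c<..<b} \<and> laplacian v (r *\<^sub>R e) \<ge> 0" if c: "c \<in> {a<..<b}" for c using that .
  show "(flux e \<longlongrightarrow> 0) (at_left b)" using flux_tendsto[of e b] flux_zero[OF b] by simp
  show "(flux e \<longlongrightarrow> 0) (at_right a)"
  proof -
    have "flux e a = 0"
      using a by (auto simp: flux_zero) (simp add: flux_def)
    then show ?thesis using flux_tendsto[of e a] by simp
  qed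
  fix c assume c: "c \<in> {a<..<b}"
  show "\<exists>r. r \<in> {a<..<c} \<and> laplacian v (r *\<^sub>R e) \<ge> 0"
  proof (cases "a *\<^sub>R e \<in> K")
    case True
    show ?thesis by (rule lap_nonneg_right_of_supp[OF e True dim]) (use c J in auto)
  next
    case False
    then have a0: "a = 0" and d: "DIM('a) \<ge> 2" and 0: "0 \<notin> K" using a by auto
    \<comment> \<open>near the origin the flux of the Laplacian is small, so the Laplacian decreases from there on\<close>
    have "continuous_on (- K) (gradient (laplacian v))"
      unfolding gradient_def
      by (intro continuous_intros Ck_on_continuous[of 1] Ck_on_partial) (use lap_v_Ck in \<open>simp add: numeral_2_eq_2\<close>)
    then have "isCont (gradient (laplacian v)) 0"
      using 0 open_compl_K by (simp add: continuous_on_eq_continuous_at)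
    then have "((\<lambda>s. gradient (laplacian v) (s *\<^sub>R e)) \<longlongrightarrow> gradient (laplacian v) 0) (at_right 0)"
      by (rule isCont_tendsto_compose) (auto intro!: tendsto_eq_intros)
    then have "(lap_flux e \<longlongrightarrow> 0 ^ (DIM('a) - 1) * (gradient (laplacian v) 0 \<bullet> e)) (at_right 0)"
      unfolding lap_flux_def[abs_def] by (intro tendsto_intros)
    moreover have "(0::real) ^ (DIM('a) - 1) = 0" using d by simp
    ultimately have "(lap_flux e \<longlongrightarrow> 0) (at_right 0)"
      by (simp only: mult_zero_left)
    from tendsto_minus[OF this] have lim: "((\<lambda>s. - lap_flux e s) \<longlongrightarrow> 0) (at_right 0)" by simp
    have neg: "lap_flux e s < 0" if "s \<in> {0<..<b}" for s
    proof -
      have "- lap_flux e s > 0"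
        by (rule increasing_from_right_limit[OF lim that]) (simp add: dec a0)
      then show ?thesis by simp
    qed
    obtain t where t: "t \<in> {c<..<b}" "laplacian v (t *\<^sub>R e) \<ge> 0" using right[OF c] by blast
    define r where "r = c / 2"
    have r: "0 < r" "r < c" using c a0 by (auto simp: r_def)
    have "laplacian v (t *\<^sub>R e) < laplacian v (r *\<^sub>R e)"
    proof (rule strict_dec_of_neg_deriv[where J = "{0<..<b}" and f = "\<lambda>s. laplacian v (s *\<^sub>R e)"])
      fix s assume s: "s \<in> {0<..<b}"
      show "((\<lambda>s. laplacian v (s *\<^sub>R e)) has_real_derivative gradient (laplacian v) (s *\<^sub>R e) \<bullet> e) (at s)"
        by (rule lap_line[OF J]) (use s a0 in auto)
      show "gradient (laplacian v) (s *\<^sub>R e) \<bullet> e < 0"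
        using neg[OF s] s unfolding lap_flux_def by (simp add: mult_less_0_iff not_less)
    qed (use r t in auto)
    then show ?thesis using t r a0 by (intro exI[of _ r]) auto
  qed
qed

lemma outer_monotone:
  assumes lap_pos: "\<And>x. norm x > R \<Longrightarrow> laplacian w x > 0"
    and e: "norm e = 1" and a: "a *\<^sub>R e \<in> K" "DIM('a) = 1 \<or> a \<ge> 0"
    and J: "\<And>q. a < q \<Longrightarrow> q *\<^sub>R e \<notin> K" and ar: "a \<le> r"
  shows "v (a *\<^sub>R e) \<le> v (r *\<^sub>R e)"
proof (rule increasing_beyond[where m = "flux e" and p = "\<lambda>r. r ^ (DIM('a) - 1)" and u = "\<lambda>s. laplacian v (s *\<^sub>R e)"
      and ?u1.0 = "\<lambda>r. gradient (laplacian v) (r *\<^sub>R e) \<bullet> e" and v = "\<lambda>s. v (s *\<^sub>R e)", OF _ _ _ _ _ _ _ _ _ ar])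
  have pos: "DIM('a) = 1 \<or> q > 0" if "q \<in> {a<..}" for q using a(2) that by auto
  have J': "q *\<^sub>R e \<notin> K" if "q \<in> {a<..}" for q using J that by auto
  show p: "r ^ (DIM('a) - 1) > 0" if "r \<in> {a<..}" for r using pos[OF that] by (cases "DIM('a) = 1") auto
  show "(flux e has_real_derivative r ^ (DIM('a) - 1) * laplacian v (r *\<^sub>R e)) (at r)" if "r \<in> {a<..}" for r
    by (rule flux_deriv[OF e J'[OF that] pos[OF that]])
  show "((\<lambda>s. v (s *\<^sub>R e)) has_real_derivative flux e r / r ^ (DIM('a) - 1)) (at r)" if "r \<in> {a<..}" for r
  proof -
    have "flux e r / r ^ (DIM('a) - 1) = g (r *\<^sub>R e) \<bullet> e" unfolding flux_def
      by (rule nonzero_mult_div_cancel_left) (use p[OF that] in linarith)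
    then show ?thesis using v_line by simp
  qed
  show "((\<lambda>s. laplacian v (s *\<^sub>R e)) has_real_derivative gradient (laplacian v) (r *\<^sub>R e) \<bullet> e) (at r)"
    if "r \<in> {a<..}" for r by (rule lap_line[OF J'[OF that]])
  show "s ^ (DIM('a) - 1) * (gradient (laplacian v) (s *\<^sub>R e) \<bullet> e) < r ^ (DIM('a) - 1) * (gradient (laplacian v) (r *\<^sub>R e) \<bullet> e)"
    if "r \<in> {a<..}" "s \<in> {a<..}" "r < s" for r s
    unfolding lap_flux_def[symmetric]
    by (rule lap_flux_decreasing[OF e that(3)]) (use that J' pos in auto)
  show "\<exists>r. r \<in> {a<..<c} \<and> laplacian v (r *\<^sub>R e) \<ge> 0" if "c \<in> {a<..}" for c
    by (rule lap_nonneg_right_of_supp[OF e a]) (use that J in auto)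
  show "(flux e \<longlongrightarrow> 0) (at_right a)" using flux_tendsto[of e a] flux_zero[OF a(1)] by simp
  show "continuous_on {a..} (\<lambda>s. v (s *\<^sub>R e))" by (rule line_cont)
  show "\<exists>r>c. laplacian v (r *\<^sub>R e) \<ge> 0" for c
  proof (intro exI conjI)
    \<comment> \<open>at this distance all differences \<open>r *\<^sub>R e - y\<close> with \<open>y\<close> in the support have norm greater than \<open>R\<close>\<close>
    define r where "r = \<bar>c\<bar> + \<bar>a\<bar> + \<bar>R\<bar> + B + 1"
    show "c < r" using B_nonneg by (simp add: r_def)
    have "a < r" using B_nonneg by (simp add: r_def)
    then have x: "r *\<^sub>R e \<notin> K" by (rule J)
    have nr: "norm (r *\<^sub>R e) = r" using B_nonneg e by (simp add: r_def)
    show "laplacian v (r *\<^sub>R e) \<ge> 0"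
      unfolding lap_v[OF x] conv_def
    proof (rule integral_nonneg_AE)
      show "AE y in \<rho>. 0 \<le> laplacian w (r *\<^sub>R e - y)"
        using bounded
      proof eventually_elim
        case (elim y)
        have "norm (r *\<^sub>R e - y) \<ge> r - B" using norm_triangle_ineq2[of "r *\<^sub>R e" y] nr elim by linarith
        then have "norm (r *\<^sub>R e - y) > R" using B_nonneg by (simp add: r_def)
        then show ?case using lap_pos by (simp add: less_imp_le)
      qed
    qed
  qed
qed

text \<open>The gradient of \<open>v\<close> vanishes on the support.\<close>

lemma line_constant_on_supp:
  assumes "\<And>q. a \<le> q \<Longrightarrow> q \<le> b \<Longrightarrow> q *\<^sub>R e \<in> K" "a \<le> r" "r \<le> b"
  shows "v (r *\<^sub>R e) = v (b *\<^sub>R e)"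
proof (cases "r = b")
  case False
  then have rb: "r < b" using assms(3) by simp
  have "\<exists>z. r < z \<and> z < b \<and> v (b *\<^sub>R e) - v (r *\<^sub>R e) = (b - r) * (g (z *\<^sub>R e) \<bullet> e)"
    by (rule MVT2[OF rb]) (rule v_line)
  then obtain z where z: "r < z" "z < b" "v (b *\<^sub>R e) - v (r *\<^sub>R e) = (b - r) * (g (z *\<^sub>R e) \<bullet> e)" by blast
  then have "z *\<^sub>R e \<in> K" using assms by auto
  then show ?thesis using z(3) by (simp add: g_zero_on_supp)
qed simp

text \<open>Once gaps are excluded, the support meets the ray (the line, in dimension one) in a single interval, which for a ray
  starts at the origin. The potential is constant there and increases beyond it.\<close>

lemma potential_minimal_on_supp:
  assumes lap_pos: "\<And>x. norm x > R \<Longrightarrow> laplacian w x > 0"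
  obtains C where "\<And>x. x \<in> K \<Longrightarrow> v x = C" "\<And>x. C \<le> v x"
proof -
  define e :: 'a where "e = (SOME b. b \<in> Basis)"
  have eB: "e \<in> Basis" unfolding e_def by (rule SOME_Basis)
  then have e: "norm e = 1" by simp
  define I where "I = (\<lambda>s. s *\<^sub>R e) -` K"
  have Iclosed: "closed I" unfolding I_def
    by (rule closed_vimage[OF measure_supp_closed]) (intro continuous_intros)
  have Ibounded: "I \<subseteq> {-B..B}"
  proof
    fix s assume "s \<in> I"
    then have "norm (s *\<^sub>R e) \<le> B" using K_subset by (auto simp: I_def)
    then show "s \<in> {-B..B}" using e by auto
  qed
  have minmax: "\<exists>x\<in>A. \<forall>y\<in>A. x \<le> y" "\<exists>x\<in>A. \<forall>y\<in>A. y \<le> x" if "A = I \<inter> F" "closed F" "A \<noteq> {}" for A F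
  proof -
    have "compact A" using that Iclosed Ibounded bounded_subset[of "{-B..B}" A]
      by (auto simp: compact_eq_bounded_closed)
    then show "\<exists>x\<in>A. \<forall>y\<in>A. x \<le> y" "\<exists>x\<in>A. \<forall>y\<in>A. y \<le> x"
      using compact_attains_inf compact_attains_sup that(3) by blast+
  qed
  show ?thesis
  proof (cases "DIM('a) = 1")
    case True
    have Be: "Basis = {e}" using True eB by (metis card_1_singletonE singletonD)
    have repr: "x = (x \<bullet> e) *\<^sub>R e" for x :: 'a using euclidean_representation[of x] unfolding Be by simp
    have memI: "x \<in> K \<longleftrightarrow> x \<bullet> e \<in> I" for x unfolding I_def using repr[of x] by simp
    have "I \<noteq> {}" using K_nonempty memI by blast
    then obtain R0 R1 where R0: "R0 \<in> I" "\<And>s. s \<in> I \<Longrightarrow> s \<le> R0" and R1: "R1 \<in> I" "\<And>s. s \<in> I \<Longrightarrow> R1 \<le> s"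
      using minmax[of I UNIV] by auto
    have full: "r *\<^sub>R e \<in> K" if r: "R1 \<le> r" "r \<le> R0" for r
    proof (rule ccontr)
      assume "r *\<^sub>R e \<notin> K"
      then have rI: "r \<notin> I" by (simp add: I_def)
      obtain b where b: "b \<in> I" "b \<ge> r" "\<And>s. s \<in> I \<Longrightarrow> s \<ge> r \<Longrightarrow> b \<le> s"
        using minmax(1)[of "I \<inter> {r..}" "{r..}"] R0(1) r by auto
      obtain a where a: "a \<in> I" "a \<le> r" "\<And>s. s \<in> I \<Longrightarrow> s \<le> r \<Longrightarrow> s \<le> a"
        using minmax(2)[of "I \<inter> {..r}" "{..r}"] R1(1) r by auto
      have ab: "a < r" "r < b" using a(1,2) b(1,2) rI by (metis order_le_less)+
      show False
      proof (rule no_bounded_gap[OF e])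
        show "a < b" using ab by simp
        show "q *\<^sub>R e \<notin> K" if "q \<in> {a<..<b}" for q
        proof
          assume "q *\<^sub>R e \<in> K"
          then have "q \<in> I" by (simp add: I_def)
          then show False using a(3)[of q] b(3)[of q] that by (cases "q \<le> r") auto
        qed
      qed (use a b True in \<open>auto simp: I_def\<close>)
    qed
    show ?thesis
    proof (rule that[of "v (R0 *\<^sub>R e)"])
      have const: "v (r *\<^sub>R e) = v (R0 *\<^sub>R e)" if "R1 \<le> r" "r \<le> R0" for r
        by (rule line_constant_on_supp[OF full that])
      show "v x = v (R0 *\<^sub>R e)" if "x \<in> K" for x
        using const[of "x \<bullet> e"] R0(2) R1(2) memI[of x] that repr[of x] by simp
      fix x :: 'a
      consider "x \<bullet> e > R0" | "x \<bullet> e < R1" | "R1 \<le> x \<bullet> e" "x \<bullet> e \<le> R0" by linarith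
      then show "v (R0 *\<^sub>R e) \<le> v x"
      proof cases
        case 1
        have "v (R0 *\<^sub>R e) \<le> v ((x \<bullet> e) *\<^sub>R e)"
          by (rule outer_monotone[OF lap_pos e]) (use 1 R0 True in \<open>force simp: I_def\<close>)+
        then show ?thesis using repr[of x] by simp
      next
        case 2
        \<comment> \<open>the left half line is the ray of direction \<open>- e\<close>\<close>
        have "v ((- R1) *\<^sub>R (- e)) \<le> v ((- (x \<bullet> e)) *\<^sub>R (- e))"
        proof (rule outer_monotone[OF lap_pos])
          show "norm (- e) = 1" using e by simp
          show "- R1 *\<^sub>R - e \<in> K" using R1 by (simp add: I_def)
          show "q *\<^sub>R - e \<notin> K" if "- R1 < q" for q
          proof
            assume "q *\<^sub>R - e \<in> K"
            then have "- q \<in> I" by (simp add: I_def)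
            then show False using R1(2) that by force
          qed
        qed (use 2 True in auto)
        then show ?thesis using repr[of x] const[of R1] R0(2)[OF R1(1)] by simp
      next
        case 3
        then show ?thesis using const[of "x \<bullet> e"] repr[of x] by simp
      qed
    qed
  next
    case False
    then have d: "DIM('a) \<ge> 2" using DIM_positive[where 'a='a] by linarith
    have nrm: "norm (norm x *\<^sub>R e) = norm x" for x :: 'a using e by simp
    have vr: "v x = v (norm x *\<^sub>R e)" for x by (rule radial(1)[OF d nrm[symmetric]])
    have memI: "x \<in> K \<longleftrightarrow> norm x \<in> I" for x
      unfolding I_def using radial(2)[OF d nrm[symmetric], of x] by simp
    obtain x1 where "x1 \<in> K" using K_nonempty by blast
    then have "norm x1 \<in> I \<inter> {0..}" using memI by simp
    then have ne: "I \<inter> {0..} \<noteq> {}" by blast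
    obtain R0 where R0: "R0 \<in> I" "0 \<le> R0" "\<And>s. s \<in> I \<Longrightarrow> 0 \<le> s \<Longrightarrow> s \<le> R0"
      using minmax(2)[OF refl closed_atLeast ne] by auto
    have full: "r *\<^sub>R e \<in> K" if r: "0 \<le> r" "r \<le> R0" for r
    proof (rule ccontr)
      assume "r *\<^sub>R e \<notin> K"
      then have rI: "r \<notin> I" by (simp add: I_def)
      obtain b where b: "b \<in> I" "b \<ge> r" "\<And>s. s \<in> I \<Longrightarrow> s \<ge> r \<Longrightarrow> b \<le> s"
        using minmax(1)[of "I \<inter> {r..}" "{r..}"] R0(1) r by auto
      have rb: "r < b" using b rI by (metis order_le_less)
      show False
      proof (cases "I \<inter> {0..r} = {}")
        case True
        show False
        proof (rule no_bounded_gap[OF e, of 0 b])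
          show "q *\<^sub>R e \<notin> K" if "q \<in> {0<..<b}" for q
          proof
            assume "q *\<^sub>R e \<in> K"
            then have "q \<in> I" by (simp add: I_def)
            then show False using True b(3)[of q] that by (cases "q \<le> r") auto
          qed
          have "0 \<notin> I" using True r by auto
          then show "0 *\<^sub>R e \<in> K \<or> 0 = (0::real) \<and> 2 \<le> DIM('a) \<and> 0 \<notin> K" using d by (simp add: I_def)
        qed (use b rb r in \<open>auto simp: I_def\<close>)
      next
        case False
        obtain a where "a \<in> I \<inter> {0..r}" "\<forall>s\<in>I \<inter> {0..r}. s \<le> a"
          using minmax(2)[OF refl closed_atLeastAtMost False] by blast
        then have a: "a \<in> I" "0 \<le> a" "a \<le> r" "\<And>s. s \<in> I \<Longrightarrow> 0 \<le> s \<Longrightarrow> s \<le> r \<Longrightarrow> s \<le> a"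
          by simp_all
        have ar: "a < r" using a rI by (metis order_le_less)
        show False
        proof (rule no_bounded_gap[OF e, of a b])
          show "q *\<^sub>R e \<notin> K" if "q \<in> {a<..<b}" for q
          proof
            assume "q *\<^sub>R e \<in> K"
            then have "q \<in> I" by (simp add: I_def)
            then show False using a(2) a(4)[of q] b(3)[of q] that by (cases "q \<le> r") auto
          qed
        qed (use a b ar rb in \<open>auto simp: I_def\<close>)
      qed
    qed
    show ?thesis
    proof (rule that[of "v (R0 *\<^sub>R e)"])
      have const: "v (r *\<^sub>R e) = v (R0 *\<^sub>R e)" if "0 \<le> r" "r \<le> R0" for r
        by (rule line_constant_on_supp[OF full that])
      show "v x = v (R0 *\<^sub>R e)" if "x \<in> K" for x
        using const[of "norm x"] R0(3)[of "norm x"] memI[of x] that vr[of x] by simp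
      fix x :: 'a
      show "v (R0 *\<^sub>R e) \<le> v x"
      proof (cases "norm x \<le> R0")
        case True
        then show ?thesis using const[of "norm x"] vr[of x] by simp
      next
        case False
        have "v (R0 *\<^sub>R e) \<le> v (norm x *\<^sub>R e)"
        proof (rule outer_monotone[OF lap_pos e])
          show "q *\<^sub>R e \<notin> K" if "R0 < q" for q
            using R0(2) R0(3)[of q] that by (auto simp: I_def)
        qed (use False R0 in \<open>auto simp: I_def\<close>)
        then show ?thesis using vr[of x] by simp
      qed
    qed
  qed
qed

text \<open>With \<open>a = mutual \<rho> \<rho> = C\<close>, \<open>b = mutual \<nu> \<nu> \<le> C\<close> and a cross term of at least \<open>C\<close>, the
  mixture with weights one half has mutual energy at least \<open>3/4 C + 1/4 b\<close>, whereas strict convexity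
  makes it smaller than \<open>1/2 C + 1/2 b\<close>; together these give \<open>b > C\<close>.\<close>

lemma energy_less_competitor:
  assumes v: "\<And>x. x \<in> K \<Longrightarrow> v x = C" "\<And>x. C \<le> v x"
    and \<nu>: "\<nu> \<in> borel_prob2" "center_of_mass \<nu> = 0" "\<nu> \<noteq> \<rho>"
  shows "energy W \<rho> < energy W \<nu>"
proof (rule ccontr)
  assume "\<not> energy W \<rho> < energy W \<nu>"
  then have le: "energy W \<nu> \<le> energy W \<rho>" by simp
  have \<nu>p: "\<nu> \<in> borel_prob" using \<nu>(1) unfolding borel_prob2_def by simp
  note n = borel_probD[OF \<nu>p]
  interpret N: prob_space \<nu> by (rule n)
  have C0: "C \<ge> 0" using K_nonempty v(1) v_nonneg by (metis all_not_in_conv)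
  have "mutual k \<rho> \<rho> = (\<integral>\<^sup>+x. ennreal C \<partial>\<rho>)"
    unfolding mutual_pot by (rule nn_integral_cong_AE) (use AE_K in eventually_elim, simp add: v(1))
  then have a: "mutual k \<rho> \<rho> = ennreal C" using \<rho>.emeasure_space_1 by simp
  have le': "mutual k \<nu> \<nu> \<le> ennreal C" using le unfolding energy_mutual half_le_iff a .
  then obtain b where b: "mutual k \<nu> \<nu> = ennreal b" "0 \<le> b" "b \<le> C"
    using C0 by (metis ennreal_cases ennreal_le_iff top.extremum_unique ennreal_neq_top)
  have "mutual k \<nu> \<rho> \<ge> (\<integral>\<^sup>+x. ennreal C \<partial>\<nu>)"
    unfolding mutual_pot by (intro nn_integral_mono ennreal_leI v(2))
  then have "mutual k \<nu> \<rho> \<ge> ennreal C" using N.emeasure_space_1 by simp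
  then have c: "mutual k \<rho> \<nu> \<ge> ennreal C" by (simp add: mutual_sym[OF \<rho>_prob \<nu>p])
  have fin: "energy W \<rho> < \<infinity>"
    using a unfolding energy_mutual by (simp add: ennreal_divide_eq_top_iff less_top[symmetric])
  have "strictly_convex_on {0..1} (\<lambda>t. energy W (mix_measure t \<rho> \<nu>))"
    using lic \<rho>_prob2 \<nu> com fin le_less_trans[OF le fin] unfolding LIC_def by auto
  then have "energy W (mix_measure ((1 - 1/2) * 0 + (1/2) * 1) \<rho> \<nu>)
    < ennreal (1 - 1/2) * energy W (mix_measure 0 \<rho> \<nu>) + ennreal (1/2) * energy W (mix_measure 1 \<rho> \<nu>)"
    unfolding strictly_convex_on_def by (elim ballE[where x = 0] ballE[where x = 1] allE[where x = "1/2"]) auto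
  moreover have "mix_measure 0 \<rho> \<nu> = \<rho>" "mix_measure 1 \<rho> \<nu> = \<nu>"
    using n by (auto intro!: measure_eqI simp: emeasure_mix_measure)
  ultimately have lt: "energy W (mix_measure (1/2) \<rho> \<nu>) < ennreal (1/2) * (ennreal C / 2) + ennreal (1/2) * (ennreal b / 2)"
    by (simp add: energy_mutual[of \<rho>] energy_mutual[of \<nu>] a b(1))
  have avg: "ennreal (1/2) * ennreal x + ennreal (1/2) * ennreal y = ennreal ((x + y) / 2)"
    if "0 \<le> x" "0 \<le> y" for x y :: real
  proof -
    have "ennreal (1/2) * ennreal x + ennreal (1/2) * ennreal y = ennreal (1/2 * x) + ennreal (1/2 * y)"
      using that by (simp only: ennreal_mult[of "1/2" x] ennreal_mult[of "1/2" y])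
    also have "\<dots> = ennreal (1/2 * x + 1/2 * y)" using that by (intro ennreal_plus[symmetric]) auto
    finally show ?thesis by (simp add: field_simps)
  qed
  have half: "ennreal x / 2 = ennreal (x / 2)" if "0 \<le> x" for x
    using that divide_ennreal[of x 2] by simp
  have "ennreal (((C + C) / 2 + (C + b) / 2) / 2)
      = ennreal (1/2) * (ennreal (1/2) * ennreal C + ennreal (1/2) * ennreal C)
       + ennreal (1/2) * (ennreal (1/2) * ennreal C + ennreal (1/2) * ennreal b)"
    using C0 b by (simp only: avg add_nonneg_nonneg divide_nonneg_pos zero_less_numeral)
  also have "\<dots> \<le> mutual k (mix_measure (1/2) \<rho> \<nu>) (mix_measure (1/2) \<rho> \<nu>)"
    unfolding mutual_mix[OF \<rho>_prob \<nu>p] a b(1)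
    by (intro add_mono mult_mono) (use c in auto)
  finally have le2: "ennreal (((C + C) / 2 + (C + b) / 2) / 2) / 2 \<le> energy W (mix_measure (1/2) \<rho> \<nu>)"
    unfolding energy_mutual by (rule divide_right_mono_ennreal)
  have "ennreal (1/2) * (ennreal C / 2) + ennreal (1/2) * (ennreal b / 2) = ennreal ((C / 2 + b / 2) / 2)"
    unfolding half[OF C0] half[OF b(2)] using C0 b by (intro avg) auto
  moreover have "ennreal (((C + C) / 2 + (C + b) / 2) / 2) / 2 = ennreal ((((C + C) / 2 + (C + b) / 2) / 2) / 2)"
    using C0 b by (intro half) auto
  ultimately have "ennreal ((((C + C) / 2 + (C + b) / 2) / 2) / 2) < ennreal ((C / 2 + b / 2) / 2)"
    using le_less_trans[OF le2 lt] by simp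
  then have "(((C + C) / 2 + (C + b) / 2) / 2) / 2 < (C / 2 + b / 2) / 2"
    using C0 b by (subst (asm) ennreal_less_iff) auto
  then show False using b by (simp add: field_simps)
qed

end

theorem theorem4p1:
  fixes W :: "'a::euclidean_space \<Rightarrow> ereal" and w :: "'a \<Rightarrow> real" and \<rho> :: "'a measure"
  defines "w \<equiv> (\<lambda>x. real_of_ereal (W x))"
  assumes "hypothesis_Hs W"
    and "Ck_on 4 w (- {0})"
    and "radially_symmetric W"
    and "LIC W"
    and "\<forall>x. x \<noteq> 0 \<longrightarrow> laplacian (laplacian w) x < 0"
    and "\<exists>R. \<forall>x. norm x > R \<longrightarrow> laplacian w x > 0"
    and "\<rho> \<in> borel_prob" and "compactly_supported \<rho>"
    and "d_infty_local_minimizer W \<rho>"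
    and "center_of_mass \<rho> = 0"
    and "grad_conv_continuous w \<rho>"
  shows "is_arg_min (energy W) (\<lambda>\<nu>. \<nu> \<in> borel_prob2 \<and> center_of_mass \<nu> = 0) \<rho> \<and>
    (\<forall>\<nu>. is_arg_min (energy W) (\<lambda>\<nu>. \<nu> \<in> borel_prob2 \<and> center_of_mass \<nu> = 0) \<nu> \<longrightarrow> \<nu> = \<rho>)"
proof -
  define k where "k = (\<lambda>x. e2ennreal (W x))"
  have Wnn: "0 \<le> W x" for x using assms(2) unfolding hypothesis_Hs_def by blast
  have Wlsc: "W x \<le> Liminf (at x) W" for x using assms(2) unfolding hypothesis_Hs_def by blast
  have Wcases: "real_continuous_on (- {0}) W \<and> W 0 = \<infinity> \<or> real_continuous_on UNIV W"
    using assms(2) unfolding hypothesis_Hs_def by blast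
  have Wint: "(\<integral>\<^sup>+x\<in>A. e2ennreal (W x) \<partial>lborel) < \<infinity>" if "compact A" for A
    using assms(2) that unfolding hypothesis_Hs_def by blast
  have Wsym: "W (- x) = W x" for x using assms(2) unfolding hypothesis_Hs_def by blast
  have Wmeas: "W \<in> borel_measurable borel" using assms(2) unfolding hypothesis_Hs_def by blast
  have Wavg: "\<exists>C>0. \<forall>x r. norm x \<le> R \<and> 0 < r \<and> r \<le> R \<longrightarrow>
        (\<integral>\<^sup>+y\<in>ball x r. e2ennreal (W y) \<partial>lborel) / emeasure lborel (ball x r)
          \<le> ennreal C * e2ennreal (W x)" if "R > 0" for R
    using assms(2) that unfolding hypothesis_Hs_def by blast
  \<comment> \<open>if \<open>W 0 = \<infinity>\<close>, lower semicontinuity makes \<open>W\<close> continuous at \<open>0\<close> as an extended real function\<close>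
  have Wcont: "continuous_on UNIV W"
    using Wcases
  proof
    assume W: "real_continuous_on (- {0}) W \<and> W 0 = \<infinity>"
    then have c: "continuous_on (- {0}) W" unfolding real_continuous_on_def by blast
    have "isCont W x" for x
    proof (cases "x = 0")
      case False
      moreover have "open (- {0::'a})" by auto
      ultimately show ?thesis using c by (simp add: continuous_on_eq_continuous_at)
    next
      case True
      have L: "Liminf (at 0) W = \<infinity>" using Wlsc[of 0] W by simp
      moreover have "Limsup (at 0) W = \<infinity>"
        using Liminf_le_Limsup[of "at (0::'a)" W] L by simp
      ultimately show ?thesis unfolding True isCont_def using W
        by (simp add: tendsto_iff_Liminf_eq_Limsup)
    qed
    then show ?thesis by (simp add: continuous_on_eq_continuous_at)
  next
    assume "real_continuous_on UNIV W"
    then show ?thesis unfolding real_continuous_on_def by blast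
  qed
  have kcont: "continuous_on UNIV k"
    unfolding k_def by (rule continuous_on_compose2[OF continuous_on_e2ennreal Wcont]) auto
  have kmeas: "k \<in> borel_measurable borel" using kcont by (rule borel_measurable_continuous_onI)
  have Wfin: "W x < \<infinity>" if "x \<noteq> 0" for x
  proof -
    have "x \<in> - {0}" "x \<in> UNIV" using that by auto
    then have "\<bar>W x\<bar> \<noteq> \<infinity>" using Wcases unfolding real_continuous_on_def
      by (elim disjE conjE; elim bspec)
    then show ?thesis by (cases "W x") auto
  qed
  have prob: "prob_space \<rho>" "sets \<rho> = sets borel" using borel_probD[OF assms(8)] by auto
  obtain B where B: "B \<ge> 0" "AE x in \<rho>. norm x \<le> B"
    using AE_compactly_supported[OF prob(2) assms(9)] by blast
  obtain g where g: "continuous_on UNIV g"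
    "AE x in lborel. integrable \<rho> (\<lambda>y. gradient w (x - y)) \<and> g x = (\<integral>y. gradient w (x - y) \<partial>\<rho>)"
    using assms(12) unfolding grad_conv_continuous_def by blast
  obtain \<epsilon> where \<epsilon>: "\<epsilon> > 0" "\<And>\<nu>. \<nu> \<in> borel_prob \<Longrightarrow> compactly_supported \<nu> \<Longrightarrow> d_infty \<rho> \<nu> < ennreal \<epsilon> \<Longrightarrow>
      energy W \<rho> \<le> energy W \<nu>"
    using assms(10) unfolding d_infty_local_minimizer_def by blast
  have Wrad: "W x = W y" if "norm x = norm y" for x y
    using assms(4) that unfolding radially_symmetric_def by blast
  interpret M: minimizer k w \<rho> B g W \<epsilon>
  proof (intro minimizer.intro kernel_density.intro kernel.intro kernel_density_axioms.intro minimizer_axioms.intro)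
    show "continuous_on UNIV k" by (rule kcont)
    show "k (- x) = k x" for x unfolding k_def Wsym ..
    show "w x = enn2real (k x)" for x
      unfolding w_def k_def enn2real_def using Wnn[of x] by (simp add: enn2ereal_e2ennreal)
    show "k x < \<infinity>" if "x \<noteq> 0" for x
      using Wfin[OF that] Wnn[of x] unfolding k_def by (cases "W x") auto
    show "(\<integral>\<^sup>+x\<in>ball 0 R. k x \<partial>lborel) < \<infinity>" for R
    proof -
      have "(\<integral>\<^sup>+x\<in>ball 0 R. k x \<partial>lborel) \<le> (\<integral>\<^sup>+x\<in>cball 0 R. e2ennreal (W x) \<partial>lborel)"
        unfolding k_def by (intro nn_integral_mono) (auto split: split_indicator)
      also have "\<dots> < \<infinity>" by (rule Wint) simp
      finally show ?thesis .
    qed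
    show "\<exists>C. \<forall>x r. norm x \<le> R \<and> 0 < r \<and> r \<le> R \<longrightarrow> (\<integral>\<^sup>+p. k (x + p) \<partial>ball_unif r) \<le> ennreal C * k x"
      if "R > 0" for R
      using Wavg[OF that] unfolding nn_integral_ball_unif[OF kmeas] unfolding k_def by blast
    show "Ck_on 4 w (- {0})" by (rule assms(3))
    show "w x = w y" if "norm x = norm y" for x y unfolding w_def using Wrad[OF that] by simp
    show "laplacian (laplacian w) x < 0" if "x \<noteq> 0" for x using assms(6) that by blast
    show "prob_space \<rho>" "sets \<rho> = sets borel" by (rule prob)+
    show "AE y in \<rho>. norm y \<le> B" by (rule B)
    show "continuous_on UNIV g" by (rule g)
    show "AE x in lborel. integrable \<rho> (\<lambda>y. gradient w (x - y)) \<and> g x = (\<integral>y. gradient w (x - y) \<partial>\<rho>)" by (rule g)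
    show "k x = e2ennreal (W x)" for x by (simp add: k_def)
    show "k x = k y" if "norm x = norm y" for x y unfolding k_def using Wrad[OF that] by simp
    show "0 \<le> B" by (rule B)
    show "LIC W" by (rule assms(5))
    show "center_of_mass \<rho> = 0" by (rule assms(11))
    show "\<epsilon> > 0" by (rule \<epsilon>)
    show "energy W \<rho> \<le> energy W \<nu>" if "\<nu> \<in> borel_prob" "compactly_supported \<nu>" "d_infty \<rho> \<nu> < ennreal \<epsilon>" for \<nu>
      using \<epsilon>(2) that by blast
  qed
  obtain R where R: "\<And>x. norm x > R \<Longrightarrow> laplacian w x > 0" using assms(7) by blast
  obtain C where C: "\<And>x. x \<in> measure_supp \<rho> \<Longrightarrow> M.v x = C" "\<And>x. C \<le> M.v x"
    using M.potential_minimal_on_supp[OF R] by blast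
  have less: "energy W \<rho> < energy W \<nu>" if "\<nu> \<in> borel_prob2" "center_of_mass \<nu> = 0" "\<nu> \<noteq> \<rho>" for \<nu>
    by (rule M.energy_less_competitor[OF C that])
  show ?thesis
    unfolding is_arg_min_def using less M.\<rho>_prob2 assms(11) by (metis order_less_asym less_irrefl)
qed

end
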